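(* Let $T>0$, let $u_0,b_0\in L^2(\mathbb{T}^2;\mathbb{R}^2)$ be divergence-free, and let $u,b\in C_w([0,T);L^2(\mathbb{T}^2;\mathbb{R}^2))$, $S\in L^1_{loc}(\mathbb{T}^2\times[0,T);\mathcal{S}^{2\times2})$ and $A\in L^1_{loc}(\mathbb{T}^2\times[0,T);\mathcal{A}^{2\times2})$ satisfy, in the sense of distributions, $$\operatorname{div}u=\operatorname{div}b=0,\qquad \partial_tu+\operatorname{div}S=0,\qquad \partial_tb+\operatorname{div}A=0,\qquad u(\cdot,0)=u_0,\ b(\cdot,0)=b_0,$$ together with $\int_{\mathbb{T}^2}u(x,t)\,dx=\int_{\mathbb{T}^2}b(x,t)\,dx=0$ for almost every $t\in[0,T)$. Suppose that $(u,b,S,A)(x,t)\in K^\Lambda$ for a.e. $(x,t)\in\mathbb{T}^2\times(0,T)$. Let $\Psi$ be the mean-zero stream function of $b$. Then the mean-square magnetic potential $\int_{\mathbb{T}^2}|\Psi(x,t)|^2\,dx$ is constant in $t\in[0,T)$.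
   Context: $\mathbb{T}^2=[0,1]^2$ is the flat torus; $\mathcal{S}^{2\times2}$ and $\mathcal{A}^{2\times2}$ are the symmetric and antisymmetric real $2\times2$ matrices; $(v\otimes w)_{ij}=v_iw_j$; $(\operatorname{div}M)_i=\sum_j\partial_jM_{ij}$. $v\in C_w([0,T);L^2(\mathbb{T}^2;\mathbb{R}^2))$ means that $v\in L^\infty_tL^2_x(\mathbb{T}^2\times[0,T);\mathbb{R}^2)$ and that $t_j\to t$ implies $v(\cdot,t_j)\rightharpoonup v(\cdot,t)$ weakly in $L^2$ for every $t\in[0,T)$ (similarly with $W^{1,2}$ in place of $L^2$). The equations with initial data are understood distributionally: for all $\varphi\in C_c^\infty(\mathbb{T}^2\times[0,T);\mathbb{R}^2)$, $\int_0^T\!\int_{\mathbb{T}^2}[u\cdot\partial_t\varphi+S:D\varphi]+\int_{\mathbb{T}^2}u_0\cdot\varphi(\cdot,0)=0$ and $\int_0^T\!\int_{\mathbb{T}^2}[b\cdot\partial_t\varphi+A:D\varphi]+\int_{\mathbb{T}^2}b_0\cdot\varphi(\cdot,0)=0$. Constraint set: $K=\{(u,b,S,A)\in\mathbb{R}^2\times\mathbb{R}^2\times\mathcal{S}^{2\times2}\times\mathcal{A}^{2\times2}: S=u\otimes u-b\otimes b+\Pi I \text{ for some }\Pi\in\mathbb{R},\ A=b\otimes u-u\otimes b\}$. Wave cone: $\Lambda$ is the set of $(u,b,S,A)\in\mathbb{R}^2\times\mathbb{R}^2\times\mathcal{S}^{2\times2}\times\mathcal{A}^{2\times2}$ for which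 there is $(\xi,c)\in(\mathbb{R}^2\setminus\{0\})\times\mathbb{R}$ with $S\xi+cu=0$, $A\xi+cb=0$, $u\cdot\xi=b\cdot\xi=0$. A function $f:\mathbb{R}^2\times\mathbb{R}^2\times\mathcal{S}^{2\times2}\times\mathcal{A}^{2\times2}\to\mathbb{R}$ is $\Lambda$-convex if $t\mapsto f(V+tW)$ is convex on $\mathbb{R}$ for every $V$ and every $W\in\Lambda$. The $\Lambda$-convex hull $K^\Lambda$ is the set of points $W$ such that $f(W)\le0$ for every $\Lambda$-convex $f$ with $f|_K\le0$. The mean-zero stream function of $b$ is the unique $\Psi\in C_w([0,T);W^{1,2}(\mathbb{T}^2))\cap C([0,T);L^2(\mathbb{T}^2))$ with $(\partial_2\Psi,-\partial_1\Psi)=b$ and $\int_{\mathbb{T}^2}\Psi(x,t)\,dx=0$ for every $t\in[0,T)$. *)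

theory Defs
  imports "HOL-Analysis.Analysis"
begin

section \<open>Function spaces on the flat torus\<close>

text \<open>
  A function on the torus is represented by a function on \<open>real^2\<close> of which only the values on
  the closed unit square matter; all integrals are taken over that square with respect to
  Lebesgue measure. Periodicity is imposed on the test functions only, which is what makes
  distributional derivatives derivatives on the torus. A time-dependent function
  is written \<open>v x t\<close>.
\<close>

definition torus :: "(real^2) set" where
  "torus = cbox 0 1"

definition L2 :: "(real^2 \<Rightarrow> 'b::euclidean_space) set" where
  "L2 = {f. f \<in> borel_measurable (lebesgue_on torus) \<and>
            integrable (lebesgue_on torus) (\<lambda>x. (norm (f x))\<^sup>2)}"

definition l2_inner :: "(real^2 \<Rightarrow> 'b::euclidean_space) \<Rightarrow> (real^2 \<Rightarrow> 'b) \<Rightarrow> real" where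
  "l2_inner f g = (LINT x|lebesgue_on torus. f x \<bullet> g x)"

definition l2_norm :: "(real^2 \<Rightarrow> 'b::euclidean_space) \<Rightarrow> real" where
  "l2_norm f = sqrt (l2_inner f f)"

definition L1_loc :: "real \<Rightarrow> 'b::euclidean_space set \<Rightarrow> (real^2 \<Rightarrow> real \<Rightarrow> 'b) set" where
  "L1_loc T X = {f.
     (\<lambda>(x, t). f x t) \<in> borel_measurable (lebesgue_on (torus \<times> {0..<T})) \<and>
     (AE (x, t) in lebesgue_on (torus \<times> {0..<T}). f x t \<in> X) \<and>
     (\<forall>T'<T. integrable (lebesgue_on (torus \<times> {0..T'})) (\<lambda>(x, t). f x t))}"


section \<open>Test functions\<close>

primrec Ck :: "nat \<Rightarrow> ('a::euclidean_space \<Rightarrow> 'b::euclidean_space) \<Rightarrow> bool" where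
  "Ck 0 f \<longleftrightarrow> continuous_on UNIV f"
| "Ck (Suc k) f \<longleftrightarrow>
     (\<forall>x. f differentiable (at x)) \<and> (\<forall>v. Ck k (\<lambda>x. frechet_derivative f (at x) v))"

definition smooth :: "('a::euclidean_space \<Rightarrow> 'b::euclidean_space) \<Rightarrow> bool" where
  "smooth f \<longleftrightarrow> (\<forall>k. Ck k f)"

definition periodic :: "(real^2 \<Rightarrow> 'b) \<Rightarrow> bool" where
  "periodic f \<longleftrightarrow> (\<forall>x i. f (x + axis i 1) = f x)"

definition torus_test :: "(real^2 \<Rightarrow> 'b::euclidean_space) set" where
  "torus_test = {\<psi>. smooth \<psi> \<and> periodic \<psi>}"

definition test_open :: "real \<Rightarrow> ((real^2) \<times> real \<Rightarrow> 'b::euclidean_space) set" where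
  "test_open T = {\<phi>. smooth \<phi> \<and> (\<forall>t. periodic (\<lambda>x. \<phi> (x, t))) \<and>
     (\<exists>a>0. \<exists>T'<T. \<forall>x t. t \<le> a \<or> T' \<le> t \<longrightarrow> \<phi> (x, t) = 0)}"

text \<open>
  Smoothness up to the initial time on the half-open cylinder \<open>torus \<times> {0..<T}\<close> is expressed by
  taking restrictions of functions that are smooth for all times. Compact support in the
  half-open cylinder imposes no condition at \<open>t = 0\<close>; the values at negative times
  are never used.
\<close>

definition test_halfopen :: "real \<Rightarrow> ((real^2) \<times> real \<Rightarrow> 'b::euclidean_space) set" where
  "test_halfopen T = {\<phi>. smooth \<phi> \<and> (\<forall>t. periodic (\<lambda>x. \<phi> (x, t))) \<and>
     (\<exists>T'<T. \<forall>x t. T' \<le> t \<longrightarrow> \<phi> (x, t) = 0)}"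

definition grad :: "(real^2 \<Rightarrow> real) \<Rightarrow> real^2 \<Rightarrow> real^2" where
  "grad \<psi> x = (\<chi> j. frechet_derivative \<psi> (at x) (axis j 1))"

definition dt :: "((real^2) \<times> real \<Rightarrow> 'b::euclidean_space) \<Rightarrow> (real^2) \<times> real \<Rightarrow> 'b" where
  "dt \<phi> z = frechet_derivative \<phi> (at z) (0, 1)"

definition dx :: "2 \<Rightarrow> ((real^2) \<times> real \<Rightarrow> 'b::euclidean_space) \<Rightarrow> (real^2) \<times> real \<Rightarrow> 'b" where
  "dx j \<phi> z = frechet_derivative \<phi> (at z) (axis j 1, 0)"

definition Dx :: "((real^2) \<times> real \<Rightarrow> real^2) \<Rightarrow> (real^2) \<times> real \<Rightarrow> real^2^2" where
  "Dx \<phi> z = (\<chi> i j. dx j \<phi> z $ i)"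


section \<open>Weak continuity in time\<close>

definition Cw_L2 :: "real \<Rightarrow> (real^2 \<Rightarrow> real \<Rightarrow> 'b::euclidean_space) set" where
  "Cw_L2 T = {v.
     (\<lambda>(x, t). v x t) \<in> borel_measurable (lebesgue_on (torus \<times> {0..<T})) \<and>
     (\<forall>t\<in>{0..<T}. (\<lambda>x. v x t) \<in> L2) \<and>
     (\<exists>C. AE t in lebesgue_on {0..<T}. l2_norm (\<lambda>x. v x t) \<le> C) \<and>
     (\<forall>t\<in>{0..<T}. \<forall>\<tau>. (\<forall>j. \<tau> j \<in> {0..<T}) \<longrightarrow> \<tau> \<longlonglongrightarrow> t \<longrightarrow>
        (\<forall>w\<in>L2. (\<lambda>j. l2_inner (\<lambda>x. v x (\<tau> j)) w) \<longlonglongrightarrow> l2_inner (\<lambda>x. v x t) w))}"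

definition C_L2 :: "real \<Rightarrow> (real^2 \<Rightarrow> real \<Rightarrow> 'b::euclidean_space) set" where
  "C_L2 T = {v. (\<forall>t\<in>{0..<T}. (\<lambda>x. v x t) \<in> L2) \<and>
     (\<forall>t\<in>{0..<T}. ((\<lambda>s. l2_norm (\<lambda>x. v x s - v x t)) \<longlongrightarrow> 0) (at t within {0..<T}))}"

definition has_weak_grad :: "(real^2 \<Rightarrow> real) \<Rightarrow> (real^2 \<Rightarrow> real^2) \<Rightarrow> bool" where
  "has_weak_grad f g \<longleftrightarrow> g \<in> L2 \<and>
     (\<forall>\<psi>\<in>torus_test. \<forall>i.
        (LINT x|lebesgue_on torus. f x * grad \<psi> x $ i) = - (LINT x|lebesgue_on torus. g x $ i * \<psi> x))"

definition W12 :: "(real^2 \<Rightarrow> real) set" where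
  "W12 = {f \<in> L2. \<exists>g. has_weak_grad f g}"

text \<open>The choice is immaterial: weak gradients are unique up to null sets.\<close>

definition weak_grad :: "(real^2 \<Rightarrow> real) \<Rightarrow> real^2 \<Rightarrow> real^2" where
  "weak_grad f = (SOME g. has_weak_grad f g)"

definition w12_inner :: "(real^2 \<Rightarrow> real) \<Rightarrow> (real^2 \<Rightarrow> real) \<Rightarrow> real" where
  "w12_inner f g = l2_inner f g + l2_inner (weak_grad f) (weak_grad g)"

definition w12_norm :: "(real^2 \<Rightarrow> real) \<Rightarrow> real" where
  "w12_norm f = sqrt (w12_inner f f)"

definition Cw_W12 :: "real \<Rightarrow> (real^2 \<Rightarrow> real \<Rightarrow> real) set" where
  "Cw_W12 T = {v.
     (\<lambda>(x, t). v x t) \<in> borel_measurable (lebesgue_on (torus \<times> {0..<T})) \<and>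
     (\<forall>t\<in>{0..<T}. (\<lambda>x. v x t) \<in> W12) \<and>
     (\<exists>C. AE t in lebesgue_on {0..<T}. w12_norm (\<lambda>x. v x t) \<le> C) \<and>
     (\<forall>t\<in>{0..<T}. \<forall>\<tau>. (\<forall>j. \<tau> j \<in> {0..<T}) \<longrightarrow> \<tau> \<longlonglongrightarrow> t \<longrightarrow>
        (\<forall>w\<in>W12. (\<lambda>j. w12_inner (\<lambda>x. v x (\<tau> j)) w) \<longlonglongrightarrow> w12_inner (\<lambda>x. v x t) w))}"


section \<open>The relaxed equations\<close>

definition div_free :: "(real^2 \<Rightarrow> real^2) \<Rightarrow> bool" where
  "div_free v \<longleftrightarrow> (\<forall>\<psi>\<in>torus_test. (LINT x|lebesgue_on torus. v x \<bullet> grad \<psi> x) = 0)"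

definition div_free_time :: "real \<Rightarrow> (real^2 \<Rightarrow> real \<Rightarrow> real^2) \<Rightarrow> bool" where
  "div_free_time T v \<longleftrightarrow> (\<forall>\<psi>\<in>test_open T.
     (LINT (x, t)|lebesgue_on (torus \<times> {0<..<T}). v x t \<bullet> (\<chi> j. dx j \<psi> (x, t))) = 0)"

text \<open>
  Distributional form of \<open>\<partial>\<^sub>t v + div M = 0\<close>, \<open>v(\<cdot>,0) = v0\<close>. The inner product on \<open>real^2^2\<close> is
  the Frobenius product \<open>M : D\<phi>\<close>.
\<close>

definition weak_evolution ::
    "real \<Rightarrow> (real^2 \<Rightarrow> real \<Rightarrow> real^2) \<Rightarrow> (real^2 \<Rightarrow> real \<Rightarrow> real^2^2) \<Rightarrow> (real^2 \<Rightarrow> real^2) \<Rightarrow> bool" where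
  "weak_evolution T v M v0 \<longleftrightarrow> (\<forall>\<phi>\<in>test_halfopen T.
     (LINT (x, t)|lebesgue_on (torus \<times> {0<..<T}).
        v x t \<bullet> dt \<phi> (x, t) + M x t \<bullet> Dx \<phi> (x, t))
     + (LINT x|lebesgue_on torus. v0 x \<bullet> \<phi> (x, 0)) = 0)"

definition is_stream_function ::
    "real \<Rightarrow> (real^2 \<Rightarrow> real \<Rightarrow> real^2) \<Rightarrow> (real^2 \<Rightarrow> real \<Rightarrow> real) \<Rightarrow> bool" where
  "is_stream_function T b \<Psi> \<longleftrightarrow> \<Psi> \<in> Cw_W12 T \<inter> C_L2 T \<and>
     (\<forall>t\<in>{0..<T}. AE x in lebesgue_on torus.
        vector [weak_grad (\<lambda>x. \<Psi> x t) x $ 2, - (weak_grad (\<lambda>x. \<Psi> x t) x $ 1)] = b x t) \<and>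
     (\<forall>t\<in>{0..<T}. (LINT x|lebesgue_on torus. \<Psi> x t) = 0)"


section \<open>Constraint set, wave cone and \<open>\<Lambda>\<close>-convex hull\<close>

type_synonym state = "(real^2) \<times> (real^2) \<times> (real^2^2) \<times> (real^2^2)"

definition sym_mat :: "(real^2^2) set" where
  "sym_mat = {S. transpose S = S}"

definition antisym_mat :: "(real^2^2) set" where
  "antisym_mat = {A. transpose A = - A}"

definition state_space :: "state set" where
  "state_space = UNIV \<times> UNIV \<times> sym_mat \<times> antisym_mat"

definition tensor :: "real^2 \<Rightarrow> real^2 \<Rightarrow> real^2^2" (infixl "\<otimes>" 75) where
  "v \<otimes> w = (\<chi> i j. v $ i * w $ j)"

definition constraint_set :: "state set" where
  "constraint_set = {(u, b, S, A). (u, b, S, A) \<in> state_space \<and>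
     (\<exists>p. S = u \<otimes> u - b \<otimes> b + p *\<^sub>R mat 1) \<and> A = b \<otimes> u - u \<otimes> b}"

definition wave_cone :: "state set" where
  "wave_cone = {(u, b, S, A). (u, b, S, A) \<in> state_space \<and>
     (\<exists>\<xi> c. \<xi> \<noteq> 0 \<and> S *v \<xi> + c *\<^sub>R u = 0 \<and> A *v \<xi> + c *\<^sub>R b = 0 \<and> u \<bullet> \<xi> = 0 \<and> b \<bullet> \<xi> = 0)}"

text \<open>Functions on the state space are total functions on \<open>state\<close>; only their values on
  \<open>state_space\<close> enter.\<close>

definition lambda_convex :: "(state \<Rightarrow> real) \<Rightarrow> bool" where
  "lambda_convex f \<longleftrightarrow>
     (\<forall>V\<in>state_space. \<forall>W\<in>wave_cone. convex_on UNIV (\<lambda>t::real. f (V + t *\<^sub>R W)))"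

definition lambda_hull :: "state set \<Rightarrow> state set" where
  "lambda_hull X = {W \<in> state_space.
     \<forall>f. lambda_convex f \<longrightarrow> (\<forall>V\<in>X. f V \<le> 0) \<longrightarrow> f W \<le> 0}"

end

theory Submission
  imports Defs
begin

text \<open>
  In the hull the matrix \<open>A\<close> still equals \<open>b \<otimes> u - u \<otimes> b\<close>, since its defect is \<open>\<Lambda>\<close>-affine. So
  the induction equation says that every nonconstant Fourier coefficient of \<open>\<Psi>\<close> has time
  derivative minus that of \<open>u \<bullet> \<nabla>\<Psi>\<close>; the means of both functions vanish, hence
  \<open>\<Psi>(x, t) = \<Psi>(x, 0) - \<integral>\<^sub>0\<^sup>t u \<bullet> \<nabla>\<Psi> dr\<close> for a.e. \<open>x\<close>. As \<open>u \<bullet> \<nabla>\<Psi>\<close> is only integrable, one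
  cannot multiply by \<open>\<Psi>\<close> and renormalizes instead: by the chain rule in time, \<open>cos (l \<Psi>)\<close>
  changes at rate \<open>l sin (l \<Psi>) (u \<bullet> \<nabla>\<Psi>)\<close>, whose spatial integral is zero because \<open>u\<close> is
  divergence-free and \<open>\<Psi>\<close> is a limit of trigonometric polynomials in \<open>W\<^sup>1\<^sup>,\<^sup>2\<close>. Thus
  \<open>\<integral> 2 (1 - cos (l \<Psi>)) / l\<^sup>2 dx\<close> is conserved, and \<open>l \<rightarrow> 0\<close> yields the claim.
\<close>


section \<open>Smooth functions and cutoffs\<close>

text \<open>In \<open>u \<bullet> \<nabla>\<Psi>\<close> both factors are only square-integrable in
  space, and in two dimensions a function with square-integrable gradient may be unbounded, so
  \<open>\<Psi> (u \<bullet> \<nabla>\<Psi>)\<close> need not be integrable. A bounded function of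
  \<Psi> with bounded derivative removes this obstacle. Cosine is convenient because
  \<open>2 (1 - cos (l s)) / l^2\<close> lies between 0 and \<open>s^2\<close>. No commutator
  estimate is needed: the flux has an honest primitive in time at almost every point. Fourier sums
  are the approximations in space because truncating frequencies commutes with the weak gradient, so
  a single sequence approximates a function and its gradient at once. The equations hold only after
  averaging in time. Weak continuity turns them into statements at every single time, by means of
  kernels supported to the right of that time, so that time 0 is no exception. Sections of Lebesgue
  measurable functions are controlled only almost everywhere; iterated integrals are therefore
  computed with Borel versions.\<close>

lemma Ck_SucI:
  assumes "\<And>x. (f has_derivative D x) (at x)" "\<And>v. Ck k (\<lambda>x. D x v)"
  shows "Ck (Suc k) f"
proof -
  have "frechet_derivative f (at x) = D x" for x
    using assms(1) frechet_derivative_at by metis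
  then show ?thesis
    using assms by (auto simp: differentiable_def)
qed

lemma Ck_SucD:
  assumes "Ck (Suc k) f"
  shows "(f has_derivative frechet_derivative f (at x)) (at x)"
    "Ck k (\<lambda>x. frechet_derivative f (at x) v)"
  using assms by (auto simp: frechet_derivative_works)

lemma Ck_Suc_imp: "Ck (Suc k) f \<Longrightarrow> Ck k f"
proof (induction k arbitrary: f)
  case 0
  then show ?case
    by (auto simp: continuous_on_eq_continuous_at differentiable_imp_continuous_within)
next
  case (Suc k)
  show ?case
    using Ck_SucD[OF Suc.prems] Suc.IH by (intro Ck_SucI) blast+
qed

lemma Ck_const: "Ck k (\<lambda>x. c)"
proof (induction k arbitrary: c)
  case (Suc k)
  show ?case
    by (rule Ck_SucI[where D = "\<lambda>x v. 0"]) (auto intro: Suc)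
qed auto

lemma Ck_bounded_linear:
  assumes "bounded_linear L"
  shows "Ck k L"
proof (cases k)
  case 0
  with assms show ?thesis
    by (simp add: linear_continuous_on)
next
  case (Suc n)
  show ?thesis
    unfolding Suc using assms
    by (intro Ck_SucI[where D = "\<lambda>x. L"] bounded_linear_imp_has_derivative Ck_const)
qed

text \<open>A derivative \<open>L'\<close> that is the same at every point makes \<open>L\<close>
  affine. Differentiating \<open>f (L x)\<close> then yields a function of the same form, so the
  induction closes without a product rule.\<close>

lemma Ck_comp_affine:
  assumes L: "\<And>x. (L has_derivative L') (at x)"
  shows "Ck k f \<Longrightarrow> Ck k (\<lambda>x. f (L x))"
proof (induction k arbitrary: f)
  case 0
  have "continuous_on UNIV L"
    by (intro continuous_at_imp_continuous_on ballI has_derivative_continuous[OF L])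
  then show ?case
    using 0 continuous_on_compose2[of UNIV f UNIV L] by simp
next
  case (Suc k)
  show ?case
  proof (rule Ck_SucI)
    show "((\<lambda>x. f (L x)) has_derivative (\<lambda>v. frechet_derivative f (at (L x)) (L' v))) (at x)" for x
      using diff_chain_at[OF L Ck_SucD(1)[OF Suc.prems]]
      by (simp add: o_def)
    show "Ck k (\<lambda>x. frechet_derivative f (at (L x)) (L' v))" for v
      using Suc.IH[OF Ck_SucD(2)[OF Suc.prems]] .
  qed
qed

lemma Ck_linear_comp:
  assumes L: "bounded_linear L"
  shows "Ck k f \<Longrightarrow> Ck k (\<lambda>x. L (f x))"
proof (induction k arbitrary: f)
  case 0
  then show ?case
    using continuous_on_compose2[OF linear_continuous_on[OF L, of UNIV], of UNIV f] by simp
next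
  case (Suc k)
  show ?case
  proof (rule Ck_SucI)
    show "((\<lambda>x. L (f x)) has_derivative (\<lambda>v. L (frechet_derivative f (at x) v))) (at x)" for x
      using bounded_linear.has_derivative[OF L Ck_SucD(1)[OF Suc.prems]] .
    show "Ck k (\<lambda>x. L (frechet_derivative f (at x) v))" for v
      using Suc.IH[OF Ck_SucD(2)[OF Suc.prems]] .
  qed
qed

lemma Ck_add: "Ck k f \<Longrightarrow> Ck k g \<Longrightarrow> Ck k (\<lambda>x. f x + g x)"
proof (induction k arbitrary: f g)
  case 0
  then show ?case by (auto intro: continuous_intros)
next
  case (Suc k)
  show ?case
    by (rule Ck_SucI[OF has_derivative_add[OF Suc.prems[THEN Ck_SucD(1)]]])
      (intro Suc.IH Suc.prems[THEN Ck_SucD(2)])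
qed

lemma Ck_mult:
  fixes f g :: "'a::euclidean_space \<Rightarrow> real"
  shows "Ck k f \<Longrightarrow> Ck k g \<Longrightarrow> Ck k (\<lambda>x. f x * g x)"
proof (induction k arbitrary: f g)
  case 0
  then show ?case by (auto intro: continuous_intros)
next
  case (Suc k)
  show ?case
    by (rule Ck_SucI[OF has_derivative_mult[OF Suc.prems[THEN Ck_SucD(1)]]])
      (intro Ck_add Suc.IH Suc.prems[THEN Ck_SucD(2)] Suc.prems[THEN Ck_Suc_imp])
qed

text \<open>Sine and cosine are treated together because each needs the other one order
  lower.\<close>

lemma Ck_sin_cos:
  fixes f :: "'a::euclidean_space \<Rightarrow> real"
  shows "Ck k f \<Longrightarrow> Ck k (\<lambda>x. sin (f x)) \<and> Ck k (\<lambda>x. cos (f x))"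
proof (induction k arbitrary: f)
  case 0
  then show ?case by (auto intro: continuous_intros)
next
  case (Suc k)
  note d = Ck_SucD(1)[OF Suc.prems]
  have s: "((\<lambda>x. sin (f x)) has_derivative (\<lambda>v. frechet_derivative f (at x) v * cos (f x))) (at x)" for x
    using has_derivative_sin[OF d] by (simp add: mult.commute)
  have c: "((\<lambda>x. cos (f x)) has_derivative (\<lambda>v. frechet_derivative f (at x) v * ((-1) * sin (f x)))) (at x)" for x
    using has_derivative_cos[OF d] by (simp add: mult.commute)
  note IH = Suc.IH[OF Ck_Suc_imp[OF Suc.prems]]
  have IHs: "Ck k (\<lambda>x. sin (f x))" and IHc: "Ck k (\<lambda>x. cos (f x))"
    using IH by auto
  show ?case
    by (intro conjI Ck_SucI[OF s] Ck_SucI[OF c] Ck_mult Ck_SucD(2)[OF Suc.prems] IHs IHc Ck_const)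
qed

lemma smooth_const: "smooth (\<lambda>x. c)"
  and smooth_linear: "bounded_linear L \<Longrightarrow> smooth L"
  and smooth_linear_comp: "bounded_linear M \<Longrightarrow> smooth f \<Longrightarrow> smooth (\<lambda>x. M (f x))"
  and smooth_add: "smooth f \<Longrightarrow> smooth h \<Longrightarrow> smooth (\<lambda>x. f x + h x)"
  by (simp_all add: smooth_def Ck_const Ck_bounded_linear Ck_linear_comp Ck_add)

lemma smooth_comp_affine:
  "(\<And>x. (g has_derivative L) (at x)) \<Longrightarrow> smooth f \<Longrightarrow> smooth (\<lambda>x. f (g x))"
  unfolding smooth_def using Ck_comp_affine by blast

lemma smooth_mult: "smooth f \<Longrightarrow> smooth g \<Longrightarrow> smooth (\<lambda>x. f x * g x)"
  and smooth_cos: "smooth f \<Longrightarrow> smooth (\<lambda>x. cos (f x))"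
  for f g :: "'a::euclidean_space \<Rightarrow> real"
  by (auto simp: smooth_def Ck_mult Ck_sin_cos)

lemma smooth_has_derivative:
  "smooth f \<Longrightarrow> (f has_derivative frechet_derivative f (at x)) (at x)"
  unfolding smooth_def using Ck_SucD(1) by blast

lemma smooth_frechet: "smooth f \<Longrightarrow> smooth (\<lambda>x. frechet_derivative f (at x) v)"
  unfolding smooth_def using Ck_SucD(2) by blast

lemma smooth_continuous: "smooth f \<Longrightarrow> continuous_on A f"
  unfolding smooth_def by (metis Ck.simps(1) continuous_on_subset subset_UNIV)

lemma smooth_if_derivative:
  fixes H h :: "real \<Rightarrow> real"
  assumes "\<And>x. (H has_real_derivative h x) (at x)" "smooth h"
  shows "smooth H"
  unfolding smooth_def
proof
  fix k
  have "Ck (Suc k) H"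
  proof (rule Ck_SucI)
    show "(H has_derivative (\<lambda>v. h x * v)) (at x)" for x
      using assms(1) by (simp add: has_field_derivative_def)
    show "Ck k (\<lambda>x. h x * v)" for v
      using assms(2) by (intro Ck_mult Ck_const) (simp add: smooth_def)
  qed
  then show "Ck k H" by (rule Ck_Suc_imp)
qed

text \<open>The case \<open>n = 0\<close> is the classical smooth function that is flat at the
  origin. The powers in the denominator are included because the whole family is then closed under
  differentiation, which makes smoothness an induction over all \<open>n\<close> at once.\<close>

definition flat_exp :: "nat \<Rightarrow> real \<Rightarrow> real" where
  "flat_exp n x = (if x > 0 then exp (- (1/x)) / x ^ n else 0)"

lemma flat_exp_tendsto_0: "(flat_exp n \<longlongrightarrow> 0) (at 0)"
proof -
  have "((\<lambda>x::real. exp (- (1/x)) / x ^ n) \<longlongrightarrow> 0) (at_right 0)"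
  proof -
    have "((\<lambda>y::real. y ^ n / exp y) \<longlongrightarrow> 0) at_top"
      by (rule tendsto_power_div_exp_0)
    from filterlim_compose[OF this filterlim_inverse_at_top_right]
    show ?thesis
      by (simp add: exp_minus field_simps power_inverse)
  qed
  then have "(flat_exp n \<longlongrightarrow> 0) (at_right 0)"
    by (rule tendsto_cong[THEN iffD1, rotated])
      (auto simp: flat_exp_def eventually_at_right_field intro: exI[of _ 1])
  moreover have "(flat_exp n \<longlongrightarrow> 0) (at_left 0)"
    by (rule tendsto_cong[THEN iffD1, OF _ tendsto_const])
      (auto simp: flat_exp_def eventually_at_left_field intro: exI[of _ "-1"])
  ultimately show ?thesis
    by (simp add: filterlim_at_split)
qed

lemma flat_exp_deriv:
  "(flat_exp n has_real_derivative (- real n * flat_exp (Suc n) x + flat_exp (n + 2) x)) (at x)"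
proof -
  consider "x > 0" | "x < 0" | "x = 0" by linarith
  then show ?thesis
  proof cases
    case 1
    have "((\<lambda>x. exp (- (1/x)) / x ^ n) has_real_derivative
        (- real n * flat_exp (Suc n) x + flat_exp (n + 2) x)) (at x)"
      using 1
      apply (auto intro!: derivative_eq_intros simp: flat_exp_def)
      apply (cases n)
       apply (auto simp: field_simps power2_eq_square)
      done
    moreover have "eventually (\<lambda>y. flat_exp n y = exp (- (1/y)) / y ^ n) (nhds x)"
      using 1 by (intro eventually_mono[OF order_tendstoD(1)[OF filterlim_ident]]) (auto simp: flat_exp_def)
    ultimately show ?thesis
      by (subst DERIV_cong_ev[OF refl _ refl]) auto
  next
    case 2
    have "eventually (\<lambda>y. flat_exp n y = 0) (nhds x)"
      using 2 by (intro eventually_mono[OF order_tendstoD(2)[OF filterlim_ident]]) (auto simp: flat_exp_def)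
    then show ?thesis
      using 2 by (subst DERIV_cong_ev[OF refl _ refl]) (auto simp: flat_exp_def)
  next
    case 3
    \<comment> \<open>At the origin the difference quotient is the next member of the family; for
      \<open>h = 0\<close> both sides are 0 by the convention on division.\<close>
    have "(\<lambda>h. (flat_exp n (0 + h) - flat_exp n 0) / h) = flat_exp (Suc n)"
      by (auto simp: flat_exp_def)
    then have "(flat_exp n has_real_derivative 0) (at 0)"
      using flat_exp_tendsto_0[of "Suc n"] by (simp add: DERIV_def)
    then show ?thesis
      using 3 by (simp add: flat_exp_def)
  qed
qed

lemma smooth_flat_exp: "smooth (flat_exp n)"
  unfolding smooth_def
proof
  fix k
  show "Ck k (flat_exp n)"
  proof (induction k arbitrary: n)
    case 0
    show ?case
      using flat_exp_deriv DERIV_continuous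
      by (simp add: continuous_on_eq_continuous_at) blast
  next
    case (Suc k)
    show ?case
    proof (rule Ck_SucI)
      show "(flat_exp n has_derivative (\<lambda>v. (- real n * flat_exp (Suc n) x + flat_exp (n + 2) x) * v)) (at x)" for x
        using flat_exp_deriv by (simp add: has_field_derivative_def)
      show "Ck k (\<lambda>x. (- real n * flat_exp (Suc n) x + flat_exp (n + 2) x) * v)" for v
        by (intro Ck_mult Ck_add Ck_const Suc)
    qed
  qed
qed

text \<open>\<open>H\<close> is a switch in time and \<open>h\<close>, its derivative, an averaging
  kernel of mass one. Both change only on the right of 0, so that rescaled kernels placed at time 0
  stay inside the time interval.\<close>

definition smooth_step :: "(real \<Rightarrow> real) \<Rightarrow> (real \<Rightarrow> real) \<Rightarrow> bool" where
  "smooth_step H h \<longleftrightarrow> smooth H \<and> smooth h \<and> (\<forall>x. (H has_real_derivative h x) (at x)) \<and>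
     (\<forall>x\<le>0. H x = 0) \<and> (\<forall>x\<ge>1. H x = 1) \<and> (\<forall>x. 0 \<le> H x \<and> H x \<le> 1) \<and>
     (\<forall>x. 0 \<le> h x) \<and> (\<forall>x. x \<notin> {0<..<1} \<longrightarrow> h x = 0)"

lemma smooth_step_exists: "\<exists>H h. smooth_step H h"
proof -
  define r where "r x = flat_exp 0 x * flat_exp 0 (1 - x)" for x
  have sr: "smooth r"
  proof -
    have "smooth (\<lambda>x. flat_exp 0 (1 - x))"
      by (rule smooth_comp_affine[OF _ smooth_flat_exp]) (auto intro!: derivative_eq_intros)
    then show ?thesis unfolding r_def by (intro smooth_mult smooth_flat_exp)
  qed
  have r0: "r x \<ge> 0" for x by (simp add: r_def flat_exp_def)
  have rz: "r x = 0" if "x \<notin> {0<..<1}" for x using that by (auto simp: r_def flat_exp_def)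
  \<comment> \<open>The lower limit -1 lies left of the support of \<open>r\<close>, so the points
    where \<open>G\<close> starts to grow are interior to the interval of integration.\<close>
  define G where "G x = integral {-1..x} r" for x
  have int: "r integrable_on {a..b}" for a b
    using integrable_continuous_interval smooth_continuous[OF sr] by blast
  have G0: "G x = 0" if "x \<le> 0" for x
    unfolding G_def
    by (rule integral_unique[OF has_integral_is_0]) (use that in \<open>auto intro!: rz\<close>)
  have "(G has_real_derivative r x) (at x)" for x
  proof (cases "x > -1")
    case True
    have "(G has_real_derivative r x) (at x within {-1..x+1})"
      unfolding G_def
      by (rule integral_has_real_derivative) (use True smooth_continuous[OF sr] in auto)
    then show ?thesis
      using True by (subst (asm) at_within_interior) auto
  next
    case False
    have "eventually (\<lambda>y. G y = 0) (nhds x)"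
      using False by (intro eventually_mono[OF order_tendstoD(2)[OF filterlim_ident, of _ 0]]) (auto intro: G0)
    then show ?thesis
      using False rz[of x] by (subst DERIV_cong_ev[OF refl _ refl]) auto
  qed
  note Gd = this
  have mono: "G x \<le> G y" if "x \<le> y" for x y
    using DERIV_nonneg_imp_nondecreasing[OF that] Gd r0 by blast
  have G1: "G x = G 1" if "x \<ge> 1" for x
  proof -
    have "G y = G 1" if "1 < y" for y
    proof (rule DERIV_isconst2[of 1 "y + 1" G y])
      show "continuous_on {1..y + 1} G"
        using DERIV_continuous[OF Gd] by (simp add: continuous_at_imp_continuous_on)
      show "DERIV G z :> 0" if "1 < z" for z
        using Gd[of z] rz[of z] that by simp
    qed (use that in auto)
    then show ?thesis
      using that by (cases "x = 1") auto
  qed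
  \<comment> \<open>Otherwise the monotone function \<open>G\<close> would vanish on the whole unit
    interval, and so would its derivative \<open>r\<close> at the midpoint, where both factors are
    positive.\<close>
  have "G 1 \<noteq> 0"
  proof
    assume "G 1 = 0"
    then have "G x = 0" if "0 \<le> x" "x \<le> 1" for x
      using mono[of 0 x] mono[of x 1] G0[of 0] that by auto
    have "eventually (\<lambda>y. G y = 0) (nhds (1/2))"
      by (rule eventually_nhds[THEN iffD2], rule exI[of _ "{0<..<1}"])
         (use \<open>\<And>x. \<lbrakk>0 \<le> x; x \<le> 1\<rbrakk> \<Longrightarrow> G x = 0\<close> in auto)
    then have "(G has_real_derivative 0) (at (1/2))"
      by (subst DERIV_cong_ev[OF refl _ refl]) auto
    then have "r (1/2) = 0" using Gd DERIV_unique by blast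
    then show False by (simp add: r_def flat_exp_def)
  qed
  then have G1p: "G 1 > 0" using mono[of 0 1] G0[of 0] by auto
  have sh: "smooth (\<lambda>x. r x / G 1)"
    using smooth_mult[OF sr smooth_const[of "1 / G 1"]] by simp
  have "smooth_step (\<lambda>x. G x / G 1) (\<lambda>x. r x / G 1)"
    unfolding smooth_step_def
  proof (intro conjI allI impI)
    show "((\<lambda>x. G x / G 1) has_real_derivative r x / G 1) (at x)" for x
      using DERIV_cdivide[OF Gd] .
    show "smooth (\<lambda>x. G x / G 1)"
      by (rule smooth_if_derivative[OF DERIV_cdivide[OF Gd] sh])
    show "0 \<le> G x / G 1" for x
      using mono[of 0 x] G0[of x] G0[of 0] G1p by (cases "x \<le> 0") auto
    show "G x / G 1 \<le> 1" for x
      using mono[of x 1] G1[of x] G1p by (cases "x \<le> 1") auto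
    show "G x / G 1 = 0" if "x \<le> 0" for x
      using G0[OF that] by simp
    show "G x / G 1 = 1" if "x \<ge> 1" for x
      using G1[OF that] G1p by simp
    show "0 \<le> r x / G 1" for x
      using r0[of x] G1p by simp
    show "r x / G 1 = 0" if "x \<notin> {0<..<1}" for x
      using that by (subst rz) auto
  qed (rule sh)
  then show ?thesis by blast
qed


section \<open>Trigonometric polynomials on the torus\<close>

lemma torus_lmeasurable: "torus \<in> lmeasurable"
  by (simp add: torus_def)

lemma torus_sets [simp, intro]: "torus \<in> sets lebesgue" "torus \<in> sets borel"
  by (auto simp: torus_def)

lemma compact_torus: "compact torus"
  by (simp add: torus_def)

interpretation torus: finite_measure "lebesgue_on torus"
  by (rule finite_measure_lebesgue_on[OF torus_lmeasurable])

lemma continuous_imp_measurable_torus: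
  fixes f :: "real^2 \<Rightarrow> 'b::euclidean_space"
  assumes "continuous_on torus f"
  shows "f \<in> borel_measurable (lebesgue_on torus)"
  by (rule continuous_imp_measurable_on_sets_lebesgue[OF assms]) simp

lemma continuous_imp_integrable_torus:
  fixes f :: "real^2 \<Rightarrow> 'b::euclidean_space"
  assumes "continuous_on torus f"
  shows "integrable (lebesgue_on torus) f"
proof -
  obtain B where "\<And>x. x \<in> torus \<Longrightarrow> norm (f x) \<le> B"
    using compact_imp_bounded[OF compact_continuous_image[OF assms compact_torus]]
    by (auto simp: bounded_iff)
  then show ?thesis
    by (intro torus.integrable_const_bound[where B = B] continuous_imp_measurable_torus assms) auto
qed

definition lattice :: "(real^2) set" where
  "lattice = {k. \<forall>i. k $ i \<in> \<int>}"

text \<open>The free phase covers sine and cosine at once, and differentiation merely shifts it by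
  \<open>pi/2\<close>.\<close>

definition wave :: "real^2 \<Rightarrow> real \<Rightarrow> real^2 \<Rightarrow> real" where
  "wave k \<theta> x = cos (2 * pi * (k \<bullet> x) + \<theta>)"

inductive_set trig_poly :: "(real^2 \<Rightarrow> real) set" where
  wave: "k \<in> lattice \<Longrightarrow> (\<lambda>x. c * wave k \<theta> x) \<in> trig_poly"
| add: "p \<in> trig_poly \<Longrightarrow> q \<in> trig_poly \<Longrightarrow> (\<lambda>x. p x + q x) \<in> trig_poly"

lemma lattice_zero: "0 \<in> lattice"
  and lattice_axis: "axis i 1 \<in> lattice"
  and lattice_add: "k \<in> lattice \<Longrightarrow> l \<in> lattice \<Longrightarrow> k + l \<in> lattice"
  and lattice_diff: "k \<in> lattice \<Longrightarrow> l \<in> lattice \<Longrightarrow> k - l \<in> lattice"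
  and lattice_uminus: "k \<in> lattice \<Longrightarrow> - k \<in> lattice"
  by (auto simp: lattice_def axis_def)

lemma trig_poly_const: "(\<lambda>x. c) \<in> trig_poly"
  using trig_poly.wave[OF lattice_zero, of c 0] by (simp add: wave_def)

lemma wave_mult:
  "wave k \<theta> x * wave l \<phi> x = (wave (k - l) (\<theta> - \<phi>) x + wave (k + l) (\<theta> + \<phi>) x) / 2"
  unfolding wave_def by (subst cos_times_cos) (simp add: algebra_simps)

text \<open>Products of waves are sums of waves, so trigonometric polynomials form an algebra; this
  is what the use of the Stone-Weierstrass theorem rests on.\<close>

lemma trig_poly_mult:
  assumes "p \<in> trig_poly" "q \<in> trig_poly"
  shows "(\<lambda>x. p x * q x) \<in> trig_poly"
  using assms
proof (induction p)
  case (wave k c \<theta>)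
  from wave(2) show ?case
  proof (induction q)
    case (wave l d \<phi>)
    have "(\<lambda>x. c * wave k \<theta> x * (d * wave l \<phi> x)) =
      (\<lambda>x. c * d / 2 * wave (k - l) (\<theta> - \<phi>) x + c * d / 2 * wave (k + l) (\<theta> + \<phi>) x)"
    proof
      fix x
      have "c * d * (wave k \<theta> x * wave l \<phi> x) =
          c * d * ((wave (k - l) (\<theta> - \<phi>) x + wave (k + l) (\<theta> + \<phi>) x) / 2)"
        by (simp only: wave_mult)
      then show "c * wave k \<theta> x * (d * wave l \<phi> x) =
          c * d / 2 * wave (k - l) (\<theta> - \<phi>) x + c * d / 2 * wave (k + l) (\<theta> + \<phi>) x"
        by (simp add: field_simps)
    qed
    then show ?case
      using wave \<open>k \<in> lattice\<close>
      by (simp only:) (intro trig_poly.intros lattice_add lattice_diff)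
  next
    case (add p q)
    then show ?case
      using trig_poly.add by (fastforce simp: distrib_left)
  qed
next
  case (add p q)
  then show ?case
    using trig_poly.add by (fastforce simp: distrib_right)
qed

lemma trig_poly_cmult: "p \<in> trig_poly \<Longrightarrow> (\<lambda>x. c * p x) \<in> trig_poly"
  using trig_poly_mult[OF trig_poly_const] .

lemma trig_poly_sum: "(\<And>i. i \<in> I \<Longrightarrow> f i \<in> trig_poly) \<Longrightarrow> (\<lambda>x. \<Sum>i\<in>I. f i x) \<in> trig_poly"
  by (induction I rule: infinite_finite_induct) (auto intro: trig_poly_const trig_poly.add)

lemma smooth_wave: "smooth (wave k \<theta>)"
  unfolding wave_def[abs_def]
  by (intro smooth_cos smooth_add smooth_mult smooth_const smooth_linear bounded_linear_inner_right)

lemma periodic_wave: "k \<in> lattice \<Longrightarrow> periodic (wave k \<theta>)"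
  unfolding periodic_def
proof (intro allI)
  fix x :: "real^2" and i :: 2 assume "k \<in> lattice"
  then obtain n :: int where n: "k $ i = of_int n"
    by (auto simp: lattice_def elim: Ints_cases)
  have "2 * pi * (k \<bullet> (x + axis i 1)) + \<theta> = (2 * pi * (k \<bullet> x) + \<theta>) + of_int n * (2 * pi)"
    by (simp add: inner_add_right inner_axis n algebra_simps)
  then show "wave k \<theta> (x + axis i 1) = wave k \<theta> x"
    unfolding wave_def using cos.plus_of_int[of "2 * pi * (k \<bullet> x) + \<theta>" n] by (simp only: of_real_eq_id id_apply)
qed

lemma trig_poly_imp_test: "p \<in> trig_poly \<Longrightarrow> p \<in> torus_test"
proof (induction rule: trig_poly.induct)
  case (wave k c \<theta>)
  then show ?case
    using periodic_wave by (auto simp: torus_test_def periodic_def intro!: smooth_mult smooth_const smooth_wave)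
next
  case (add p q)
  then show ?case
    by (simp add: torus_test_def smooth_add) (simp add: periodic_def)
qed

lemma trig_poly_continuous: "p \<in> trig_poly \<Longrightarrow> continuous_on A p"
  using trig_poly_imp_test by (auto simp: torus_test_def smooth_continuous)

section \<open>Integrals of waves\<close>

lemma integral_lborel_prod:
  fixes g :: "'a::euclidean_space \<Rightarrow> real \<Rightarrow> complex"
  assumes "\<And>b. b \<in> Basis \<Longrightarrow> integrable lborel (g b)"
  shows "(LINT x|lborel. (\<Prod>b\<in>Basis. g b (x \<bullet> b))) = (\<Prod>b\<in>Basis. LINT y|lborel. g b y)"
proof -
  interpret P: product_sigma_finite "\<lambda>b::'a. lborel :: real measure"
    by standard
  have [measurable]: "g b \<in> borel_measurable borel" if "b \<in> Basis" for b
    using borel_measurable_integrable[OF assms[OF that]] by simp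
  have "(LINT x|lborel. (\<Prod>b\<in>Basis. g b (x \<bullet> b))) =
    (LINT f|(\<Pi>\<^sub>M b\<in>Basis. lborel). (\<Prod>b\<in>Basis. g b ((\<Sum>c\<in>Basis. f c *\<^sub>R c) \<bullet> b)))"
    by (subst lborel_eq, subst integral_distr) (auto intro!: borel_measurable_prod measurable_compose[OF borel_measurable_inner])
  also have "\<dots> = (LINT f|(\<Pi>\<^sub>M b\<in>Basis. lborel). (\<Prod>b\<in>Basis. g b (f b)))"
    by (intro Bochner_Integration.integral_cong refl prod.cong) (simp add: inner_sum_left_Basis)
  also have "\<dots> = (\<Prod>b\<in>Basis. LINT y|lborel. g b y)"
    by (rule P.product_integral_prod) (use assms in auto)
  finally show ?thesis .
qed

lemma integral_cis_unit:
  assumes "n \<in> \<int>"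
  shows "(LINT y|lborel. indicator {0..1} y *\<^sub>R cis (2 * pi * (n * y))) = (if n = 0 then 1 else 0)"
proof (cases "n = 0")
  case False
  let ?F = "\<lambda>y. cis (2 * pi * (n * y)) / (\<i> * complex_of_real (2 * pi * n))"
  have "(LINT y|lborel. indicator {0..1} y *\<^sub>R cis (2 * pi * (n * y))) = ?F 1 - ?F 0"
  proof (rule integral_FTC_Icc)
    show "(?F has_vector_derivative cis (2 * pi * (n * x))) (at x within {0..1})" for x
    proof -
      have "((\<lambda>y. exp (y *\<^sub>R (\<i> * complex_of_real (2 * pi * n))) / (\<i> * complex_of_real (2 * pi * n)))
          has_vector_derivative exp (x *\<^sub>R (\<i> * complex_of_real (2 * pi * n))) *
            (\<i> * complex_of_real (2 * pi * n)) / (\<i> * complex_of_real (2 * pi * n))) (at x within {0..1})"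
        unfolding divide_inverse
        by (intro has_vector_derivative_mult_left exp_scaleR_has_vector_derivative_right)
      then show ?thesis
        using False by (simp add: cis_conv_exp scaleR_conv_of_real mult_ac)
    qed
  qed (auto intro!: continuous_intros)
  also have "cis (2 * pi * (n * 1)) = 1"
    using assms by (auto elim!: Ints_cases)
  finally show ?thesis using False by simp
qed simp

text \<open>A wave is the real part of \<open>cis \<theta>\<close> times a complex exponential, and
  the exponential, unlike the cosine, factors over the coordinates. Each one-dimensional factor is
  an integral over full periods.\<close>

lemma integral_wave:
  assumes "k \<in> lattice"
  shows "(LINT x|lebesgue_on torus. wave k \<theta> x) = (if k = 0 then cos \<theta> else 0)"
proof -
  have ind: "(\<Prod>b\<in>Basis. indicator {0..1} (x \<bullet> b) :: real) = indicator torus x" for x :: "real^2"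
  proof -
    have "(1::real^2) \<bullet> b = 1" if "b \<in> Basis" for b
      using that by (auto simp: Basis_vec_def inner_axis)
    then show ?thesis
      by (cases "x \<in> torus") (auto simp: torus_def mem_box indicator_def intro!: prod.neutral)
  qed
  have pr: "(\<Prod>b\<in>Basis. indicator {0..1} (x \<bullet> b) *\<^sub>R cis (2 * pi * ((k \<bullet> b) * (x \<bullet> b)))) =
      indicator torus x *\<^sub>R cis (2 * pi * (k \<bullet> x))" for x :: "real^2"
  proof -
    have "(\<Prod>b\<in>A. cis (g b)) = cis (sum g A)" for A :: "(real^2) set" and g
      by (induction A rule: infinite_finite_induct) (auto simp: cis_mult)
    then have "(\<Prod>b\<in>Basis. cis (2 * pi * ((k \<bullet> b) * (x \<bullet> b)))) = cis (2 * pi * (k \<bullet> x))"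
      by (simp add: euclidean_inner[of k x] sum_distrib_left)
    then show ?thesis
      by (simp add: scaleR_conv_of_real prod.distrib ind[symmetric])
  qed
  have "(LINT x|lebesgue_on torus. wave k \<theta> x) = (LINT x|lborel. indicator torus x *\<^sub>R wave k \<theta> x)"
  proof -
    have "(\<lambda>x. indicator torus x *\<^sub>R wave k \<theta> x) \<in> borel_measurable borel"
      by (intro borel_measurable_scaleR borel_measurable_indicator
          borel_measurable_continuous_onI smooth_continuous smooth_wave) auto
    then show ?thesis
      by (subst integral_restrict_space) (auto intro!: integral_completion)
  qed
  also have "\<dots> = (LINT x|lborel. Re (cis \<theta> * (indicator torus x *\<^sub>R cis (2 * pi * (k \<bullet> x)))))"
    by (intro Bochner_Integration.integral_cong) (auto simp: wave_def cis_mult[symmetric] cos_add indicator_def)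
  also have "\<dots> = Re (cis \<theta> * (LINT x|lborel. indicator torus x *\<^sub>R cis (2 * pi * (k \<bullet> x))))"
  proof -
    have "integrable lborel (\<lambda>x. cis \<theta> * (indicator torus x *\<^sub>R cis (2 * pi * (k \<bullet> x))))"
      by (intro integrable_mult_right borel_integrable_compact compact_torus continuous_intros)
    from integral_Re[OF this] show ?thesis
      by (simp only: integral_mult_right_zero)
  qed
  also have "(LINT x|lborel. indicator torus x *\<^sub>R cis (2 * pi * (k \<bullet> x))) =
      (\<Prod>b\<in>Basis. LINT y|lborel. indicator {0..1} y *\<^sub>R cis (2 * pi * ((k \<bullet> b) * y)))"
    unfolding pr[symmetric]
    by (rule integral_lborel_prod) (intro borel_integrable_compact continuous_intros compact_Icc)
  also have "\<dots> = (\<Prod>b\<in>(Basis::(real^2) set). if k \<bullet> b = 0 then 1 else 0)"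
    using assms by (intro prod.cong refl integral_cis_unit) (auto simp: lattice_def Basis_vec_def inner_axis)
  also have "\<dots> = (if k = 0 then 1 else 0)"
    using euclidean_all_zero_iff[of k] by (auto simp: prod_zero_iff)
  finally show ?thesis by simp
qed

text \<open>The usual embedding of the torus as a product of two circles. Its image is a compact
  subset of a Euclidean space, on which polynomials pull back to trigonometric polynomials.\<close>

definition torus_embed :: "real^2 \<Rightarrow> complex \<times> complex" where
  "torus_embed x = (cis (2 * pi * (x $ 1)), cis (2 * pi * (x $ 2)))"

lemma trig_poly_embed:
  assumes "real_polynomial_function g"
  shows "(\<lambda>x. g (torus_embed x)) \<in> trig_poly"
  using assms
proof (induction g)
  case (linear f)
  interpret bounded_linear f by fact
  have c: "(\<lambda>x. cos (2 * pi * (x $ i))) \<in> trig_poly" for i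
    using trig_poly.wave[OF lattice_axis[of i], of 1 0] by (simp add: wave_def inner_axis')
  have s: "(\<lambda>x. sin (2 * pi * (x $ i))) \<in> trig_poly" for i
    using trig_poly.wave[OF lattice_axis[of i], of 1 "- (pi/2)"]
    by (simp add: wave_def inner_axis' cos_diff)
  have eq: "f (torus_embed x) = (f (1, 0) * cos (2 * pi * (x $ 1)) + f (\<i>, 0) * sin (2 * pi * (x $ 1)))
    + (f (0, 1) * cos (2 * pi * (x $ 2)) + f (0, \<i>) * sin (2 * pi * (x $ 2)))" for x
  proof -
    have "torus_embed x = cos (2 * pi * (x $ 1)) *\<^sub>R (1, 0) + sin (2 * pi * (x $ 1)) *\<^sub>R (\<i>, 0)
      + cos (2 * pi * (x $ 2)) *\<^sub>R (0, 1) + sin (2 * pi * (x $ 2)) *\<^sub>R (0, \<i>)"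
      by (auto simp: torus_embed_def complex_eq_iff)
    then show ?thesis
      by (simp only: add scaleR real_scaleR_def) (simp add: algebra_simps)
  qed
  show ?case
    unfolding eq by (intro trig_poly.add trig_poly_cmult c s)
qed (auto intro: trig_poly_const trig_poly.add trig_poly_mult)

text \<open>Opposite sides of the square have the same image, so one of the two points has to be
  interior.\<close>

lemma torus_embed_eq:
  assumes "x \<in> torus" "y \<in> torus" "torus_embed x = torus_embed y" "x \<in> box 0 1"
  shows "x = y"
proof -
  have "x $ i = y $ i" for i
  proof -
    have "cis (2 * pi * (x $ i)) = cis (2 * pi * (y $ i))"
      using assms(3) exhaust_2[of i] by (auto simp: torus_embed_def)
    then have "cis (2 * pi * (x $ i) - 2 * pi * (y $ i)) = 1"
      using cis_divide[of "2 * pi * (x $ i)" "2 * pi * (y $ i)"] by simp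
    then have "cos (2 * pi * (x $ i - y $ i)) = 1"
      by (simp add: complex_eq_iff algebra_simps)
    then obtain n :: int where "2 * pi * (x $ i - y $ i) = of_int n * 2 * pi"
      by (auto simp: cos_one_2pi_int)
    then have n: "x $ i - y $ i = of_int n" by (simp add: mult_ac)
    have "0 < x $ i" "x $ i < 1" "0 \<le> y $ i" "y $ i \<le> 1"
      using assms by (auto simp: torus_def mem_box_cart)
    then have "\<bar>of_int n :: real\<bar> < 1" using n by linarith
    then have "n = 0" by linarith
    with n show ?thesis by simp
  qed
  then show ?thesis by (simp add: vec_eq_iff)
qed

text \<open>A function that vanishes on the sides of the square descends to the embedded torus,
  where Stone-Weierstrass applies.\<close>

lemma trig_poly_uniform_approx:
  assumes f: "continuous_on UNIV f" "\<And>x. x \<notin> box 0 1 \<Longrightarrow> f x = 0" and "e > 0"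
  obtains p where "p \<in> trig_poly" "\<And>x. x \<in> torus \<Longrightarrow> \<bar>f x - p x\<bar> < e"
proof -
  \<comment> \<open>The chosen preimage can differ from the original point only on the sides, where
    \<open>f\<close> is 0 anyway.\<close>
  define F where "F z = f (inv_into torus torus_embed z)" for z
  have F: "F (torus_embed x) = f x" if "x \<in> torus" for x
  proof -
    define y where "y = inv_into torus torus_embed (torus_embed x)"
    have y: "y \<in> torus" "torus_embed y = torus_embed x"
      unfolding y_def using that by (auto intro: inv_into_into f_inv_into_f)
    have "f y = f x"
    proof (cases "x \<in> box 0 1 \<or> y \<in> box 0 1")
      case True
      then have "x = y"
        using torus_embed_eq[OF that y(1) y(2)[symmetric]] torus_embed_eq[OF y(1) that y(2)] by blast
      then show ?thesis by simp
    next
      case False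
      then show ?thesis using f(2)[of x] f(2)[of y] by simp
    qed
    then show ?thesis by (simp add: F_def y_def)
  qed
  have cE: "continuous_on torus torus_embed"
    unfolding torus_embed_def by (intro continuous_intros)
  have cf: "continuous_on torus f"
    using f(1) continuous_on_subset by blast
  \<comment> \<open>The embedding is not injective on the closed square, so continuity is not
    obtained from an inverse map: the graph of \<open>F\<close> is the compact image of the square,
    hence closed.\<close>
  have "continuous_on (torus_embed ` torus) F"
  proof (rule continuous_from_closed_graph[of "f ` torus"])
    show "compact (f ` torus)"
      using compact_continuous_image[OF cf compact_torus] .
    show "F \<in> torus_embed ` torus \<rightarrow> f ` torus"
      using F by auto
    have "(\<lambda>z. (z, F z)) ` torus_embed ` torus = (\<lambda>x. (torus_embed x, f x)) ` torus"
      using F by (auto simp: image_iff)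
    then show "closed ((\<lambda>z. (z, F z)) ` torus_embed ` torus)"
      using compact_continuous_image[OF continuous_on_Pair[OF cE cf] compact_torus] compact_imp_closed by simp
  qed
  from Stone_Weierstrass_real_polynomial_function[OF compact_continuous_image[OF cE compact_torus] this \<open>e > 0\<close>]
  obtain g where g: "real_polynomial_function g" "\<And>z. z \<in> torus_embed ` torus \<Longrightarrow> \<bar>F z - g z\<bar> < e"
    by blast
  show thesis
  proof (rule that[OF trig_poly_embed[OF g(1)]])
    show "\<bar>f x - g (torus_embed x)\<bar> < e" if "x \<in> torus" for x
      using g(2)[of "torus_embed x"] F[OF that] that by simp
  qed
qed

text \<open>The approximants share one bound, which makes them ready for dominated convergence. The
  extra 1 pays for the uniform error \<open>1 / real (Suc n)\<close> of the trigonometric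
  approximation.\<close>

lemma bounded_measurable_trig_approx:
  fixes f :: "real^2 \<Rightarrow> real"
  assumes f: "f \<in> borel_measurable (lebesgue_on torus)" "\<And>x. x \<in> torus \<Longrightarrow> \<bar>f x\<bar> \<le> B"
  obtains p where "\<And>n::nat. p n \<in> trig_poly" "\<And>n x. x \<in> torus \<Longrightarrow> \<bar>p n x\<bar> \<le> B + 1"
    "AE x in lebesgue_on torus. (\<lambda>n. p n x) \<longlonglongrightarrow> f x"
proof -
  have "f measurable_on torus"
    using f(1) by (simp add: measurable_on_iff_borel_measurable)
  then obtain N g where N: "negligible N" and g: "\<And>n::nat. continuous_on UNIV (g n)"
    "\<And>x. x \<notin> N \<Longrightarrow> (\<lambda>n. g n x) \<longlonglongrightarrow> (if x \<in> torus then f x else 0)"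
    unfolding measurable_on_def by blast
  have B: "B \<ge> 0"
    using f(2)[of 0] by (auto simp: torus_def mem_box_cart)
  \<comment> \<open>The factor \<open>c n\<close> forces the approximant to vanish on the sides of
    the square and equals 1 at any interior point once \<open>n\<close> is large. Clamping to
    \<open>[- B, B]\<close> keeps the bound and does not change the limit.\<close>
  define c where "c n x = min 1 (real n * infdist x (- box 0 1))" for n and x :: "real^2"
  define h where "h n x = c n x * max (- B) (min B (g n x))" for n x
  have c01: "0 \<le> c n x" "c n x \<le> 1" for n x
    by (auto simp: c_def infdist_nonneg)
  have hB: "\<bar>h n x\<bar> \<le> B" for n x
  proof -
    have "\<bar>h n x\<bar> \<le> 1 * B"
      unfolding h_def abs_mult by (intro mult_mono) (use c01 B in auto)
    then show ?thesis by simp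
  qed
  have ch: "continuous_on UNIV (h n)" for n
    unfolding h_def c_def by (intro continuous_intros g)
  have h0: "h n x = 0" if "x \<notin> box 0 1" for n x
    using that by (simp add: h_def c_def)
  have hlim: "(\<lambda>n. h n x) \<longlonglongrightarrow> f x" if "x \<in> box 0 1" "x \<notin> N" for x
  proof -
    have xt: "x \<in> torus" using that(1) box_subset_cbox by (auto simp: torus_def)
    have "- box 0 (1::real^2) \<noteq> {}"
      using bounded_box[of 0 "1::real^2"] not_bounded_UNIV by (metis compl_bot_eq double_compl)
    then have d: "infdist x (- box 0 1) > 0"
      using that(1) open_box[of 0 "1::real^2"] by (intro infdist_pos_not_in_closed) (auto simp: closed_Compl)
    obtain m :: nat where m: "1 / infdist x (- box 0 1) < real m"
      using reals_Archimedean2 by blast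
    have "eventually (\<lambda>n. c n x = 1) sequentially"
      unfolding eventually_sequentially
    proof (intro exI[of _ m] allI impI)
      fix n assume "m \<le> n"
      then have "1 / infdist x (- box 0 1) < real n" using m by linarith
      then show "c n x = 1" using d by (simp add: c_def field_simps)
    qed
    then have "(\<lambda>n. c n x) \<longlonglongrightarrow> 1"
      by (rule tendsto_eventually)
    moreover have "(\<lambda>n. g n x) \<longlonglongrightarrow> f x"
      using g(2)[OF that(2)] xt by simp
    then have "(\<lambda>n. max (- B) (min B (g n x))) \<longlonglongrightarrow> max (- B) (min B (f x))"
      by (intro tendsto_intros)
    moreover have "max (- B) (min B (f x)) = f x"
      using f(2)[OF xt] by auto
    ultimately have "(\<lambda>n. c n x * max (- B) (min B (g n x))) \<longlonglongrightarrow> 1 * f x"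
      by (intro tendsto_mult) auto
    then show ?thesis by (simp add: h_def)
  qed
  have "\<exists>p\<in>trig_poly. \<forall>x\<in>torus. \<bar>h n x - p x\<bar> < 1 / real (Suc n)" for n
  proof -
    have e: "1 / real (Suc n) > 0" by simp
    show ?thesis
      using trig_poly_uniform_approx[OF ch[of n] h0[of _ n] e] by metis
  qed
  then obtain p where p: "\<And>n. p n \<in> trig_poly" "\<And>n x. x \<in> torus \<Longrightarrow> \<bar>h n x - p n x\<bar> < 1 / real (Suc n)"
    by metis
  show thesis
  proof (rule that[of p])
    show "p n \<in> trig_poly" for n by (rule p)
    show "\<bar>p n x\<bar> \<le> B + 1" if "x \<in> torus" for n x
    proof -
      have "1 / real (Suc n) \<le> 1" by simp
      then show ?thesis using p(2)[OF that, of n] hB[of n x] by linarith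
    qed
    have "negligible (N \<union> (torus - box 0 1))"
      using N negligible_frontier_interval[of 0 "1::real^2"] by (auto simp: torus_def)
    then have "AE x in lebesgue. x \<notin> N \<union> (torus - box 0 1)"
      using negligible_iff_null_sets AE_not_in by blast
    then have "AE x in lebesgue_on torus. x \<notin> N \<union> (torus - box 0 1)"
      by (auto simp: AE_restrict_space_iff)
    then show "AE x in lebesgue_on torus. (\<lambda>n. p n x) \<longlonglongrightarrow> f x"
    proof (rule AE_mp, intro AE_I2 impI)
      fix x assume x: "x \<in> space (lebesgue_on torus)" "x \<notin> N \<union> (torus - box 0 1)"
      then have xt: "x \<in> torus" "x \<in> box 0 1" "x \<notin> N" by auto
      have "(\<lambda>n. h n x - p n x) \<longlonglongrightarrow> 0"
        by (rule Lim_null_comparison[OF _ LIMSEQ_inverse_real_of_nat])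
           (use p(2)[OF xt(1)] in \<open>auto simp: less_imp_le inverse_eq_divide intro!: always_eventually\<close>)
      from tendsto_diff[OF hlim[OF xt(2,3)] this] show "(\<lambda>n. p n x) \<longlonglongrightarrow> f x" by simp
    qed
  qed
qed


section \<open>Square-integrable functions\<close>

text \<open>Integrating \<open>2 t |f x \<bullet> g x| \<le> |f x|^2 + t^2 |g x|^2\<close> gives a
  quadratic inequality in \<open>t\<close>, from which the best \<open>t\<close> is taken. The
  absolute value stands inside the integral because convergence in L1 is wanted later.\<close>

lemma Cauchy_Schwarz_integral:
  fixes f g :: "'a \<Rightarrow> 'b::euclidean_space"
  assumes [measurable]: "f \<in> borel_measurable M" "g \<in> borel_measurable M"
    and f: "integrable M (\<lambda>x. (norm (f x))\<^sup>2)" and g: "integrable M (\<lambda>x. (norm (g x))\<^sup>2)"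
  shows "integrable M (\<lambda>x. f x \<bullet> g x)"
    "(LINT x|M. \<bar>f x \<bullet> g x\<bar>)\<^sup>2 \<le> (LINT x|M. (norm (f x))\<^sup>2) * (LINT x|M. (norm (g x))\<^sup>2)"
proof -
  show int: "integrable M (\<lambda>x. f x \<bullet> g x)"
  proof (rule Bochner_Integration.integrable_bound[OF Bochner_Integration.integrable_add[OF f g]])
    show "AE x in M. norm (f x \<bullet> g x) \<le> norm ((norm (f x))\<^sup>2 + (norm (g x))\<^sup>2)"
    proof (rule AE_I2)
      fix x
      have "\<bar>f x \<bullet> g x\<bar> \<le> norm (f x) * norm (g x)" by (rule Cauchy_Schwarz_ineq2)
      also have "\<dots> \<le> (norm (f x))\<^sup>2 + (norm (g x))\<^sup>2"
        using sum_squares_bound[of "norm (f x)" "norm (g x)"]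
          mult_nonneg_nonneg[OF norm_ge_zero[of "f x"] norm_ge_zero[of "g x"]] by linarith
      finally show "norm (f x \<bullet> g x) \<le> norm ((norm (f x))\<^sup>2 + (norm (g x))\<^sup>2)" by simp
    qed
  qed simp
  let ?A = "LINT x|M. (norm (f x))\<^sup>2" and ?B = "LINT x|M. \<bar>f x \<bullet> g x\<bar>" and ?C = "LINT x|M. (norm (g x))\<^sup>2"
  have A: "?A \<ge> 0" and B: "?B \<ge> 0" and C: "?C \<ge> 0" by simp_all
  have q: "2 * t * ?B \<le> ?A + t\<^sup>2 * ?C" for t :: real
  proof (cases "t \<ge> 0")
    case True
    have "2 * t * ?B = (LINT x|M. 2 * t * \<bar>f x \<bullet> g x\<bar>)" by simp
    also have "\<dots> \<le> (LINT x|M. (norm (f x))\<^sup>2 + t\<^sup>2 * (norm (g x))\<^sup>2)"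
    proof (rule integral_mono)
      fix x
      have "2 * t * \<bar>f x \<bullet> g x\<bar> \<le> 2 * t * (norm (f x) * norm (g x))"
        using True by (intro mult_left_mono Cauchy_Schwarz_ineq2) auto
      also have "\<dots> \<le> (norm (f x))\<^sup>2 + t\<^sup>2 * (norm (g x))\<^sup>2"
        using sum_squares_bound[of "norm (f x)" "t * norm (g x)"] by (simp add: power_mult_distrib mult_ac)
      finally show "2 * t * \<bar>f x \<bullet> g x\<bar> \<le> (norm (f x))\<^sup>2 + t\<^sup>2 * (norm (g x))\<^sup>2" .
    qed (use int f g in auto)
    also have "\<dots> = ?A + t\<^sup>2 * ?C" using f g by simp
    finally show ?thesis .
  next
    case False
    then have "2 * t * ?B \<le> 0" using B by (simp add: mult_nonpos_nonneg)
    then show ?thesis using A C by (smt (verit) mult_nonneg_nonneg zero_le_power2)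
  qed
  show "?B\<^sup>2 \<le> ?A * ?C"
  proof (cases "?C = 0")
    case True
    have "?B = 0"
    proof (rule ccontr)
      assume "?B \<noteq> 0"
      \<comment> \<open>For \<open>?C = 0\<close> the inequality \<open>q\<close> is linear in
        \<open>t\<close>; this choice of \<open>t\<close> turns it into
        \<open>?A + 1 \<le> ?A\<close>.\<close>
      then show False
        using q[of "(?A + 1) / (2 * ?B)"] True A by simp
    qed
    then show ?thesis using True by simp
  next
    case False
    then have Cp: "?C > 0" using C by linarith
    \<comment> \<open>The value \<open>t = ?B / ?C\<close> is the minimizer of the quadratic
      polynomial in \<open>q\<close>.\<close>
    have "2 * ?B\<^sup>2 / ?C \<le> ?A + ?B\<^sup>2 / ?C"
      using q[of "?B / ?C"] False by (simp add: power2_eq_square field_simps)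
    then have "?B\<^sup>2 / ?C \<le> ?A" by simp
    then show ?thesis using Cp by (simp add: field_simps)
  qed
qed

lemma L2_measurable: "f \<in> L2 \<Longrightarrow> f \<in> borel_measurable (lebesgue_on torus)"
  and L2_integrable_norm2: "f \<in> L2 \<Longrightarrow> integrable (lebesgue_on torus) (\<lambda>x. (norm (f x))\<^sup>2)"
  by (auto simp: L2_def)

lemma L2_inner_integrable: "f \<in> L2 \<Longrightarrow> g \<in> L2 \<Longrightarrow> integrable (lebesgue_on torus) (\<lambda>x. f x \<bullet> g x)"
  by (intro Cauchy_Schwarz_integral L2_measurable L2_integrable_norm2)

lemma L2_mult_integrable:
  "f \<in> L2 \<Longrightarrow> g \<in> L2 \<Longrightarrow> integrable (lebesgue_on torus) (\<lambda>x. f x * g x)" for f g :: "real^2 \<Rightarrow> real"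
  using L2_inner_integrable[of f g] by simp

lemma bounded_imp_L2:
  assumes "f \<in> borel_measurable (lebesgue_on torus)" "\<And>x. x \<in> torus \<Longrightarrow> norm (f x) \<le> B"
  shows "f \<in> L2"
  unfolding L2_def using assms
  by (auto intro!: torus.integrable_const_bound[where B = "B\<^sup>2"] AE_I2 power_mono)

lemma continuous_imp_L2: "continuous_on torus f \<Longrightarrow> f \<in> L2"
  by (simp add: L2_def continuous_imp_measurable_torus continuous_imp_integrable_torus continuous_intros)

lemma L2_const: "(\<lambda>x. c) \<in> L2"
  by (simp add: continuous_imp_L2)

lemma trig_poly_L2: "p \<in> trig_poly \<Longrightarrow> p \<in> L2"
  by (simp add: continuous_imp_L2 trig_poly_continuous)

lemma wave_continuous: "continuous_on A (wave k \<theta>)"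
  by (simp add: smooth_continuous smooth_wave)

lemma wave_L2: "wave k \<theta> \<in> L2"
  by (simp add: continuous_imp_L2 wave_continuous)

lemma L2_integrable: 
  fixes f :: "real^2 \<Rightarrow> 'b::euclidean_space"
  assumes "f \<in> L2"
  shows "integrable (lebesgue_on torus) f"
proof (rule Bochner_Integration.integrable_bound)
  show "integrable (lebesgue_on torus) (\<lambda>x. 1 + (norm (f x))\<^sup>2)"
    using L2_integrable_norm2[OF assms] by simp
  show "AE x in lebesgue_on torus. norm (f x) \<le> norm (1 + (norm (f x))\<^sup>2)"
  proof (rule AE_I2)
    fix x
    have "2 * norm (f x) \<le> 1 + (norm (f x))\<^sup>2"
      using sum_squares_bound[of 1 "norm (f x)"] by simp
    then show "norm (f x) \<le> norm (1 + (norm (f x))\<^sup>2)"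
      unfolding real_norm_def using norm_ge_zero[of "f x"] zero_le_power2[of "norm (f x)"] by linarith
  qed
qed (rule L2_measurable[OF assms])

lemma L2_dominated:
  assumes "g \<in> borel_measurable (lebesgue_on torus)" "f \<in> L2" "h \<in> L2"
    "AE x in lebesgue_on torus. norm (g x) \<le> norm (f x) + norm (h x)"
  shows "g \<in> L2"
proof -
  have "integrable (lebesgue_on torus) (\<lambda>x. (norm (g x))\<^sup>2)"
  proof (rule Bochner_Integration.integrable_bound)
    show "integrable (lebesgue_on torus) (\<lambda>x. 2 * (norm (f x))\<^sup>2 + 2 * (norm (h x))\<^sup>2)"
      using assms by (simp add: L2_integrable_norm2)
    show "AE x in lebesgue_on torus. norm ((norm (g x))\<^sup>2) \<le> norm (2 * (norm (f x))\<^sup>2 + 2 * (norm (h x))\<^sup>2)"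
      using assms(4)
    proof eventually_elim
      case (elim x)
      then have "(norm (g x))\<^sup>2 \<le> (norm (f x) + norm (h x))\<^sup>2"
        by (intro power_mono) auto
      also have "\<dots> \<le> 2 * (norm (f x))\<^sup>2 + 2 * (norm (h x))\<^sup>2"
        using sum_squares_bound[of "norm (f x)" "norm (h x)"] by (simp add: power2_sum)
      finally show ?case by simp
    qed
  qed (use assms in measurable)
  with assms show ?thesis by (simp add: L2_def)
qed

lemma L2_diff: "f \<in> L2 \<Longrightarrow> g \<in> L2 \<Longrightarrow> (\<lambda>x. f x - g x) \<in> L2"
  by (rule L2_dominated[of _ f g])
    (auto intro!: AE_I2 borel_measurable_diff simp: norm_triangle_ineq4 L2_measurable)

lemma L2_component: "f \<in> L2 \<Longrightarrow> (\<lambda>x. f x $ i) \<in> L2" for f :: "real^2 \<Rightarrow> real^2"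
proof -
  assume f: "f \<in> L2"
  have "(\<lambda>x. f x $ i) \<in> borel_measurable (lebesgue_on torus)"
    using L2_measurable[OF f] by (simp add: cart_eq_inner_axis)
  then show ?thesis
    by (rule L2_dominated[OF _ f L2_const[of "0::real"]]) (simp add: component_le_norm_cart)
qed

lemma L2_truncation_tendsto:
  fixes f :: "real^2 \<Rightarrow> real"
  assumes f: "f \<in> L2"
  shows "(\<lambda>n::nat. LINT x|lebesgue_on torus. (f x - max (- real n) (min (real n) (f x)))\<^sup>2) \<longlonglongrightarrow> 0"
proof -
  note [measurable] = L2_measurable[OF f]
  have "(\<lambda>n::nat. LINT x|lebesgue_on torus. (f x - max (- real n) (min (real n) (f x)))\<^sup>2) \<longlonglongrightarrow>
      (LINT x|lebesgue_on torus. 0)"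
  proof (rule integral_dominated_convergence[where w = "\<lambda>x. (f x)\<^sup>2"])
    show "integrable (lebesgue_on torus) (\<lambda>x. (f x)\<^sup>2)"
      using L2_integrable_norm2[OF f] by simp
    show "AE x in lebesgue_on torus. (\<lambda>n. (f x - max (- real n) (min (real n) (f x)))\<^sup>2) \<longlonglongrightarrow> 0"
    proof (rule AE_I2)
      fix x
      obtain m :: nat where "\<bar>f x\<bar> < real m" using reals_Archimedean2 by blast
      then have "eventually (\<lambda>n. (f x - max (- real n) (min (real n) (f x)))\<^sup>2 = 0) sequentially"
        unfolding eventually_sequentially by (intro exI[of _ m]) auto
      then show "(\<lambda>n. (f x - max (- real n) (min (real n) (f x)))\<^sup>2) \<longlonglongrightarrow> 0"
        by (rule tendsto_eventually)
    qed
    show "AE x in lebesgue_on torus. norm ((f x - max (- real n) (min (real n) (f x)))\<^sup>2) \<le> (f x)\<^sup>2" for n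
      by (intro AE_I2) (auto simp: abs_le_square_iff[symmetric])
  qed auto
  then show ?thesis by simp
qed

lemma trig_poly_dense:
  fixes f :: "real^2 \<Rightarrow> real"
  assumes f: "f \<in> L2" and "e > 0"
  obtains p where "p \<in> trig_poly" "(LINT x|lebesgue_on torus. (f x - p x)\<^sup>2) < e"
proof -
  \<comment> \<open>Each of the two errors, from truncation and from approximation, may take a
    quarter of \<open>e\<close>, because \<open>(x + y)^2 \<le> 2 x^2 + 2 y^2\<close>.\<close>
  have "eventually (\<lambda>n. (LINT x|lebesgue_on torus. (f x - max (- real n) (min (real n) (f x)))\<^sup>2) < e/4) sequentially"
    using order_tendstoD(2)[OF L2_truncation_tendsto[OF f], of "e/4"] \<open>e > 0\<close> by simp
  then obtain n :: nat where n: "(LINT x|lebesgue_on torus. (f x - max (- real n) (min (real n) (f x)))\<^sup>2) < e/4"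
    by (auto simp: eventually_sequentially)
  define g where "g x = max (- real n) (min (real n) (f x))" for x
  have gb: "\<bar>g x\<bar> \<le> real n" for x by (auto simp: g_def)
  have [measurable]: "g \<in> borel_measurable (lebesgue_on torus)"
    unfolding g_def using L2_measurable[OF f] by measurable
  have g: "g \<in> L2" by (rule bounded_imp_L2[of _ "real n"]) (use gb in auto)
  obtain p where p: "\<And>m::nat. p m \<in> trig_poly" "\<And>m x. x \<in> torus \<Longrightarrow> \<bar>p m x\<bar> \<le> real n + 1"
    "AE x in lebesgue_on torus. (\<lambda>m. p m x) \<longlonglongrightarrow> g x"
    using bounded_measurable_trig_approx[of g "real n"] gb by auto
  have [measurable]: "p m \<in> borel_measurable (lebesgue_on torus)" for m
    using L2_measurable[OF trig_poly_L2[OF p(1)]] .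
  have "(\<lambda>m. LINT x|lebesgue_on torus. (g x - p m x)\<^sup>2) \<longlonglongrightarrow> (LINT x|lebesgue_on torus. 0)"
  proof (rule integral_dominated_convergence[where w = "\<lambda>x. (2 * real n + 1)\<^sup>2"])
    show "AE x in lebesgue_on torus. (\<lambda>m. (g x - p m x)\<^sup>2) \<longlonglongrightarrow> 0"
      using p(3)
    proof eventually_elim
      case (elim x)
      from tendsto_power[OF tendsto_diff[OF tendsto_const[of "g x"] this], of 2] show ?case by simp
    qed
    show "AE x in lebesgue_on torus. norm ((g x - p m x)\<^sup>2) \<le> (2 * real n + 1)\<^sup>2" for m
    proof (rule AE_I2)
      fix x assume "x \<in> space (lebesgue_on torus)"
      then have "\<bar>g x - p m x\<bar> \<le> 2 * real n + 1" using gb[of x] p(2)[of x m] by auto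
      from power_mono[OF this, of 2] show "norm ((g x - p m x)\<^sup>2) \<le> (2 * real n + 1)\<^sup>2" by simp
    qed
  qed auto
  then have "eventually (\<lambda>m. (LINT x|lebesgue_on torus. (g x - p m x)\<^sup>2) < e/4) sequentially"
    using \<open>e > 0\<close> by (intro order_tendstoD) auto
  then obtain m where m: "(LINT x|lebesgue_on torus. (g x - p m x)\<^sup>2) < e/4"
    by (auto simp: eventually_sequentially)
  have i: "integrable (lebesgue_on torus) (\<lambda>x. (f x - g x)\<^sup>2)" "integrable (lebesgue_on torus) (\<lambda>x. (g x - p m x)\<^sup>2)"
    "integrable (lebesgue_on torus) (\<lambda>x. (f x - p m x)\<^sup>2)"
    using L2_integrable_norm2[OF L2_diff[OF f g]] L2_integrable_norm2[OF L2_diff[OF g trig_poly_L2[OF p(1)]]]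
      L2_integrable_norm2[OF L2_diff[OF f trig_poly_L2[OF p(1)]]] by simp_all
  have "(LINT x|lebesgue_on torus. (f x - p m x)\<^sup>2) \<le> (LINT x|lebesgue_on torus. 2 * (f x - g x)\<^sup>2 + 2 * (g x - p m x)\<^sup>2)"
  proof (rule integral_mono)
    fix x
    have "0 \<le> ((f x - g x) - (g x - p m x))\<^sup>2" by simp
    then show "(f x - p m x)\<^sup>2 \<le> 2 * (f x - g x)\<^sup>2 + 2 * (g x - p m x)\<^sup>2"
      by (simp add: power2_eq_square algebra_simps)
  qed (use i in auto)
  also have "\<dots> = 2 * (LINT x|lebesgue_on torus. (f x - g x)\<^sup>2) + 2 * (LINT x|lebesgue_on torus. (g x - p m x)\<^sup>2)"
    using i by simp
  also have "\<dots> < e" using n m unfolding g_def by simp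
  finally show thesis using that p(1) by blast
qed

text \<open>Since \<open>h\<close> is merely integrable, Hilbert space arguments do not apply.
  Instead \<open>sgn (h x)\<close> is a limit of uniformly bounded trigonometric polynomials, so the
  integral of \<open>|h|\<close> is a limit of vanishing moments.\<close>

lemma AE_zero_if_trig_moments_zero:
  fixes h :: "real^2 \<Rightarrow> real"
  assumes h: "integrable (lebesgue_on torus) h"
    and 0: "\<And>k \<theta>. k \<in> lattice \<Longrightarrow> (LINT x|lebesgue_on torus. h x * wave k \<theta> x) = 0"
  shows "AE x in lebesgue_on torus. h x = 0"
proof -
  note [measurable] = borel_measurable_integrable[OF h]
  obtain p where p: "\<And>m::nat. p m \<in> trig_poly" "\<And>m x. x \<in> torus \<Longrightarrow> \<bar>p m x\<bar> \<le> 1 + 1"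
    "AE x in lebesgue_on torus. (\<lambda>m. p m x) \<longlonglongrightarrow> sgn (h x)"
    by (rule bounded_measurable_trig_approx[of "\<lambda>x. sgn (h x)" 1]) (auto simp: abs_sgn_eq)
  have pm[measurable]: "p m \<in> borel_measurable (lebesgue_on torus)" for m
    using L2_measurable[OF trig_poly_L2[OF p(1)]] .
  have hq: "integrable (lebesgue_on torus) (\<lambda>x. h x * q x)" if "q \<in> trig_poly" for q
  proof -
    obtain B where B: "\<And>x. x \<in> torus \<Longrightarrow> norm (q x) \<le> B"
      using compact_imp_bounded[OF compact_continuous_image[OF trig_poly_continuous[OF \<open>q \<in> trig_poly\<close>] compact_torus]]
      by (auto simp: bounded_iff)
    have [measurable]: "q \<in> borel_measurable (lebesgue_on torus)"
      using L2_measurable[OF trig_poly_L2[OF that]] .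
    show ?thesis
    proof (rule Bochner_Integration.integrable_bound[where f = "\<lambda>x. B * \<bar>h x\<bar>"])
      show "AE x in lebesgue_on torus. norm (h x * q x) \<le> norm (B * \<bar>h x\<bar>)"
      proof (rule AE_I2)
        fix x assume "x \<in> space (lebesgue_on torus)"
        then have "\<bar>h x\<bar> * \<bar>q x\<bar> \<le> \<bar>h x\<bar> * \<bar>B\<bar>" using B[of x] by (intro mult_left_mono) auto
        then show "norm (h x * q x) \<le> norm (B * \<bar>h x\<bar>)" by (simp add: abs_mult mult.commute)
      qed
    qed (use h in auto)
  qed
  have "(LINT x|lebesgue_on torus. h x * q x) = 0" if "q \<in> trig_poly" for q
    using that
  proof induction
    case (wave k c \<theta>)
    have "(LINT x|lebesgue_on torus. h x * (c * wave k \<theta> x)) = (LINT x|lebesgue_on torus. c * (h x * wave k \<theta> x))"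
      by (simp add: mult_ac)
    then show ?case using 0[OF wave(1)] by simp
  next
    case (add p q)
    then show ?case using hq by (simp add: distrib_left)
  qed
  then have z: "(LINT x|lebesgue_on torus. h x * p m x) = 0" for m using p(1) by blast
  have "(\<lambda>m. LINT x|lebesgue_on torus. h x * p m x) \<longlonglongrightarrow> (LINT x|lebesgue_on torus. \<bar>h x\<bar>)"
  proof (rule integral_dominated_convergence[where w = "\<lambda>x. 2 * \<bar>h x\<bar>"])
    show "AE x in lebesgue_on torus. (\<lambda>m. h x * p m x) \<longlonglongrightarrow> \<bar>h x\<bar>"
      using p(3)
    proof eventually_elim
      case (elim x)
      from tendsto_mult[OF tendsto_const[of "h x"] this] show ?case
        by (simp add: abs_sgn[of "h x", symmetric])
    qed
    show "AE x in lebesgue_on torus. norm (h x * p m x) \<le> 2 * \<bar>h x\<bar>" for m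
    proof (rule AE_I2)
      fix x assume "x \<in> space (lebesgue_on torus)"
      then have "\<bar>h x\<bar> * \<bar>p m x\<bar> \<le> \<bar>h x\<bar> * 2" using p(2)[of x m] by (intro mult_left_mono) auto
      then show "norm (h x * p m x) \<le> 2 * \<bar>h x\<bar>" by (simp add: abs_mult mult.commute)
    qed
  qed (use h in auto)
  then have "(LINT x|lebesgue_on torus. \<bar>h x\<bar>) = 0"
    unfolding z by (simp add: LIMSEQ_const_iff)
  then show ?thesis
    using integral_nonneg_eq_0_iff_AE[of "lebesgue_on torus" "\<lambda>x. \<bar>h x\<bar>"] h by simp
qed


section \<open>Fourier sums and weak gradients\<close>

definition freqs :: "nat \<Rightarrow> (real^2) set" where
  "freqs N = {k \<in> lattice. \<forall>i. \<bar>k $ i\<bar> \<le> real N}"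

text \<open>The phases 0 and \<open>- (pi/2)\<close> are cosine and sine. The sum runs over both
  \<open>k\<close> and \<open>- k\<close>, which carry the same waves; this double counting replaces
  the usual factor 2 at nonzero frequencies and leaves the correct factor 1 at
  \<open>k = 0\<close>.\<close>

definition fourier_sum :: "nat \<Rightarrow> (real^2 \<Rightarrow> real) \<Rightarrow> real^2 \<Rightarrow> real" where
  "fourier_sum N f x = (\<Sum>k\<in>freqs N.
     (LINT y|lebesgue_on torus. f y * wave k 0 y) * wave k 0 x +
     (LINT y|lebesgue_on torus. f y * wave k (- (pi/2)) y) * wave k (- (pi/2)) x)"

lemma finite_freqs: "finite (freqs N)"
proof (rule finite_subset)
  show "freqs N \<subseteq> (\<lambda>(a, b). vector [real_of_int a, real_of_int b]) ` ({- int N..int N} \<times> {- int N..int N})"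
  proof
    fix k assume k: "k \<in> freqs N"
    then obtain a b :: int where ab: "k $ 1 = of_int a" "k $ 2 = of_int b"
      unfolding freqs_def lattice_def by (metis (mono_tags, lifting) Ints_cases mem_Collect_eq)
    have "\<bar>real_of_int a\<bar> \<le> real N" "\<bar>real_of_int b\<bar> \<le> real N"
      using k ab unfolding freqs_def by (metis (mono_tags, lifting) mem_Collect_eq)+
    then have "a \<in> {- int N..int N}" "b \<in> {- int N..int N}" by auto
    moreover have "k = vector [real_of_int a, real_of_int b]"
      using ab by (simp add: vec_eq_iff forall_2)
    ultimately show "k \<in> (\<lambda>(a, b). vector [real_of_int a, real_of_int b]) ` ({- int N..int N} \<times> {- int N..int N})"
      by (intro image_eqI[of _ _ "(a, b)"]) auto
  qed
qed simp

lemma freqs_lattice: "k \<in> freqs N \<Longrightarrow> k \<in> lattice"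
  and freqs_uminus: "k \<in> freqs N \<Longrightarrow> - k \<in> freqs N"
  and freqs_mono: "M \<le> N \<Longrightarrow> freqs M \<subseteq> freqs N"
  by (auto simp: freqs_def lattice_uminus intro: order_trans)

lemma lattice_in_freqs: "k \<in> lattice \<Longrightarrow> \<exists>N. k \<in> freqs N"
proof -
  assume k: "k \<in> lattice"
  obtain N where "norm k \<le> real N" using real_arch_simple by blast
  then have "\<bar>k $ i\<bar> \<le> real N" for i
    using component_le_norm_cart[of k i] by linarith
  with k show ?thesis by (auto simp: freqs_def)
qed

lemma fourier_sum_trig: "fourier_sum N f \<in> trig_poly"
  unfolding fourier_sum_def[abs_def]
  by (intro trig_poly_sum trig_poly.add trig_poly.wave freqs_lattice)

lemma fourier_sum_add:
  assumes "f \<in> L2" "g \<in> L2"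
  shows "fourier_sum N (\<lambda>x. f x + g x) x = fourier_sum N f x + fourier_sum N g x"
  using L2_mult_integrable[OF assms(1) wave_L2] L2_mult_integrable[OF assms(2) wave_L2]
  by (simp add: fourier_sum_def distrib_left distrib_right sum.distrib[symmetric] algebra_simps)

lemma fourier_sum_cmult: "fourier_sum N (\<lambda>x. c * f x) x = c * fourier_sum N f x"
  by (simp add: fourier_sum_def sum_distrib_left algebra_simps)

text \<open>For square-integrable \<open>f\<close> and \<open>h\<close> the right-hand side is
  symmetric in them, which is the self-adjointness of the Fourier projection.\<close>

lemma fourier_sum_inner:
  assumes "h \<in> L2"
  shows "(LINT x|lebesgue_on torus. fourier_sum N f x * h x) = (\<Sum>k\<in>freqs N.
     (LINT y|lebesgue_on torus. f y * wave k 0 y) * (LINT y|lebesgue_on torus. h y * wave k 0 y) +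
     (LINT y|lebesgue_on torus. f y * wave k (- (pi/2)) y) * (LINT y|lebesgue_on torus. h y * wave k (- (pi/2)) y))"
proof -
  note i = L2_mult_integrable[OF assms wave_L2]
  show ?thesis
    unfolding fourier_sum_def sum_distrib_right distrib_right
    by (subst Bochner_Integration.integral_sum)
       (use i in \<open>auto simp: mult.assoc mult.commute[of "wave _ _ _" "h _"]\<close>)
qed

text \<open>There are two conditionals because \<open>k\<close> and \<open>- k\<close> describe the
  same real waves; at \<open>k = l = 0\<close> both are active.\<close>

lemma integral_wave_mult:
  assumes "k \<in> lattice" "l \<in> lattice"
  shows "(LINT x|lebesgue_on torus. wave k \<theta> x * wave l \<phi> x) =
    ((if k = l then cos (\<theta> - \<phi>) else 0) + (if k = - l then cos (\<theta> + \<phi>) else 0)) / 2"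
proof -
  have "(LINT x|lebesgue_on torus. wave k \<theta> x * wave l \<phi> x) =
      (LINT x|lebesgue_on torus. wave (k - l) (\<theta> - \<phi>) x + wave (k + l) (\<theta> + \<phi>) x) / 2"
    by (simp add: wave_mult)
  also have "\<dots> = ((LINT x|lebesgue_on torus. wave (k - l) (\<theta> - \<phi>) x) +
      (LINT x|lebesgue_on torus. wave (k + l) (\<theta> + \<phi>) x)) / 2"
    by (subst Bochner_Integration.integral_add) (auto intro: continuous_imp_integrable_torus wave_continuous)
  also have "\<dots> = ((if k = l then cos (\<theta> - \<phi>) else 0) + (if k = - l then cos (\<theta> + \<phi>) else 0)) / 2"
    by (simp add: integral_wave lattice_add lattice_diff assms eq_neg_iff_add_eq_0)
  finally show ?thesis .
qed

lemma wave_neg: "wave (- k) \<theta> x = wave k (- \<theta>) x"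
  unfolding wave_def by (subst cos_minus[symmetric]) simp

lemma wave_phase: "wave k \<theta> x = cos \<theta> * wave k 0 x - sin \<theta> * wave k (- (pi/2)) x"
  by (simp add: wave_def cos_add sin_diff cos_diff algebra_simps)

text \<open>The frequencies \<open>j\<close> and \<open>- j\<close> each contribute one half of the
  wave. For \<open>j = 0\<close> the two halves come from the same summand.\<close>

lemma fourier_sum_wave:
  assumes j: "j \<in> freqs N"
  shows "fourier_sum N (wave j \<theta>) x = wave j \<theta> x"
proof -
  have "fourier_sum N (wave j \<theta>) x = (\<Sum>k\<in>freqs N.
      (if k = j then (cos \<theta> * wave k 0 x + cos (\<theta> + pi/2) * wave k (- (pi/2)) x) / 2 else 0) +
      (if k = - j then (cos \<theta> * wave k 0 x + cos (\<theta> - pi/2) * wave k (- (pi/2)) x) / 2 else 0))"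
    unfolding fourier_sum_def
  proof (rule sum.cong[OF refl])
    fix k assume k: "k \<in> freqs N"
    have eqs: "j = k \<longleftrightarrow> k = j" "j = - k \<longleftrightarrow> k = - j" by auto
    have split: "((if P then a else 0) + (if Q then a else 0)) / 2 * X + ((if P then b else 0) + (if Q then c else 0)) / 2 * Y =
        (if P then (a * X + b * Y) / 2 else 0) + (if Q then (a * X + c * Y) / 2 else 0)"
      for P Q and a b c X Y :: real
      by (simp add: add_divide_distrib distrib_right)
    show "(LINT y|lebesgue_on torus. wave j \<theta> y * wave k 0 y) * wave k 0 x +
        (LINT y|lebesgue_on torus. wave j \<theta> y * wave k (- (pi/2)) y) * wave k (- (pi/2)) x =
        (if k = j then (cos \<theta> * wave k 0 x + cos (\<theta> + pi/2) * wave k (- (pi/2)) x) / 2 else 0) +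
        (if k = - j then (cos \<theta> * wave k 0 x + cos (\<theta> - pi/2) * wave k (- (pi/2)) x) / 2 else 0)"
      unfolding integral_wave_mult[OF freqs_lattice[OF j] freqs_lattice[OF k]] eqs
      by (simp only: diff_minus_eq_add add_uminus_conv_diff diff_zero add_0_right split)
  qed
  also have "\<dots> = (cos \<theta> * wave j 0 x + cos (\<theta> + pi/2) * wave j (- (pi/2)) x) / 2 +
      (cos \<theta> * wave (- j) 0 x + cos (\<theta> - pi/2) * wave (- j) (- (pi/2)) x) / 2"
    using j freqs_uminus[OF j] by (simp add: sum.distrib finite_freqs)
  also have "\<dots> = wave j \<theta> x"
    by (simp add: wave_neg wave_phase[of j \<theta>] wave_phase[of j "pi/2"] cos_add cos_diff)
  finally show ?thesis .
qed

lemma fourier_sum_trig_poly: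
  assumes "p \<in> trig_poly"
  obtains N where "\<And>M x. N \<le> M \<Longrightarrow> fourier_sum M p x = p x"
proof -
  from assms have "\<exists>N. \<forall>M\<ge>N. \<forall>x. fourier_sum M p x = p x"
  proof induction
    case (wave k c \<theta>)
    then obtain N where "k \<in> freqs N" using lattice_in_freqs by blast
    then have "fourier_sum M (wave k \<theta>) x = wave k \<theta> x" if "M \<ge> N" for M x
      using freqs_mono[OF that] by (intro fourier_sum_wave) auto
    then show ?case by (auto simp: fourier_sum_cmult)
  next
    case (add p q)
    then obtain M N where "\<forall>K\<ge>M. \<forall>x. fourier_sum K p x = p x" "\<forall>K\<ge>N. \<forall>x. fourier_sum K q x = q x"
      by blast
    then show ?case
      using add.hyps by (intro exI[of _ "max M N"]) (simp add: fourier_sum_add trig_poly_L2)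
  qed
  with that show thesis by blast
qed

text \<open>Fourier sums are orthogonal projections, hence at least as good as any other approximation
  by waves of the same frequencies.\<close>

lemma fourier_sum_best_approx:
  fixes f :: "real^2 \<Rightarrow> real"
  assumes f: "f \<in> L2" and p: "p \<in> trig_poly" "\<And>x. fourier_sum N p x = p x"
  shows "(LINT x|lebesgue_on torus. (f x - fourier_sum N f x)\<^sup>2) \<le> (LINT x|lebesgue_on torus. (f x - p x)\<^sup>2)"
proof -
  define h where "h x = f x - p x" for x
  define q where "q = fourier_sum N h"
  have h: "h \<in> L2" unfolding h_def by (intro L2_diff f trig_poly_L2 p)
  have q: "q \<in> L2" "q \<in> trig_poly"
    unfolding q_def by (auto intro: fourier_sum_trig trig_poly_L2)
  have fh: "f = (\<lambda>x. h x + p x)" by (auto simp: h_def)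
  have eq: "f x - fourier_sum N f x = h x - q x" for x
    unfolding fh q_def by (simp add: fourier_sum_add[OF h trig_poly_L2[OF p(1)]] p(2))
  \<comment> \<open>\<open>q\<close> is the projection of \<open>h\<close>. By self-adjointness and
    the invariance of waves under \<open>fourier_sum\<close>, both have the same coefficients at
    every frequency in \<open>freqs N\<close>, so their difference is orthogonal to \<open>q\<close>
    and projecting does not increase the norm.\<close>
  have qq: "(LINT x|lebesgue_on torus. q x * q x) = (LINT x|lebesgue_on torus. q x * h x)"
  proof -
    have coeff: "(LINT y|lebesgue_on torus. q y * wave k \<theta> y) = (LINT y|lebesgue_on torus. h y * wave k \<theta> y)"
      if k: "k \<in> freqs N" for k \<theta>
    proof -
      have "(LINT y|lebesgue_on torus. q y * wave k \<theta> y) = (LINT y|lebesgue_on torus. fourier_sum N (wave k \<theta>) y * h y)"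
        unfolding q_def fourier_sum_inner[OF wave_L2] fourier_sum_inner[OF h] by (simp add: mult.commute)
      then show ?thesis using fourier_sum_wave[OF k] by (simp add: mult.commute)
    qed
    show ?thesis
      unfolding q_def fourier_sum_inner[OF h]
      unfolding q_def[symmetric] fourier_sum_inner[OF q(1), of N h, folded q_def] by (simp add: coeff)
  qed
  have pos: "0 \<le> (LINT x|lebesgue_on torus. q x * h x)"
    unfolding qq[symmetric] by simp
  have "(LINT x|lebesgue_on torus. (h x - q x)\<^sup>2) =
      (LINT x|lebesgue_on torus. h x * h x - 2 * (q x * h x) + q x * q x)"
    by (simp add: power2_eq_square algebra_simps)
  also have "\<dots> = (LINT x|lebesgue_on torus. h x * h x) - (LINT x|lebesgue_on torus. q x * h x)"
    using L2_mult_integrable[OF h h] L2_mult_integrable[OF q(1) h] L2_mult_integrable[OF q(1) q(1)]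
    by (simp add: qq)
  also have "\<dots> \<le> (LINT x|lebesgue_on torus. (h x)\<^sup>2)"
    using pos by (simp add: power2_eq_square)
  finally show ?thesis unfolding eq h_def .
qed

lemma fourier_sum_tendsto:
  assumes f: "f \<in> L2"
  shows "(\<lambda>N. LINT x|lebesgue_on torus. (f x - fourier_sum N f x)\<^sup>2) \<longlonglongrightarrow> 0"
proof (rule LIMSEQ_I)
  fix e :: real assume "e > 0"
  then obtain p where p: "p \<in> trig_poly" "(LINT x|lebesgue_on torus. (f x - p x)\<^sup>2) < e"
    using trig_poly_dense[OF f] by blast
  obtain N where N: "\<And>M x. N \<le> M \<Longrightarrow> fourier_sum M p x = p x"
    using fourier_sum_trig_poly[OF p(1)] by blast
  show "\<exists>N. \<forall>M\<ge>N. norm ((LINT x|lebesgue_on torus. (f x - fourier_sum M f x)\<^sup>2) - 0) < e"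
  proof (intro exI[of _ N] allI impI)
    fix M assume "N \<le> M"
    from fourier_sum_best_approx[OF f p(1) N[OF this]] p(2)
    show "norm ((LINT x|lebesgue_on torus. (f x - fourier_sum M f x)\<^sup>2) - 0) < e" by simp
  qed
qed

section \<open>Gradients of Fourier sums and the transport identity\<close>

lemma wave_has_derivative:
  "(wave k \<theta> has_derivative (\<lambda>v. 2 * pi * (k \<bullet> v) * wave k (\<theta> + pi/2) x)) (at x)"
  unfolding wave_def[abs_def]
  by (auto intro!: derivative_eq_intros simp: cos_add algebra_simps sin_add)

lemma grad_wave: "grad (wave k \<theta>) x $ i = 2 * pi * (k $ i) * wave k (\<theta> + pi/2) x"
  unfolding grad_def frechet_derivative_at[OF wave_has_derivative, symmetric]
  by (simp add: inner_axis)

lemma wave_torus_test: "k \<in> lattice \<Longrightarrow> wave k \<theta> \<in> torus_test"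
  by (simp add: torus_test_def smooth_wave periodic_wave)

lemma weak_grad_wave:
  assumes g: "has_weak_grad f g" and k: "k \<in> lattice"
  shows "(LINT x|lebesgue_on torus. g x $ i * wave k \<theta> x) =
    - 2 * pi * (k $ i) * (LINT x|lebesgue_on torus. f x * wave k (\<theta> + pi/2) x)"
proof -
  have "(LINT x|lebesgue_on torus. f x * grad (wave k \<theta>) x $ i) = - (LINT x|lebesgue_on torus. g x $ i * wave k \<theta> x)"
    using g wave_torus_test[OF k] unfolding has_weak_grad_def by blast
  moreover have "(LINT x|lebesgue_on torus. f x * grad (wave k \<theta>) x $ i) =
      (LINT x|lebesgue_on torus. 2 * pi * (k $ i) * (f x * wave k (\<theta> + pi/2) x))"
    unfolding grad_wave by (simp add: mult_ac)
  ultimately show ?thesis by simp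
qed

text \<open>Differentiating a wave exchanges the two phases, and so does integration by parts in the
  coefficients. Hence the L2 convergence of Fourier sums applied to the components of
  \<open>g\<close> gives convergence of the gradients of the same sums.\<close>

lemma grad_fourier_sum:
  assumes g: "has_weak_grad f g"
  shows "grad (fourier_sum N f) x $ i = fourier_sum N (\<lambda>x. g x $ i) x"
proof -
  have "(fourier_sum N f has_derivative (\<lambda>v. \<Sum>k\<in>freqs N.
     (LINT y|lebesgue_on torus. f y * wave k 0 y) * (2 * pi * (k \<bullet> v) * wave k (0 + pi/2) x) +
     (LINT y|lebesgue_on torus. f y * wave k (- (pi/2)) y) * (2 * pi * (k \<bullet> v) * wave k (- (pi/2) + pi/2) x))) (at x)"
    unfolding fourier_sum_def[abs_def]
    by (intro has_derivative_sum has_derivative_add has_derivative_mult_right wave_has_derivative)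
  then have "grad (fourier_sum N f) x $ i = (\<Sum>k\<in>freqs N.
     (LINT y|lebesgue_on torus. f y * wave k 0 y) * (2 * pi * (k $ i) * wave k (pi/2) x) +
     (LINT y|lebesgue_on torus. f y * wave k (- (pi/2)) y) * (2 * pi * (k $ i) * wave k 0 x))"
    unfolding grad_def by (simp add: frechet_derivative_at[symmetric] inner_axis)
  also have "\<dots> = fourier_sum N (\<lambda>x. g x $ i) x"
    unfolding fourier_sum_def
  proof (rule sum.cong[OF refl])
    fix k assume "k \<in> freqs N"
    note k = freqs_lattice[OF this]
    have "wave k (pi/2) y = - wave k (- (pi/2)) y" for y
      by (simp add: wave_phase[of k "pi/2"])
    then show "(LINT y|lebesgue_on torus. f y * wave k 0 y) * (2 * pi * (k $ i) * wave k (pi/2) x) +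
        (LINT y|lebesgue_on torus. f y * wave k (- (pi/2)) y) * (2 * pi * (k $ i) * wave k 0 x) =
        (LINT y|lebesgue_on torus. g y $ i * wave k 0 y) * wave k 0 x +
        (LINT y|lebesgue_on torus. g y $ i * wave k (- (pi/2)) y) * wave k (- (pi/2)) x"
      by (simp add: weak_grad_wave[OF g k])
  qed
  finally show ?thesis .
qed

lemma L2_tendsto_imp_inner_L1:
  fixes w g :: "real^2 \<Rightarrow> real^2" and G :: "nat \<Rightarrow> real^2 \<Rightarrow> real^2"
  assumes w: "w \<in> L2" and g: "g \<in> L2" and G: "\<And>n. G n \<in> L2"
    and lim: "\<And>i. (\<lambda>n. LINT x|lebesgue_on torus. (g x $ i - G n x $ i)\<^sup>2) \<longlonglongrightarrow> 0"
  shows "(\<lambda>n. LINT x|lebesgue_on torus. \<bar>w x \<bullet> (g x - G n x)\<bar>) \<longlonglongrightarrow> 0"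
proof -
  have d: "(\<lambda>x. g x - G n x) \<in> L2" for n by (intro L2_diff g G)
  have "(\<lambda>n. (LINT x|lebesgue_on torus. (norm (w x))\<^sup>2) *
      (\<Sum>i\<in>UNIV. LINT x|lebesgue_on torus. (g x $ i - G n x $ i)\<^sup>2)) \<longlonglongrightarrow>
      (LINT x|lebesgue_on torus. (norm (w x))\<^sup>2) * (\<Sum>i\<in>(UNIV :: 2 set). 0)"
    by (intro tendsto_intros lim)
  moreover have "(LINT x|lebesgue_on torus. (norm (g x - G n x))\<^sup>2) =
      (\<Sum>i\<in>UNIV. LINT x|lebesgue_on torus. (g x $ i - G n x $ i)\<^sup>2)" for n
  proof -
    have "(norm (g x - G n x))\<^sup>2 = (\<Sum>i\<in>UNIV. (g x $ i - G n x $ i)\<^sup>2)" for x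
      by (simp add: norm_vec_def L2_set_def sum_nonneg)
    moreover have "integrable (lebesgue_on torus) (\<lambda>x. (g x $ i - G n x $ i)\<^sup>2)" for i
      using L2_integrable_norm2[OF L2_component[OF d]] by simp
    ultimately show ?thesis by simp
  qed
  ultimately have lim2: "(\<lambda>n. (LINT x|lebesgue_on torus. (norm (w x))\<^sup>2) *
      (LINT x|lebesgue_on torus. (norm (g x - G n x))\<^sup>2)) \<longlonglongrightarrow> 0" by simp
  have "(\<lambda>n. (LINT x|lebesgue_on torus. \<bar>w x \<bullet> (g x - G n x)\<bar>)\<^sup>2) \<longlonglongrightarrow> 0"
    by (rule Lim_null_comparison[OF _ lim2])
       (auto intro!: always_eventually Cauchy_Schwarz_integral(2) L2_measurable L2_integrable_norm2 w d)
  then show ?thesis by simp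
qed

text \<open>For a trigonometric polynomial \<open>p\<close> the function
  \<open>cos (l * p x)\<close> is a test function, and its gradient is
  \<open>- l * sin (l * p x)\<close> times that of \<open>p\<close>. The passage to \<open>f\<close>
  is done in two stages, first in the gradient and then in the sine.\<close>

lemma transport_orthogonal:
  fixes f :: "real^2 \<Rightarrow> real"
  assumes f: "f \<in> L2" and g: "has_weak_grad f g" and w: "w \<in> L2" "div_free w"
  shows "(LINT x|lebesgue_on torus. w x \<bullet> g x) = 0"
    and "l \<noteq> 0 \<Longrightarrow> (LINT x|lebesgue_on torus. sin (l * f x) * (w x \<bullet> g x)) = 0"
proof -
  define p where "p n = fourier_sum n f" for n
  define G where "G n = grad (p n)" for n
  have gL2: "g \<in> L2" using g by (simp add: has_weak_grad_def)
  have p: "p n \<in> trig_poly" for n unfolding p_def by (rule fourier_sum_trig)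
  have sp: "smooth (p n)" "periodic (p n)" for n
    using trig_poly_imp_test[OF p] by (auto simp: torus_test_def)
  have Gi: "G n x $ i = fourier_sum n (\<lambda>x. g x $ i) x" for n x i
    unfolding G_def p_def by (rule grad_fourier_sum[OF g])
  have "continuous_on torus (G n)" for n
  proof -
    have "continuous_on torus (\<lambda>x. \<chi> i. fourier_sum n (\<lambda>x. g x $ i) x)"
      by (intro continuous_on_vec_lambda trig_poly_continuous fourier_sum_trig)
    moreover have "G n = (\<lambda>x. \<chi> i. fourier_sum n (\<lambda>x. g x $ i) x)"
      by (auto simp: vec_eq_iff Gi)
    ultimately show ?thesis by simp
  qed
  then have G: "G n \<in> L2" for n by (rule continuous_imp_L2)
  have L1: "(\<lambda>n. LINT x|lebesgue_on torus. \<bar>w x \<bullet> (g x - G n x)\<bar>) \<longlonglongrightarrow> 0"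
    by (rule L2_tendsto_imp_inner_L1[OF w(1) gL2 G])
       (unfold Gi, rule fourier_sum_tendsto[OF L2_component[OF gL2]])
  note [measurable] = L2_measurable[OF f]
  have pm[measurable]: "p n \<in> borel_measurable (lebesgue_on torus)" for n
    using L2_measurable[OF trig_poly_L2[OF p]] .
  have wg: "integrable (lebesgue_on torus) (\<lambda>x. w x \<bullet> g x)" by (rule L2_inner_integrable[OF w(1) gL2])
  have wG: "integrable (lebesgue_on torus) (\<lambda>x. w x \<bullet> G n x)" for n by (rule L2_inner_integrable[OF w(1) G])
  note [measurable] = borel_measurable_integrable[OF wg] borel_measurable_integrable[OF wG]
  \<comment> \<open>The price of replacing \<open>g\<close> by \<open>G n\<close> does not depend on
    the factor \<open>c\<close>, which may therefore change with \<open>n\<close>. It is used for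
    the constant 1 and for the sine of \<open>l\<close> times an approximant.\<close>
  have bound: "\<bar>(LINT x|lebesgue_on torus. c x * (w x \<bullet> g x)) - (LINT x|lebesgue_on torus. c x * (w x \<bullet> G n x))\<bar>
      \<le> (LINT x|lebesgue_on torus. \<bar>w x \<bullet> (g x - G n x)\<bar>)"
    if c[measurable]: "c \<in> borel_measurable (lebesgue_on torus)" "\<And>x. \<bar>c x\<bar> \<le> 1" for c :: "real^2 \<Rightarrow> real" and n
  proof -
    have ci: "integrable (lebesgue_on torus) (\<lambda>x. c x * h x)" if "integrable (lebesgue_on torus) h" for h
    proof (rule Bochner_Integration.integrable_bound[OF that])
      show "AE x in lebesgue_on torus. norm (c x * h x) \<le> norm (h x)"
        using c(2) by (intro AE_I2) (simp add: abs_mult mult_left_le_one_le)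
    qed (use borel_measurable_integrable[OF that] in measurable)
    have "(LINT x|lebesgue_on torus. c x * (w x \<bullet> g x)) - (LINT x|lebesgue_on torus. c x * (w x \<bullet> G n x))
        = (LINT x|lebesgue_on torus. c x * (w x \<bullet> (g x - G n x)))"
      using ci[OF wg] ci[OF wG] by (simp add: inner_diff_right right_diff_distrib)
    also have "\<bar>\<dots>\<bar> \<le> (LINT x|lebesgue_on torus. \<bar>c x * (w x \<bullet> (g x - G n x))\<bar>)"
      by (rule integral_abs_bound)
    also have "\<dots> \<le> (LINT x|lebesgue_on torus. \<bar>w x \<bullet> (g x - G n x)\<bar>)"
    proof (rule integral_mono)
      show "integrable (lebesgue_on torus) (\<lambda>x. \<bar>w x \<bullet> (g x - G n x)\<bar>)"
        using wg wG by (simp add: inner_diff_right)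
      then show "integrable (lebesgue_on torus) (\<lambda>x. \<bar>c x * (w x \<bullet> (g x - G n x))\<bar>)"
        using ci[of "\<lambda>x. \<bar>w x \<bullet> (g x - G n x)\<bar>"] ci[of "\<lambda>x. w x \<bullet> (g x - G n x)"] wg wG
        by (simp add: inner_diff_right)
    qed (use c(2) in \<open>simp add: abs_mult mult_left_le_one_le\<close>)
    finally show ?thesis .
  qed
  have "(LINT x|lebesgue_on torus. w x \<bullet> G n x) = 0" for n
    using w(2) trig_poly_imp_test[OF p] by (simp add: div_free_def G_def)
  with bound[of "\<lambda>_. 1"] have "\<bar>LINT x|lebesgue_on torus. w x \<bullet> g x\<bar>
      \<le> (LINT x|lebesgue_on torus. \<bar>w x \<bullet> (g x - G n x)\<bar>)" for n by simp
  then have "\<bar>LINT x|lebesgue_on torus. w x \<bullet> g x\<bar> \<le> 0"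
    by (intro LIMSEQ_le_const[OF L1]) auto
  then show "(LINT x|lebesgue_on torus. w x \<bullet> g x) = 0" by simp

  assume l: "l \<noteq> 0"
  have z: "(LINT x|lebesgue_on torus. sin (l * p n x) * (w x \<bullet> G n x)) = 0" for n
  proof -
    have "(\<lambda>x. cos (l * p n x)) \<in> torus_test"
      unfolding torus_test_def using sp[of n]
      by (simp add: smooth_cos smooth_mult smooth_const) (simp add: periodic_def)
    moreover have "grad (\<lambda>x. cos (l * p n x)) x = (- l * sin (l * p n x)) *\<^sub>R G n x" for x
    proof -
      have "((\<lambda>x. cos (l * p n x)) has_derivative
          (\<lambda>v. (l * frechet_derivative (p n) (at x) v) * - sin (l * p n x))) (at x)"
        by (rule has_derivative_cos[OF has_derivative_mult_right[OF smooth_has_derivative[OF sp(1)]]])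
      from frechet_derivative_at[OF this, symmetric] show ?thesis
        by (simp add: grad_def G_def vec_eq_iff)
    qed
    ultimately have "(LINT x|lebesgue_on torus. w x \<bullet> ((- l * sin (l * p n x)) *\<^sub>R G n x)) = 0"
      using w(2) unfolding div_free_def by (metis (no_types, lifting) Bochner_Integration.integral_cong)
    moreover have "(LINT x|lebesgue_on torus. w x \<bullet> ((- l * sin (l * p n x)) *\<^sub>R G n x)) =
        (LINT x|lebesgue_on torus. (- l) * (sin (l * p n x) * (w x \<bullet> G n x)))"
      by (intro Bochner_Integration.integral_cong) auto
    ultimately show ?thesis using l by (simp only: integral_mult_right_zero) simp
  qed
  \<comment> \<open>Convergence in L2 gives convergence almost everywhere along a subsequence only;
    this suffices to pass to the limit in the sine, with \<open>w x \<bullet> g x\<close> as the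
    integrable majorant.\<close>
  have "(\<lambda>n. LINT x|lebesgue_on torus. norm ((p n x - f x)\<^sup>2 - 0)) \<longlonglongrightarrow> 0"
    using fourier_sum_tendsto[OF f] by (simp add: p_def power2_commute)
  then obtain r :: "nat \<Rightarrow> nat" where r: "strict_mono r"
      "AE x in lebesgue_on torus. (\<lambda>n. (p (r n) x - f x)\<^sup>2 - 0) \<longlonglongrightarrow> 0"
    using tendsto_L1_AE_subseq[of "lebesgue_on torus" "\<lambda>n x. (p n x - f x)\<^sup>2 - 0"]
      L2_integrable_norm2[OF L2_diff[OF trig_poly_L2[OF p] f]] by auto
  have "(\<lambda>n. LINT x|lebesgue_on torus. sin (l * p (r n) x) * (w x \<bullet> g x)) \<longlonglongrightarrow>
      (LINT x|lebesgue_on torus. sin (l * f x) * (w x \<bullet> g x))"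
  proof (rule integral_dominated_convergence[where w = "\<lambda>x. \<bar>w x \<bullet> g x\<bar>"])
    show "AE x in lebesgue_on torus. (\<lambda>n. sin (l * p (r n) x) * (w x \<bullet> g x)) \<longlonglongrightarrow> sin (l * f x) * (w x \<bullet> g x)"
      using r(2)
    proof eventually_elim
      case (elim x)
      then have "(\<lambda>n. p (r n) x - f x) \<longlonglongrightarrow> 0" by simp
      then have "(\<lambda>n. p (r n) x) \<longlonglongrightarrow> f x" by (simp add: LIM_zero_iff)
      then show ?case by (intro tendsto_intros)
    qed
    show "AE x in lebesgue_on torus. norm (sin (l * p (r n) x) * (w x \<bullet> g x)) \<le> \<bar>w x \<bullet> g x\<bar>" for n
      by (intro AE_I2) (simp add: abs_mult mult_left_le_one_le)
  qed (use wg in auto)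
  moreover have "(\<lambda>n. LINT x|lebesgue_on torus. sin (l * p (r n) x) * (w x \<bullet> g x)) \<longlonglongrightarrow> 0"
  proof (rule Lim_null_comparison[OF _ LIMSEQ_subseq_LIMSEQ[OF L1 r(1)]], intro always_eventually allI)
    fix n
    show "norm (LINT x|lebesgue_on torus. sin (l * p (r n) x) * (w x \<bullet> g x))
        \<le> ((\<lambda>n. LINT x|lebesgue_on torus. \<bar>w x \<bullet> (g x - G n x)\<bar>) \<circ> r) n"
      using bound[of "\<lambda>x. sin (l * p (r n) x)" "r n"] z[of "r n"] by simp
  qed
  ultimately show "(LINT x|lebesgue_on torus. sin (l * f x) * (w x \<bullet> g x)) = 0"
    using LIMSEQ_unique by blast
qed


section \<open>Fubini for Lebesgue measure and an absolutely continuous chain rule\<close>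

text \<open>Lebesgue measure on a product is the completion of a product measure, not a product
  measure itself. Iterated integrals are therefore handled for a Borel function \<open>h'\<close>
  that agrees almost everywhere with the extension of \<open>h\<close> by 0.\<close>

lemma lebesgue_on_via_lborel:
  fixes h h' :: "'a::euclidean_space \<Rightarrow> real"
  assumes A: "A \<in> sets lebesgue" and h': "h' \<in> borel_measurable borel"
    and eq: "AE x in lborel. h' x = indicator A x * h x"
  shows "h \<in> borel_measurable (lebesgue_on A)"
    and "integrable (lebesgue_on A) h \<longleftrightarrow> integrable lborel h'"
    and "(LINT x|lebesgue_on A. h x) = (LINT x|lborel. h' x)"
proof -
  have h'l: "h' \<in> borel_measurable lebesgue"
    using h' by (intro measurable_completion) simp
  have eql: "AE x in lebesgue. h' x = indicator A x * h x"
    using eq by (rule AE_completion)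
  have m: "(\<lambda>x. indicator A x *\<^sub>R h x) \<in> borel_measurable lebesgue"
    using borel_measurable_AE[OF h'l eql] by simp
  have A': "A \<inter> space lebesgue \<in> sets lebesgue" using A by simp
  show "h \<in> borel_measurable (lebesgue_on A)"
    using m by (simp only: borel_measurable_restrict_space_iff[OF A'])
  have "integrable (lebesgue_on A) h \<longleftrightarrow> integrable lebesgue (\<lambda>x. indicator A x *\<^sub>R h x)"
    by (rule integrable_restrict_space[OF A'])
  also have "\<dots> \<longleftrightarrow> integrable lebesgue h'"
    using eql by (intro integrable_cong_AE m h'l) auto
  also have "\<dots> \<longleftrightarrow> integrable lborel h'"
    using h' by (intro integrable_completion) simp
  finally show "integrable (lebesgue_on A) h \<longleftrightarrow> integrable lborel h'" .
  have "(LINT x|lebesgue_on A. h x) = (LINT x|lebesgue. indicator A x *\<^sub>R h x)"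
    by (rule integral_restrict_space[OF A'])
  also have "\<dots> = (LINT x|lebesgue. h' x)"
    using eql by (intro integral_cong_AE m h'l) auto
  also have "\<dots> = (LINT x|lborel. h' x)"
    using h' by (intro integral_completion) simp
  finally show "(LINT x|lebesgue_on A. h x) = (LINT x|lborel. h' x)" .
qed

lemma lebesgue_on_borel_version:
  fixes f :: "'a::euclidean_space \<Rightarrow> real"
  assumes A: "A \<in> sets lebesgue" and f: "f \<in> borel_measurable (lebesgue_on A)"
  obtains f' where "f' \<in> borel_measurable borel" "AE x in lborel. f' x = indicator A x * f x"
proof -
  have "(\<lambda>x. indicator A x *\<^sub>R f x) \<in> borel_measurable lebesgue"
    using A f by (subst (asm) borel_measurable_restrict_space_iff) auto
  from completion_ex_borel_measurable_real[OF this] obtain f' where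
    "f' \<in> borel_measurable lborel" "AE x in lborel. indicator A x *\<^sub>R f x = f' x" by blast
  with that[of f'] show thesis by (auto simp: eq_commute)
qed

lemma AE_lborel_sections:
  fixes P :: "'a::euclidean_space \<times> 'b::euclidean_space \<Rightarrow> bool"
  assumes "AE z in lborel. P z"
  shows "AE t in lborel. AE x in lborel. P (x, t)" and "AE x in lborel. AE t in lborel. P (x, t)"
proof -
  have ae: "AE z in lborel \<Otimes>\<^sub>M lborel. P z"
    unfolding lborel_prod by (rule assms)
  then show "AE x in lborel. AE t in lborel. P (x, t)"
    by (rule lborel_pair.AE_pair)
  \<comment> \<open>Interchanging the two quantifiers requires a measurable set, whereas the
    exceptional set of \<open>P\<close> need not be one; it is enlarged to a measurable null set
    \<open>N\<close>.\<close>
  obtain N where N: "{z \<in> space (lborel \<Otimes>\<^sub>M lborel). \<not> P z} \<subseteq> N" "emeasure (lborel \<Otimes>\<^sub>M lborel) N = 0"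
    "N \<in> sets (lborel \<Otimes>\<^sub>M lborel)"
    using AE_E[OF ae] by blast
  have "AE z in lborel \<Otimes>\<^sub>M lborel. z \<notin> N"
    using N by (intro AE_not_in) auto
  then have "AE x in lborel. AE t in lborel. (x, t) \<notin> N"
    by (rule lborel_pair.AE_pair)
  then have "AE t in lborel. AE x in lborel. (x, t) \<notin> N"
  proof (subst lborel_pair.AE_commute[symmetric])
    have "{z \<in> space (lborel \<Otimes>\<^sub>M lborel). (fst z, snd z) \<notin> N} = space (lborel \<Otimes>\<^sub>M lborel) - N"
      by auto
    then show "{z \<in> space (lborel \<Otimes>\<^sub>M lborel). (fst z, snd z) \<notin> N} \<in> sets (lborel \<Otimes>\<^sub>M lborel)"
      using sets.compl_sets[OF N(3)] by simp
  qed
  then show "AE t in lborel. AE x in lborel. P (x, t)"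
    using N(1) by (auto simp: space_pair_measure elim!: eventually_mono)
qed

lemma lebesgue_on_Times_sets:
  fixes A :: "'a::euclidean_space set" and B :: "'b::euclidean_space set"
  assumes "A \<in> sets borel" "B \<in> sets borel"
  shows "A \<times> B \<in> sets lebesgue" "A \<times> B \<in> sets borel"
  using assms borel_Times[of A B] by auto

lemma lebesgue_on_Times_sections:
  fixes f :: "'a::euclidean_space \<times> 'b::euclidean_space \<Rightarrow> real"
  assumes A: "A \<in> sets borel" and B: "B \<in> sets borel"
    and f': "f' \<in> borel_measurable borel" "AE z in lborel. f' z = indicator (A \<times> B) z * f z"
  shows "AE t in lborel. (\<lambda>x. f' (x, t)) \<in> borel_measurable borel \<and>
     (if t \<in> B then AE x in lborel. f' (x, t) = indicator A x * f (x, t) else AE x in lborel. f' (x, t) = 0)"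
  using AE_lborel_sections(1)[OF f'(2)]
proof eventually_elim
  case (elim t)
  have "(\<lambda>x. f' (x, t)) \<in> borel_measurable borel"
    using f'(1) by (rule measurable_compose[rotated]) (simp add: borel_measurable_Pair)
  with elim show ?case by (auto simp: indicator_times)
qed

text \<open>Only almost every section of \<open>f\<close> is known to be measurable. The inner
  integral agrees for almost every \<open>t\<close> with that of a Borel version, and completeness
  of Lebesgue measure does the rest.\<close>

lemma fubini_lebesgue_on:
  fixes f :: "'a::euclidean_space \<times> 'b::euclidean_space \<Rightarrow> real"
  assumes A: "A \<in> sets borel" and B: "B \<in> sets borel" and f: "integrable (lebesgue_on (A \<times> B)) f"
  shows "integrable (lebesgue_on B) (\<lambda>t. LINT x|lebesgue_on A. f (x, t))"
    "(LINT z|lebesgue_on (A \<times> B). f z) = (LINT t|lebesgue_on B. LINT x|lebesgue_on A. f (x, t))"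
proof -
  note AB = lebesgue_on_Times_sets[OF A B]
  obtain f' where f': "f' \<in> borel_measurable borel" "AE z in lborel. f' z = indicator (A \<times> B) z * f z"
    using lebesgue_on_borel_version[OF AB(1) borel_measurable_integrable[OF f]] by blast
  note via = lebesgue_on_via_lborel[OF AB(1) f']
  have f'i: "integrable (lborel \<Otimes>\<^sub>M lborel) (case_prod (\<lambda>x t. f' (x, t)))"
    using via(2) f by (simp add: lborel_prod)
  define \<phi> where "\<phi> t = (LINT x|lborel. f' (x, t))" for t
  have \<phi>: "integrable lborel \<phi>" unfolding \<phi>_def by (rule lborel_pair.integrable_snd[OF f'i])
  have "AE t in lborel. \<phi> t = indicator B t * (LINT x|lebesgue_on A. f (x, t))"
    using lebesgue_on_Times_sections[OF A B f']
  proof eventually_elim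
    case (elim t)
    show ?case
    proof (cases "t \<in> B")
      case True
      then show ?thesis
        using lebesgue_on_via_lborel(3)[of A "\<lambda>x. f' (x, t)" "\<lambda>x. f (x, t)"] elim A by (simp add: \<phi>_def)
    next
      case False
      have "\<phi> t = (LINT x|(lborel :: 'a measure). 0)"
        unfolding \<phi>_def by (intro integral_cong_AE) (use elim False in simp_all)
      with False show ?thesis by simp
    qed
  qed
  note via2 = lebesgue_on_via_lborel[OF _ _ this]
  have B': "B \<in> sets lebesgue" "\<phi> \<in> borel_measurable borel" using B borel_measurable_integrable[OF \<phi>] by auto
  show "integrable (lebesgue_on B) (\<lambda>t. LINT x|lebesgue_on A. f (x, t))"
    using via2(2)[OF B'] \<phi> by simp
  have "(LINT z|lebesgue_on (A \<times> B). f z) = (LINT z|(lborel \<Otimes>\<^sub>M lborel). f' z)"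
    using via(3) by (simp add: lborel_prod)
  also have "\<dots> = (LINT t|lborel. \<phi> t)"
    unfolding \<phi>_def using lborel_pair.integral_snd[OF f'i] by simp
  finally show "(LINT z|lebesgue_on (A \<times> B). f z) = (LINT t|lebesgue_on B. LINT x|lebesgue_on A. f (x, t))"
    using via2(3)[OF B'] by simp
qed

text \<open>Tailored to functions that are bounded in time with values in L1 of space, which is what
  products of two fields in \<open>Cw_L2\<close> are.\<close>

lemma tonelli_lebesgue_on:
  fixes f :: "'a::euclidean_space \<times> 'b::euclidean_space \<Rightarrow> real"
  assumes A: "A \<in> sets borel" and B: "B \<in> sets borel" and Bfin: "emeasure lborel B < \<infinity>"
    and f: "f \<in> borel_measurable (lebesgue_on (A \<times> B))"
    and bound: "AE t in lebesgue_on B. integrable (lebesgue_on A) (\<lambda>x. f (x, t)) \<and>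
       (LINT x|lebesgue_on A. \<bar>f (x, t)\<bar>) \<le> C"
  shows "integrable (lebesgue_on (A \<times> B)) f"
proof -
  note AB = lebesgue_on_Times_sets[OF A B]
  obtain f' where f': "f' \<in> borel_measurable borel" "AE z in lborel. f' z = indicator (A \<times> B) z * f z"
    using lebesgue_on_borel_version[OF AB(1) f] by blast
  have bound': "AE t in lborel. t \<in> B \<longrightarrow> integrable (lebesgue_on A) (\<lambda>x. f (x, t)) \<and>
       (LINT x|lebesgue_on A. \<bar>f (x, t)\<bar>) \<le> C"
    using bound B by (subst (asm) AE_restrict_space_iff) (auto simp: AE_completion_iff)
  have [measurable]: "f' \<in> borel_measurable (lborel \<Otimes>\<^sub>M lborel)"
    using f'(1) by (simp add: lborel_prod)
  have "(\<integral>\<^sup>+ z. ennreal (norm (f' z)) \<partial>lborel) = (\<integral>\<^sup>+ t. (\<integral>\<^sup>+ x. ennreal (norm (f' (x, t))) \<partial>lborel) \<partial>lborel)"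
  proof -
    have "(\<lambda>z. ennreal (norm (f' z))) \<in> borel_measurable (lborel \<Otimes>\<^sub>M lborel)" by measurable
    from lborel_pair.nn_integral_snd[OF this] show ?thesis by (simp add: lborel_prod)
  qed
  also have "\<dots> \<le> (\<integral>\<^sup>+ t. ennreal C * indicator B t \<partial>lborel)"
  proof (rule nn_integral_mono_AE)
    show "AE t in lborel. (\<integral>\<^sup>+ x. ennreal (norm (f' (x, t))) \<partial>lborel) \<le> ennreal C * indicator B t"
      using lebesgue_on_Times_sections[OF A B f'] bound'
    proof eventually_elim
      case (elim t)
      show ?case
      proof (cases "t \<in> B")
        case True
        then have eq: "AE x in lborel. f' (x, t) = indicator A x * f (x, t)" using elim by simp
        then have eq': "AE x in lborel. \<bar>f' (x, t)\<bar> = indicator A x * \<bar>f (x, t)\<bar>"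
          by eventually_elim (simp add: abs_mult)
        have "integrable lborel (\<lambda>x. f' (x, t))"
          using lebesgue_on_via_lborel(2)[OF _ _ eq] elim A True by simp
        then have "(\<integral>\<^sup>+ x. ennreal (norm (f' (x, t))) \<partial>lborel) = ennreal (LINT x|lborel. \<bar>f' (x, t)\<bar>)"
          by (subst nn_integral_eq_integral) auto
        also have "(LINT x|lborel. \<bar>f' (x, t)\<bar>) = (LINT x|lebesgue_on A. \<bar>f (x, t)\<bar>)"
          using lebesgue_on_via_lborel(3)[OF _ _ eq'] elim A by simp
        finally show ?thesis using True elim by (simp add: ennreal_leI)
      next
        case False
        then have "(\<integral>\<^sup>+ x. ennreal (norm (f' (x, t))) \<partial>lborel) = (\<integral>\<^sup>+ x. 0 \<partial>(lborel :: 'a measure))"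
          by (intro nn_integral_cong_AE) (use elim False in \<open>auto elim!: eventually_mono\<close>)
        then show ?thesis by simp
      qed
    qed
  qed
  also have "\<dots> = ennreal C * emeasure lborel B"
    using B by (subst nn_integral_cmult_indicator) auto
  also have "\<dots> < \<infinity>" using Bfin by (simp add: ennreal_mult_less_top)
  finally have "integrable lborel f'"
    using f'(1) by (intro integrableI_bounded) auto
  then show ?thesis
    using lebesgue_on_via_lborel(2)[OF AB(1) f'] by simp
qed

text \<open>The integrated chain rule for \<open>cos (l * y)\<close>, where \<open>y\<close> starts
  at \<open>c\<close> and has derivative \<open>- f\<close>. As a predicate of \<open>f\<close> it
  can be passed through limits in \<open>f\<close>.\<close>

definition cos_chain :: "real \<Rightarrow> real \<Rightarrow> real \<Rightarrow> (real \<Rightarrow> real) \<Rightarrow> bool" where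
  "cos_chain l c t f \<longleftrightarrow> cos (l * (c - (LBINT s:{0..t}. f s))) - cos (l * c) =
     (LBINT r:{0..t}. sin (l * (c - (LBINT s:{0..r}. f s))) * (l * f r))"

lemma cos_chain_continuous:
  assumes f: "continuous_on UNIV f" and t: "0 \<le> t"
  shows "cos_chain l c t f"
proof -
  define F where "F r = (LBINT s:{0..r}. f s)" for r
  have Fi: "F r = integral {0..r} f" for r
    unfolding F_def
    by (intro set_borel_integral_eq_integral borel_integrable_atLeastAtMost'[unfolded set_integrable_def[symmetric]]
        continuous_on_subset[OF f]) auto
  have dF: "(F has_real_derivative f r) (at r within {0..t})" if "r \<in> {0..t}" for r
    unfolding Fi using continuous_on_subset[OF f] that by (intro integral_has_real_derivative) auto
  have cF: "continuous_on {0..t} F"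
    using dF by (meson DERIV_continuous_on)
  have "(LBINT r:{0..t}. sin (l * (c - F r)) * (l * f r)) = cos (l * (c - F t)) - cos (l * (c - F 0))"
    unfolding set_lebesgue_integral_def
  proof (rule integral_FTC_Icc[OF t])
    show "((\<lambda>r. cos (l * (c - F r))) has_vector_derivative sin (l * (c - F r)) * (l * f r)) (at r within {0..t})"
      if "0 \<le> r" "r \<le> t" for r
      unfolding has_real_derivative_iff_has_vector_derivative[symmetric]
      using that by (auto intro!: derivative_eq_intros dF)
    show "continuous_on {0..t} (\<lambda>r. sin (l * (c - F r)) * (l * f r))"
      by (intro continuous_intros cF continuous_on_subset[OF f]) auto
  qed
  moreover have "F 0 = 0" by (simp add: Fi)
  ultimately show ?thesis by (simp add: cos_chain_def F_def)
qed

text \<open>The primitives converge at every time by dominated convergence. On the right-hand side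
  the sine is bounded and continuous, and the derivative enters only as a factor, so the majorant
  \<open>w\<close> serves there as well.\<close>

lemma cos_chain_limit:
  fixes f w :: "real \<Rightarrow> real" and g :: "nat \<Rightarrow> real \<Rightarrow> real"
  assumes t: "0 \<le> t" and P: "\<And>n. cos_chain l c t (g n)"
    and g[measurable]: "\<And>n. g n \<in> borel_measurable borel" and f[measurable]: "f \<in> borel_measurable borel"
    and lim: "AE r in lborel. r \<in> {0..t} \<longrightarrow> (\<lambda>n. g n r) \<longlonglongrightarrow> f r"
    and bound: "\<And>n. AE r in lborel. r \<in> {0..t} \<longrightarrow> \<bar>g n r\<bar> \<le> w r"
    and w: "set_integrable lborel {0..t} w"
  shows "cos_chain l c t f"
proof -
  have w': "integrable lborel (\<lambda>r. indicator {0..t} r * w r)"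
    using w by (simp add: set_integrable_def)
  note [measurable] = borel_measurable_integrable[OF w']
  have wnn: "AE r in lborel. r \<in> {0..t} \<longrightarrow> 0 \<le> w r"
    using bound[of 0] by eventually_elim auto
  have F: "(\<lambda>n. LBINT s:{0..r}. g n s) \<longlonglongrightarrow> (LBINT s:{0..r}. f s)" if "r \<in> {0..t}" for r
    unfolding set_lebesgue_integral_def
  proof (rule integral_dominated_convergence[OF _ _ w'])
    show "AE s in lborel. (\<lambda>n. indicator {0..r} s *\<^sub>R g n s) \<longlonglongrightarrow> indicator {0..r} s *\<^sub>R f s"
      using lim that by (auto elim!: eventually_mono simp: indicator_def)
    show "AE s in lborel. norm (indicator {0..r} s *\<^sub>R g n s) \<le> indicator {0..t} s * w s" for n
      using bound[of n] wnn by eventually_elim (use that in \<open>auto simp: indicator_def\<close>)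
  qed auto
  \<comment> \<open>Moving the variable endpoint \<open>r\<close> into the integrand makes this an
    integral depending measurably on a parameter.\<close>
  have mF[measurable]: "(\<lambda>r. LBINT s:{0..r}. h s) \<in> borel_measurable borel" if [measurable]: "h \<in> borel_measurable borel" for h :: "real \<Rightarrow> real"
  proof -
    have "(\<lambda>r. LBINT s. (if 0 \<le> s \<and> s \<le> r then h s else 0)) \<in> borel_measurable borel"
      by measurable
    moreover have "(LBINT s:{0..r}. h s) = (LBINT s. (if 0 \<le> s \<and> s \<le> r then h s else 0))" for r
      unfolding set_lebesgue_integral_def by (intro Bochner_Integration.integral_cong) auto
    ultimately show ?thesis by simp
  qed
  have "(\<lambda>n. LBINT r:{0..t}. sin (l * (c - (LBINT s:{0..r}. g n s))) * (l * g n r)) \<longlonglongrightarrow>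
      (LBINT r:{0..t}. sin (l * (c - (LBINT s:{0..r}. f s))) * (l * f r))"
    unfolding set_lebesgue_integral_def[of _ "{0..t}"]
  proof (rule integral_dominated_convergence[where w = "\<lambda>r. \<bar>l\<bar> * (indicator {0..t} r * w r)"])
    show "AE r in lborel. (\<lambda>n. indicator {0..t} r *\<^sub>R (sin (l * (c - (LBINT s:{0..r}. g n s))) * (l * g n r)))
        \<longlonglongrightarrow> indicator {0..t} r *\<^sub>R (sin (l * (c - (LBINT s:{0..r}. f s))) * (l * f r))"
      using lim
    proof eventually_elim
      case (elim r)
      show ?case
      proof (cases "r \<in> {0..t}")
        case True
        then show ?thesis using elim F[OF True] by (intro tendsto_intros) auto
      qed simp
    qed
    show "AE r in lborel. norm (indicator {0..t} r *\<^sub>R (sin (l * (c - (LBINT s:{0..r}. g n s))) * (l * g n r)))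
        \<le> \<bar>l\<bar> * (indicator {0..t} r * w r)" for n
      using bound[of n] wnn
    proof eventually_elim
      case (elim r)
      show ?case
      proof (cases "r \<in> {0..t}")
        case True
        have "\<bar>sin (l * (c - (LBINT s:{0..r}. g n s)))\<bar> * (\<bar>l\<bar> * \<bar>g n r\<bar>) \<le> 1 * (\<bar>l\<bar> * w r)"
          using elim True by (intro mult_mono mult_left_mono) simp_all
        then show ?thesis using True by (simp add: abs_mult)
      qed simp
    qed
    show "integrable lborel (\<lambda>r. \<bar>l\<bar> * (indicator {0..t} r * w r))"
      using w' by (rule integrable_mult_right)
  qed measurable
  moreover have "(\<lambda>n. cos (l * (c - (LBINT s:{0..t}. g n s))) - cos (l * c)) \<longlonglongrightarrow>
      cos (l * (c - (LBINT s:{0..t}. f s))) - cos (l * c)"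
    using F[of t] t by (intro tendsto_intros) auto
  ultimately show ?thesis
    using P unfolding cos_chain_def by (simp add: LIMSEQ_unique)
qed

text \<open>The chain rule for \<open>cos\<close> of an absolutely continuous function, by approximation of its
  derivative.\<close>

lemma cos_chain_integrable:
  fixes f :: "real \<Rightarrow> real"
  assumes t: "0 \<le> t" and f[measurable]: "f \<in> borel_measurable borel" and fi: "set_integrable lborel {0..t} f"
  shows "cos_chain l c t f"
proof -
  \<comment> \<open>Bounded derivatives come first: a measurable function is almost everywhere a
    limit of continuous ones, which are clamped to keep the bound \<open>B\<close>. General
    derivatives are then truncated, with \<open>|f|\<close> as majorant.\<close>
  have bdd: "cos_chain l c t h" if [measurable]: "h \<in> borel_measurable borel" and hB: "\<And>r. \<bar>h r\<bar> \<le> B"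
    for h :: "real \<Rightarrow> real" and B
  proof -
    have "h measurable_on UNIV"
      by (simp add: measurable_on_iff_borel_measurable lebesgue_on_UNIV_eq measurable_completion)
    then obtain N g where N: "negligible N" and g: "\<And>n::nat. continuous_on UNIV (g n)"
      "\<And>r. r \<notin> N \<Longrightarrow> (\<lambda>n. g n r) \<longlonglongrightarrow> h r"
      unfolding measurable_on_def by auto
    have B: "B \<ge> 0" using hB[of 0] by auto
    have ae: "AE r in lborel. r \<notin> N"
    proof -
      have "AE r in lebesgue. r \<notin> N"
        using N negligible_iff_null_sets AE_not_in by blast
      then show ?thesis by (simp only: AE_completion_iff)
    qed
    have c: "continuous_on UNIV (\<lambda>r. max (- B) (min B (g n r)))" for n
      by (intro continuous_intros g)
    show ?thesis
    proof (rule cos_chain_limit[OF t, where g = "\<lambda>n r. max (- B) (min B (g n r))" and w = "\<lambda>_. B"])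
      show "cos_chain l c t (\<lambda>r. max (- B) (min B (g n r)))" for n
        by (rule cos_chain_continuous[OF c t])
      show "(\<lambda>r. max (- B) (min B (g n r))) \<in> borel_measurable borel" for n
        by (rule borel_measurable_continuous_onI[OF c])
      show "AE r in lborel. r \<in> {0..t} \<longrightarrow> (\<lambda>n. max (- B) (min B (g n r))) \<longlonglongrightarrow> h r"
        using ae
      proof eventually_elim
        case (elim r)
        have "(\<lambda>n. max (- B) (min B (g n r))) \<longlonglongrightarrow> max (- B) (min B (h r))"
          by (intro tendsto_intros g elim)
        moreover have "max (- B) (min B (h r)) = h r" using hB[of r] by auto
        ultimately show ?case by simp
      qed
      show "set_integrable lborel {0..t} (\<lambda>_. B)"
        by (rule borel_integrable_atLeastAtMost') simp
    qed (use B in auto)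
  qed
  show ?thesis
  proof (rule cos_chain_limit[OF t, where g = "\<lambda>n r. max (- real n) (min (real n) (f r))" and w = "\<lambda>r. \<bar>f r\<bar>"])
    show "cos_chain l c t (\<lambda>r. max (- real n) (min (real n) (f r)))" for n
      by (rule bdd[where B = "real n"]) auto
    show "AE r in lborel. r \<in> {0..t} \<longrightarrow> (\<lambda>n. max (- real n) (min (real n) (f r))) \<longlonglongrightarrow> f r"
    proof (intro AE_I2 impI)
      fix r
      obtain m :: nat where "\<bar>f r\<bar> < real m" using reals_Archimedean2 by blast
      then have "eventually (\<lambda>n. max (- real n) (min (real n) (f r)) = f r) sequentially"
        unfolding eventually_sequentially by (intro exI[of _ m]) auto
      then show "(\<lambda>n. max (- real n) (min (real n) (f r))) \<longlonglongrightarrow> f r"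
        by (rule tendsto_eventually)
    qed
    show "set_integrable lborel {0..t} (\<lambda>r. \<bar>f r\<bar>)"
      using set_integrable_abs[OF fi] .
  qed auto
qed


section \<open>The hull of the constraint set and time slices\<close>

text \<open>A quantity affine along the cone is convex with either sign, so an equation between such
  quantities on a set persists on its hull.\<close>

lemma lambda_affine_convex:
  fixes f :: "state \<Rightarrow> real"
  assumes "\<And>V W t. W \<in> wave_cone \<Longrightarrow> f (V + t *\<^sub>R W) = f V + t * g V W"
  shows "lambda_convex f"
  unfolding lambda_convex_def
proof (intro ballI)
  fix V W :: state assume "W \<in> wave_cone"
  then have "(\<lambda>t. f (V + t *\<^sub>R W)) = (\<lambda>t. f V + t * g V W)"
    using assms by auto
  moreover have "convex_on UNIV (\<lambda>t. p + t * q)" for p q :: real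
    by (rule convex_onI) (auto simp: algebra_simps)
  ultimately show "convex_on UNIV (\<lambda>t. f (V + t *\<^sub>R W))" by simp
qed

text \<open>The determinant of \<open>(b, u)\<close> vanishes on the wave cone, both vectors being orthogonal to
  \<open>\<xi>\<close>; so the defect of \<open>A = b \<otimes> u - u \<otimes> b\<close> is affine along the cone, and it and its negative
  are \<open>\<Lambda>\<close>-convex.\<close>

lemma lambda_hull_constraint_set:
  assumes "(u, b, S, A) \<in> lambda_hull constraint_set"
  shows "A $ 1 $ 2 = b $ 1 * u $ 2 - u $ 1 * b $ 2" "A $ 2 $ 1 = - (A $ 1 $ 2)"
    "A $ 1 $ 1 = 0" "A $ 2 $ 2 = 0"
proof -
  define f :: "state \<Rightarrow> real" where
    "f = (\<lambda>(u, b, S, A). A $ 1 $ 2 - (b $ 1 * u $ 2 - u $ 1 * b $ 2))"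
  define g :: "state \<Rightarrow> state \<Rightarrow> real" where
    "g = (\<lambda>(u, b, S, A) (u', b', S', A').
       A' $ 1 $ 2 - (b $ 1 * u' $ 2 + b' $ 1 * u $ 2 - u $ 1 * b' $ 2 - u' $ 1 * b $ 2))"
  have aff: "f (V + t *\<^sub>R W) = f V + t * g V W" if W: "W \<in> wave_cone" for V W t
  proof -
    obtain u b S A where V: "V = (u, b, S, A)" by (cases V)
    obtain u' b' S' A' where W': "W = (u', b', S', A')" by (cases W)
    obtain \<xi> :: "real^2" where \<xi>: "\<xi> \<noteq> 0" "u' \<bullet> \<xi> = 0" "b' \<bullet> \<xi> = 0"
      using W unfolding W' wave_cone_def by auto
    have e: "u' $ 1 * \<xi> $ 1 + u' $ 2 * \<xi> $ 2 = 0" "b' $ 1 * \<xi> $ 1 + b' $ 2 * \<xi> $ 2 = 0"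
      using \<xi> by (simp_all add: inner_vec_def sum_2)
    have "\<xi> $ 1 * (b' $ 1 * u' $ 2 - u' $ 1 * b' $ 2) = 0" "\<xi> $ 2 * (b' $ 1 * u' $ 2 - u' $ 1 * b' $ 2) = 0"
      using e by algebra+
    moreover have "\<xi> $ 1 \<noteq> 0 \<or> \<xi> $ 2 \<noteq> 0"
      using \<xi>(1) by (auto simp: vec_eq_iff forall_2)
    ultimately have "b' $ 1 * u' $ 2 - u' $ 1 * b' $ 2 = 0" by auto
    moreover have "f (V + t *\<^sub>R W) = f V + t * g V W - t\<^sup>2 * (b' $ 1 * u' $ 2 - u' $ 1 * b' $ 2)"
      unfolding V W' f_def g_def by (simp add: algebra_simps power2_eq_square)
    ultimately show ?thesis by simp
  qed
  have z: "f V = 0" if "V \<in> constraint_set" for V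
    using that unfolding constraint_set_def f_def by (auto simp: tensor_def)
  have "lambda_convex f" by (rule lambda_affine_convex[where g = g]) (rule aff)
  moreover have "lambda_convex (\<lambda>V. - f V)"
  proof (rule lambda_affine_convex[where g = "\<lambda>V W. - g V W"])
    show "- f (V + t *\<^sub>R W) = - f V + t * - g V W" if "W \<in> wave_cone" for V W t
      unfolding aff[OF that, of V t] by simp
  qed
  ultimately have "f (u, b, S, A) \<le> 0 \<and> - f (u, b, S, A) \<le> 0"
  proof -
    assume c: "lambda_convex f" "lambda_convex (\<lambda>V. - f V)"
    have "g (u, b, S, A) \<le> 0" if "lambda_convex g" "\<forall>V\<in>constraint_set. g V \<le> 0" for g
      using assms that unfolding lambda_hull_def by blast
    from this[OF c(1)] this[OF c(2)] show ?thesis using z by simp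
  qed
  then show "A $ 1 $ 2 = b $ 1 * u $ 2 - u $ 1 * b $ 2"
    unfolding f_def by simp
  \<comment> \<open>The other entries need no convexity: the hull lies in \<open>state_space\<close>
    by definition, so \<open>A\<close> is antisymmetric.\<close>
  have "transpose A = - A"
    using assms unfolding lambda_hull_def state_space_def antisym_mat_def by auto
  then have tr: "transpose A $ i $ j = - (A $ i $ j)" for i j
    by simp
  have "A $ j $ i = - (A $ i $ j)" for i j
    using tr[of i j] by (simp only: transpose_def vec_lambda_beta)
  from this[of 1 1] this[of 2 2] this[of 2 1]
  show "A $ 1 $ 1 = 0" "A $ 2 $ 2 = 0" "A $ 2 $ 1 = - (A $ 1 $ 2)" by linarith+
qed

section \<open>Averaging kernels in time and separated test functions\<close>

lemma smooth_step_scaled_derivative: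
  assumes "smooth_step H h"
  shows "((\<lambda>r. H (c * (r - s))) has_real_derivative c * h (c * (r - s))) (at r)"
proof -
  have H: "(H has_real_derivative h (c * (r - s))) (at (c * (r - s)))"
    using assms by (simp add: smooth_step_def)
  have "((\<lambda>r. c * (r - s)) has_real_derivative c) (at r)"
    by (auto intro!: derivative_eq_intros)
  from DERIV_chain2[where f = H and g = "\<lambda>r. c * (r - s)", OF H this]
  show ?thesis by (simp add: mult.commute)
qed

lemma smooth_scaled:
  fixes f :: "real \<Rightarrow> real"
  assumes "smooth f"
  shows "smooth (\<lambda>r. f (c * (r - s)))"
  by (rule smooth_comp_affine[OF _ assms]) (auto intro!: derivative_eq_intros)

text \<open>The rescaled \<open>h\<close> is an approximate identity supported in the interval of
  length \<open>1 / real (Suc n)\<close> to the right of \<open>s\<close>. This one-sidedness admits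
  \<open>s = 0\<close>, where only values of \<open>m\<close> at later times are available.\<close>

lemma kernel_limit:
  fixes m :: "real \<Rightarrow> real"
  assumes H: "smooth_step H h" and m: "continuous_on {0..<T} m" and s: "0 \<le> s" "s < T"
  shows "(\<lambda>n. LINT r|lebesgue_on {0<..<T}. real (Suc n) * h (real (Suc n) * (r - s)) * m r) \<longlonglongrightarrow> m s"
proof (rule LIMSEQ_I)
  fix e :: real assume "e > 0"
  then obtain d where d: "d > 0" "\<And>r. r \<in> {0..<T} \<Longrightarrow> \<bar>r - s\<bar> < d \<Longrightarrow> \<bar>m r - m s\<bar> < e/2"
    using m[unfolded continuous_on_iff, rule_format, of s "e/2"] s by (auto simp: dist_real_def)
  obtain N where N: "1 / real (Suc N) < min d (T - s)"
    using d s nat_approx_posE[of "min d (T - s)"] by auto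
  show "\<exists>N. \<forall>n\<ge>N. norm ((LINT r|lebesgue_on {0<..<T}. real (Suc n) * h (real (Suc n) * (r - s)) * m r) - m s) < e"
  proof (intro exI[of _ N] allI impI)
    fix n assume n: "N \<le> n"
    define c where "c = real (Suc n)"
    define k where "k r = c * h (c * (r - s))" for r
    have c: "c > 0" "1 / c < d" "s + 1 / c < T"
    proof -
      have "1 / c \<le> 1 / real (Suc N)" unfolding c_def using n by (simp add: frac_le)
      then show "1 / c < d" "s + 1 / c < T" using N by auto
    qed (simp add: c_def)
    have k0: "k r = 0" if "r \<notin> {s<..<s + 1/c}" for r
    proof -
      have "c * (r - s) \<notin> {0<..<1}"
      proof
        assume "c * (r - s) \<in> {0<..<1}"
        then have "0 < c * (r - s)" "c * (r - s) < 1" by auto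
        then have "s < r" "r < s + 1/c" using c(1) by (auto simp: zero_less_mult_iff field_simps)
        with that show False by simp
      qed
      then show ?thesis using H by (simp add: k_def smooth_step_def)
    qed
    have knn: "k r \<ge> 0" for r using H c by (simp add: k_def smooth_step_def)
    have ck: "continuous_on A k" for A
    proof -
      have "smooth h" using H by (simp add: smooth_step_def)
      then have "smooth (\<lambda>r. h (c * (r - s)))" by (rule smooth_scaled)
      then show ?thesis unfolding k_def by (intro continuous_intros smooth_continuous)
    qed
    let ?I = "{s..s + 1/c}"
    have I: "?I \<subseteq> {0..<T}" using s c by auto
    have ckm: "continuous_on ?I (\<lambda>r. k r * (m r - a))" for a
      using continuous_on_subset[OF m I] by (intro continuous_intros ck)
    have int: "integrable lborel (\<lambda>r. indicator ?I r *\<^sub>R (k r * (m r - a)))" for a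
      by (intro borel_integrable_compact compact_Icc ckm)
    have "integrable lborel (\<lambda>r. indicator ?I r *\<^sub>R k r)"
      by (intro borel_integrable_compact compact_Icc ck)
    \<comment> \<open>The mass is the total increase of \<open>H\<close> from 0 to 1.\<close>
    have k1: "(LINT r|lborel. indicator ?I r *\<^sub>R k r) = 1"
    proof -
      have "(LINT r|lborel. indicator ?I r *\<^sub>R k r) = H (c * (s + 1/c - s)) - H (c * (s - s))"
        unfolding k_def
        by (rule integral_FTC_Icc)
           (use c smooth_step_scaled_derivative[OF H, of c s] ck in
            \<open>auto simp: has_real_derivative_iff_has_vector_derivative k_def[symmetric] intro: has_vector_derivative_at_within\<close>)
      also have "\<dots> = 1" using H c by (simp add: smooth_step_def)
      finally show ?thesis .
    qed
    have "(LINT r|lebesgue_on {0<..<T}. k r * m r) = (LINT r|lborel. indicator ?I r *\<^sub>R (k r * (m r - 0)))"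
    proof (rule lebesgue_on_via_lborel(3))
      show "(\<lambda>r. indicator ?I r *\<^sub>R (k r * (m r - 0))) \<in> borel_measurable borel"
        using borel_measurable_integrable[OF int[of 0]] by simp
      show "AE r in lborel. indicator ?I r *\<^sub>R (k r * (m r - 0)) = indicator {0<..<T} r * (k r * m r)"
      proof (rule AE_I2)
        fix r
        show "indicator ?I r *\<^sub>R (k r * (m r - 0)) = indicator {0<..<T} r * (k r * m r)"
          using k0[of r] s c by (cases "r \<in> {s<..<s + 1/c}") auto
      qed
    qed simp
    also have "\<dots> = (LINT r|lborel. indicator ?I r *\<^sub>R (k r * (m r - m s)) + m s * (indicator ?I r *\<^sub>R k r))"
      by (intro Bochner_Integration.integral_cong) (auto simp: algebra_simps)
    also have "\<dots> = (LINT r|lborel. indicator ?I r *\<^sub>R (k r * (m r - m s))) + m s"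
      using int k1 \<open>integrable lborel (\<lambda>r. indicator ?I r *\<^sub>R k r)\<close>
      by (subst Bochner_Integration.integral_add) auto
    finally have eq: "(LINT r|lebesgue_on {0<..<T}. k r * m r) - m s = (LINT r|lborel. indicator ?I r *\<^sub>R (k r * (m r - m s)))"
      by simp
    have "\<bar>LINT r|lborel. indicator ?I r *\<^sub>R (k r * (m r - m s))\<bar> \<le> (LINT r|lborel. \<bar>indicator ?I r *\<^sub>R (k r * (m r - m s))\<bar>)"
      by (rule integral_abs_bound)
    also have "\<dots> \<le> (LINT r|lborel. e/2 * (indicator ?I r *\<^sub>R k r))"
    proof (rule integral_mono)
      show "\<bar>indicator ?I r *\<^sub>R (k r * (m r - m s))\<bar> \<le> e/2 * (indicator ?I r *\<^sub>R k r)" for r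
      proof (cases "r \<in> ?I")
        case True
        then have "\<bar>r - s\<bar> < d" using c(2) by auto
        then have "\<bar>m r - m s\<bar> \<le> e/2" using True d(2)[of r] I by (force intro: less_imp_le)
        then have "k r * \<bar>m r - m s\<bar> \<le> k r * (e/2)" using knn[of r] by (rule mult_left_mono)
        then show ?thesis using True knn[of r] by (simp add: abs_mult mult.commute)
      qed simp
    qed (use int \<open>integrable lborel (\<lambda>r. indicator ?I r *\<^sub>R k r)\<close> in auto)
    also have "\<dots> = e/2" using k1 by simp
    finally have "\<bar>(LINT r|lebesgue_on {0<..<T}. k r * m r) - m s\<bar> \<le> e/2" using eq by simp
    then show "norm ((LINT r|lebesgue_on {0<..<T}. real (Suc n) * h (real (Suc n) * (r - s)) * m r) - m s) < e"
      using \<open>e > 0\<close> by (simp add: k_def c_def)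
  qed
qed

text \<open>Test functions that separate time, space and direction suffice: they isolate one spatial
  moment at a time. Scalar test functions are the case \<open>v = 1\<close>.\<close>

lemma separated_has_derivative:
  fixes \<psi> :: "real^2 \<Rightarrow> real" and v :: "'b::euclidean_space"
  assumes "(\<eta> has_real_derivative e) (at t)" "smooth \<psi>"
  shows "((\<lambda>z. (\<eta> (snd z) * \<psi> (fst z)) *\<^sub>R v) has_derivative
    (\<lambda>w. (\<eta> t * frechet_derivative \<psi> (at x) (fst w) + e * snd w * \<psi> x) *\<^sub>R v)) (at (x, t))"
proof -
  have "((\<lambda>z. \<eta> (snd z)) has_derivative (\<lambda>w. e * snd w)) (at (x, t))"
    using diff_chain_at[of snd snd "(x, t)" \<eta> "\<lambda>w. e * w"] assms(1)
    by (simp add: has_field_derivative_def o_def bounded_linear_imp_has_derivative bounded_linear_snd)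
  moreover have "((\<lambda>z. \<psi> (fst z)) has_derivative (\<lambda>w. frechet_derivative \<psi> (at x) (fst w))) (at (x, t))"
    using diff_chain_at[of fst fst "(x, t)" \<psi> "frechet_derivative \<psi> (at x)"] smooth_has_derivative[OF assms(2)]
    by (simp add: o_def bounded_linear_imp_has_derivative bounded_linear_fst)
  ultimately have "((\<lambda>z. \<eta> (snd z) * \<psi> (fst z)) has_derivative
      (\<lambda>w. \<eta> t * frechet_derivative \<psi> (at x) (fst w) + e * snd w * \<psi> x)) (at (x, t))"
    using has_derivative_mult[of "\<lambda>z. \<eta> (snd z)" "\<lambda>w. e * snd w" "(x, t)" UNIV "\<lambda>z. \<psi> (fst z)"] by simp
  then show ?thesis by (rule has_derivative_scaleR_left)
qed

lemma separated_dx: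
  assumes "(\<eta> has_real_derivative e) (at t)" "smooth \<psi>"
  shows "dx j (\<lambda>z. (\<eta> (snd z) * \<psi> (fst z)) *\<^sub>R v) (x, t) = (\<eta> t * grad \<psi> x $ j) *\<^sub>R v"
  by (simp add: dx_def frechet_derivative_at[OF separated_has_derivative[OF assms], symmetric] grad_def)

lemma separated_dt:
  assumes "(\<eta> has_real_derivative e) (at t)" "smooth \<psi>"
  shows "dt (\<lambda>z. (\<eta> (snd z) * \<psi> (fst z)) *\<^sub>R v) (x, t) = (e * \<psi> x) *\<^sub>R v"
proof -
  have "frechet_derivative \<psi> (at x) 0 = 0"
    using has_derivative_linear[OF smooth_has_derivative[OF assms(2)]] by (rule linear_0)
  then show ?thesis
    by (simp add: dt_def frechet_derivative_at[OF separated_has_derivative[OF assms], symmetric])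
qed

lemma smooth_separated:
  fixes \<eta> :: "real \<Rightarrow> real" and \<psi> :: "real^2 \<Rightarrow> real" and v :: "'b::euclidean_space"
  assumes "smooth \<eta>" "smooth \<psi>"
  shows "smooth (\<lambda>z. (\<eta> (snd z) * \<psi> (fst z)) *\<^sub>R v)"
proof -
  have "smooth (\<lambda>z::(real^2)\<times>real. \<eta> (snd z))"
    by (rule smooth_comp_affine[OF bounded_linear_imp_has_derivative[OF bounded_linear_snd] assms(1)])
  moreover have "smooth (\<lambda>z::(real^2)\<times>real. \<psi> (fst z))"
    by (rule smooth_comp_affine[OF bounded_linear_imp_has_derivative[OF bounded_linear_fst] assms(2)])
  ultimately show ?thesis
    by (intro smooth_linear_comp[OF bounded_linear_scaleR_left] smooth_mult)
qed

section \<open>Weakly continuous fields on the space-time cylinder\<close>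

lemma Cw_L2_slice: "v \<in> Cw_L2 T \<Longrightarrow> t \<in> {0..<T} \<Longrightarrow> (\<lambda>x. v x t) \<in> L2"
  by (simp add: Cw_L2_def)

lemma Cw_L2_continuous:
  assumes "v \<in> Cw_L2 T" "w \<in> L2"
  shows "continuous_on {0..<T} (\<lambda>t. LINT x|lebesgue_on torus. v x t \<bullet> w x)"
  unfolding continuous_on_sequentially using assms
  by (auto simp: Cw_L2_def l2_inner_def o_def)

lemma AE_lebesgue_on_subset:
  assumes "AE x in lebesgue_on A. P x" "B \<subseteq> A" "A \<in> sets lebesgue" "B \<in> sets lebesgue"
  shows "AE x in lebesgue_on B. P x"
  using assms by (auto simp: AE_restrict_space_iff elim!: eventually_mono)

lemma Cw_L2_bound:
  assumes "v \<in> Cw_L2 T"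
  obtains C where "C \<ge> 0" "AE t in lebesgue_on {0<..<T}. (\<lambda>x. v x t) \<in> L2 \<and>
    (LINT x|lebesgue_on torus. (norm (v x t))\<^sup>2) \<le> C"
proof -
  obtain C where "AE t in lebesgue_on {0..<T}. l2_norm (\<lambda>x. v x t) \<le> C"
    using assms by (auto simp: Cw_L2_def)
  then have "AE t in lebesgue_on {0<..<T}. l2_norm (\<lambda>x. v x t) \<le> C"
    by (rule AE_lebesgue_on_subset) auto
  moreover have "AE t in lebesgue_on {0<..<T}. (\<lambda>x. v x t) \<in> L2"
    using Cw_L2_slice[OF assms] by (intro AE_I2) auto
  ultimately have "AE t in lebesgue_on {0<..<T}. (\<lambda>x. v x t) \<in> L2 \<and>
    (LINT x|lebesgue_on torus. (norm (v x t))\<^sup>2) \<le> C\<^sup>2"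
  proof eventually_elim
    case (elim t)
    have "0 \<le> (LINT x|lebesgue_on torus. (norm (v x t))\<^sup>2)" by simp
    then show ?case
      using elim by (simp add: l2_norm_def l2_inner_def power2_norm_eq_inner sqrt_le_D)
  qed
  then show thesis using that[of "C\<^sup>2"] by simp
qed

lemma Cw_L2_measurable:
  assumes "v \<in> Cw_L2 T"
  shows "(\<lambda>z. v (fst z) (snd z)) \<in> borel_measurable (lebesgue_on (torus \<times> {0<..<T}))"
proof (rule measurable_restrict_mono)
  show "(\<lambda>z. v (fst z) (snd z)) \<in> borel_measurable (lebesgue_on (torus \<times> {0..<T}))"
    using assms by (simp add: Cw_L2_def split_beta')
qed auto

lemma continuous_imp_measurable_cylinder:
  fixes f :: "(real^2) \<times> real \<Rightarrow> 'b::euclidean_space"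
  assumes "continuous_on UNIV f"
  shows "f \<in> borel_measurable (lebesgue_on (torus \<times> {0<..<T}))"
  by (rule continuous_imp_measurable_on_sets_lebesgue[OF continuous_on_subset[OF assms]])
     (auto intro: lebesgue_on_Times_sets)

text \<open>The bound on the spatial L2 norms, uniform in time, controls the L1 norms of the slices.
  This covers both the product of two fields, with \<open>c = 0\<close>, and the pairing with a test
  function, whose square goes into \<open>c\<close>.\<close>

lemma Cw_L2_pairing_integrable:
  fixes v w :: "real^2 \<Rightarrow> real \<Rightarrow> real^2"
  assumes v: "v \<in> Cw_L2 T" and w: "w \<in> Cw_L2 T"
    and f: "f \<in> borel_measurable (lebesgue_on (torus \<times> {0<..<T}))"
    and bound: "\<And>x t. \<bar>f (x, t)\<bar> \<le> (norm (v x t))\<^sup>2 + (norm (w x t))\<^sup>2 + c"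
    and slice: "\<And>t. t \<in> {0<..<T} \<Longrightarrow> (\<lambda>x. f (x, t)) \<in> borel_measurable (lebesgue_on torus)"
  shows "integrable (lebesgue_on (torus \<times> {0<..<T})) f"
proof -
  obtain C where C: "AE t in lebesgue_on {0<..<T}. (\<lambda>x. v x t) \<in> L2 \<and>
    (LINT x|lebesgue_on torus. (norm (v x t))\<^sup>2) \<le> C" using Cw_L2_bound[OF v] by blast
  obtain D where D: "AE t in lebesgue_on {0<..<T}. (\<lambda>x. w x t) \<in> L2 \<and>
    (LINT x|lebesgue_on torus. (norm (w x t))\<^sup>2) \<le> D" using Cw_L2_bound[OF w] by blast
  have sl: "AE t in lebesgue_on {0<..<T}. (\<lambda>x. f (x, t)) \<in> borel_measurable (lebesgue_on torus)"
    using slice by (intro AE_I2) auto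
  show ?thesis
  proof (rule tonelli_lebesgue_on[OF _ _ _ f])
    show "AE t in lebesgue_on {0<..<T}. integrable (lebesgue_on torus) (\<lambda>x. f (x, t)) \<and>
       (LINT x|lebesgue_on torus. \<bar>f (x, t)\<bar>) \<le> C + D + (LINT x|lebesgue_on torus. c)"
      using C D sl
    proof eventually_elim
      case (elim t)
      have i: "integrable (lebesgue_on torus) (\<lambda>x. (norm (v x t))\<^sup>2 + (norm (w x t))\<^sup>2 + c)"
        using elim by (simp add: L2_integrable_norm2)
      have f: "integrable (lebesgue_on torus) (\<lambda>x. f (x, t))"
        using elim bound[of _ t] by (intro Bochner_Integration.integrable_bound[OF i]) (auto intro!: AE_I2 order_trans[OF bound])
      have "(LINT x|lebesgue_on torus. \<bar>f (x, t)\<bar>) \<le> (LINT x|lebesgue_on torus. (norm (v x t))\<^sup>2 + (norm (w x t))\<^sup>2 + c)"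
        using f i bound by (intro integral_mono) auto
      also have "\<dots> = (LINT x|lebesgue_on torus. (norm (v x t))\<^sup>2) + (LINT x|lebesgue_on torus. (norm (w x t))\<^sup>2) + (LINT x|lebesgue_on torus. c)"
        using elim by (simp add: L2_integrable_norm2)
      finally show ?case using f elim by auto
    qed
  next
    have "emeasure lborel {0<..<T} \<le> emeasure lborel {0..T}" by (intro emeasure_mono) auto
    also have "\<dots> < \<infinity>" by (simp add: emeasure_lborel_Icc_eq)
    finally show "emeasure lborel {0<..<T} < \<infinity>" .
  qed auto
qed

lemma Cw_L2_test_integrable:
  fixes v :: "real^2 \<Rightarrow> real \<Rightarrow> real^2"
  assumes v: "v \<in> Cw_L2 T" and e: "continuous_on UNIV e" and p: "continuous_on UNIV p"
    and eb: "\<And>r. \<bar>e r\<bar> \<le> E" and pb: "\<And>x. norm (p x) \<le> P"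
  shows "integrable (lebesgue_on (torus \<times> {0<..<T})) (\<lambda>z. e (snd z) * (v (fst z) (snd z) \<bullet> p (fst z)))"
\<comment> \<open>The constant comes from
  \<open>2 |v| (E * P) \<le> |v|^2 + (E * P)^2\<close>.\<close>
proof (rule Cw_L2_pairing_integrable[OF v v, where c = "(E * P)\<^sup>2"])
  have [measurable]: "(\<lambda>z. v (fst z) (snd z)) \<in> borel_measurable (lebesgue_on (torus \<times> {0<..<T}))"
    by (rule Cw_L2_measurable[OF v])
  have [measurable]: "(\<lambda>z. e (snd z)) \<in> borel_measurable (lebesgue_on (torus \<times> {0<..<T}))"
    "(\<lambda>z. p (fst z)) \<in> borel_measurable (lebesgue_on (torus \<times> {0<..<T}))"
    by (intro continuous_imp_measurable_cylinder continuous_on_compose2[OF e] continuous_on_compose2[OF p] continuous_intros; simp)+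
  show "(\<lambda>z. e (snd z) * (v (fst z) (snd z) \<bullet> p (fst z))) \<in> borel_measurable (lebesgue_on (torus \<times> {0<..<T}))"
    by measurable
  show "\<bar>e (snd (x, t)) * (v (fst (x, t)) (snd (x, t)) \<bullet> p (fst (x, t)))\<bar> \<le> (norm (v x t))\<^sup>2 + (norm (v x t))\<^sup>2 + (E * P)\<^sup>2" for x t
  proof -
    have E: "E \<ge> 0" using eb[of 0] by auto
    have "\<bar>e t\<bar> * \<bar>v x t \<bullet> p x\<bar> \<le> E * (norm (v x t) * P)"
      using E by (intro mult_mono eb order_trans[OF Cauchy_Schwarz_ineq2] mult_left_mono pb) auto
    also have "\<dots> = norm (v x t) * (E * P)" by simp
    also have "\<dots> \<le> (norm (v x t))\<^sup>2 + (norm (v x t))\<^sup>2 + (E * P)\<^sup>2"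
    proof -
      have "2 * norm (v x t) * (E * P) \<le> (norm (v x t))\<^sup>2 + (E * P)\<^sup>2" by (rule sum_squares_bound)
      moreover have "0 \<le> (norm (v x t))\<^sup>2" "0 \<le> (E * P)\<^sup>2" by simp_all
      ultimately show ?thesis by linarith
    qed
    finally show ?thesis by (simp add: abs_mult)
  qed
  show "(\<lambda>x. e (snd (x, t)) * (v (fst (x, t)) (snd (x, t)) \<bullet> p (fst (x, t)))) \<in> borel_measurable (lebesgue_on torus)"
    if "t \<in> {0<..<T}" for t
  proof -
    have [measurable]: "(\<lambda>x. v x t) \<in> borel_measurable (lebesgue_on torus)" "p \<in> borel_measurable (lebesgue_on torus)"
      using Cw_L2_slice[OF v, of t] that L2_measurable continuous_imp_measurable_torus[OF continuous_on_subset[OF p]] by auto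
    show ?thesis by simp
  qed
qed

text \<open>Subtracting the integer parts of the coordinates moves any point into the compact
  square.\<close>

lemma continuous_periodic_bounded:
  fixes f :: "real^2 \<Rightarrow> 'b::real_normed_vector"
  assumes f: "continuous_on UNIV f" "periodic f"
  obtains B where "\<And>x. norm (f x) \<le> B"
proof -
  have shift_nat: "f (x + real n *\<^sub>R axis i 1) = f x" for x n i
  proof (induction n)
    case (Suc n)
    have "f (x + real (Suc n) *\<^sub>R axis i 1) = f ((x + real n *\<^sub>R axis i 1) + axis i 1)"
      by (simp add: algebra_simps)
    also have "\<dots> = f x" using f(2) Suc unfolding periodic_def by metis
    finally show ?case .
  qed simp
  have shift: "f (x + real_of_int n *\<^sub>R axis i 1) = f x" for x n i
  proof (cases "n \<ge> 0")
    case True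
    then show ?thesis using shift_nat[of x "nat n" i] by simp
  next
    case False
    then show ?thesis using shift_nat[of "x + real_of_int n *\<^sub>R axis i 1" "nat (- n)" i] by (simp add: algebra_simps)
  qed
  obtain B where B: "\<And>x. x \<in> torus \<Longrightarrow> norm (f x) \<le> B"
    using compact_imp_bounded[OF compact_continuous_image[OF continuous_on_subset[OF f(1)] compact_torus]]
    by (auto simp: bounded_iff)
  show thesis
  proof (rule that)
    fix x :: "real^2"
    define y where "y = x + real_of_int (- \<lfloor>x $ 1\<rfloor>) *\<^sub>R axis 1 1 + real_of_int (- \<lfloor>x $ 2\<rfloor>) *\<^sub>R axis 2 1"
    have "y $ 1 = frac (x $ 1)" "y $ 2 = frac (x $ 2)"
      by (simp_all add: y_def axis_def frac_def)
    then have "y \<in> torus"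
      by (simp add: torus_def mem_box_cart forall_2 frac_lt_1 less_imp_le)
    moreover have "f y = f x" unfolding y_def shift ..
    ultimately show "norm (f x) \<le> B" using B by metis
  qed
qed

text \<open>The space-time condition by itself sees only almost every time. Concentrating the time
  factor of the test function just after \<open>t\<close> and using weak continuity of the moment
  \<open>m\<close> yields the condition at \<open>t\<close> itself.\<close>

lemma div_free_slice:
  fixes u :: "real^2 \<Rightarrow> real \<Rightarrow> real^2"
  assumes u: "u \<in> Cw_L2 T" and div: "div_free_time T u" and t: "t \<in> {0<..<T}"
  shows "div_free (\<lambda>x. u x t)"
  unfolding div_free_def
proof
  fix \<psi> :: "real^2 \<Rightarrow> real" assume \<psi>: "\<psi> \<in> torus_test"
  then have s\<psi>: "smooth \<psi>" and p\<psi>: "periodic \<psi>" by (auto simp: torus_test_def)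
  have cg: "continuous_on A (grad \<psi>)" for A
    unfolding grad_def by (intro continuous_on_vec_lambda smooth_continuous smooth_frechet s\<psi>)
  have pg: "periodic (grad \<psi>)"
    unfolding periodic_def
  proof (intro allI)
    fix x and i :: 2
    have "((\<lambda>y. \<psi> (y + axis i 1)) has_derivative frechet_derivative \<psi> (at (x + axis i 1))) (at x)"
    proof -
      have "((\<lambda>y. y + axis i 1) has_derivative (\<lambda>v. v)) (at x)"
        by (auto intro!: derivative_eq_intros)
      from diff_chain_at[OF this smooth_has_derivative[OF s\<psi>]] show ?thesis by (simp add: o_def)
    qed
    moreover have "(\<lambda>y. \<psi> (y + axis i 1)) = \<psi>" using p\<psi> by (simp add: periodic_def)
    ultimately have "frechet_derivative \<psi> (at (x + axis i 1)) = frechet_derivative \<psi> (at x)"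
      by (metis frechet_derivative_at)
    then show "grad \<psi> (x + axis i 1) = grad \<psi> x" by (simp add: grad_def)
  qed
  obtain P where P: "\<And>x. norm (grad \<psi> x) \<le> P" using continuous_periodic_bounded[OF cg pg] by blast
  define m where "m t = (LINT x|lebesgue_on torus. u x t \<bullet> grad \<psi> x)" for t
  have cm: "continuous_on {0..<T} m"
    unfolding m_def by (rule Cw_L2_continuous[OF u continuous_imp_L2[OF cg]])
  obtain H h where Hh: "smooth_step H h" using smooth_step_exists by blast
  have sh: "smooth h" and hz: "\<And>x. x \<notin> {0<..<1} \<Longrightarrow> h x = 0"
    using Hh by (auto simp: smooth_step_def)
  have zero: "(LINT r|lebesgue_on {0<..<T}. real (Suc n) * h (real (Suc n) * (r - t)) * m r) = 0"
    if n: "1 / real (Suc n) < T - t" for n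
  proof -
    define c where "c = real (Suc n)"
    have c: "c > 0" "t + 1 / c < T" using n by (auto simp: c_def)
    define e where "e r = c * h (c * (r - t))" for r
    have se: "smooth e" unfolding e_def by (intro smooth_mult smooth_const smooth_scaled sh)
    have e0: "e r = 0" if "r \<le> t \<or> t + 1/c \<le> r" for r
    proof -
      have "c * (r - t) \<notin> {0<..<1}"
      proof
        assume "c * (r - t) \<in> {0<..<1}"
        then have "0 < c * (r - t)" "c * (r - t) < 1" by auto
        then have "t < r" "r < t + 1/c" using c(1) by (auto simp: zero_less_mult_iff field_simps)
        with that show False by simp
      qed
      then show ?thesis using hz by (simp add: e_def)
    qed
    have de: "\<exists>e'. (e has_real_derivative e') (at r)" for r
      using smooth_has_derivative[OF se, of r] has_derivative_imp_has_field_derivative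
      by (metis differentiable_def real_differentiable_def)
    define \<phi> where "\<phi> = (\<lambda>z. (e (snd z) * \<psi> (fst z)) *\<^sub>R (1::real))"
    have "\<phi> \<in> test_open T"
      unfolding test_open_def
    proof (intro CollectI conjI)
      show "smooth \<phi>" unfolding \<phi>_def by (rule smooth_separated[OF se s\<psi>])
      show "\<forall>t. periodic (\<lambda>x. \<phi> (x, t))" using p\<psi> by (simp add: \<phi>_def periodic_def)
      show "\<exists>a>0. \<exists>T'<T. \<forall>x t. t \<le> a \<or> T' \<le> t \<longrightarrow> \<phi> (x, t) = 0"
        \<comment> \<open>The time factor lives between \<open>t\<close> and \<open>t + 1/c\<close>,
          both strictly inside the time interval because \<open>t > 0\<close> and \<open>n\<close>
          is large.\<close>
        using t c e0 by (intro exI[of _ t] conjI exI[of _ "t + 1/c"]) (auto simp: \<phi>_def)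
    qed
    then have "(LINT (x, r)|lebesgue_on (torus \<times> {0<..<T}). u x r \<bullet> (\<chi> j. dx j \<phi> (x, r))) = 0"
      using div by (simp add: div_free_time_def)
    moreover have "(\<chi> j. dx j \<phi> (x, r)) = e r *\<^sub>R grad \<psi> x" for x r
    proof -
      obtain e' where "(e has_real_derivative e') (at r)" using de by blast
      from separated_dx[OF this s\<psi>, of _ "1::real" x] show ?thesis
        by (simp add: \<phi>_def vec_eq_iff)
    qed
    ultimately have 0: "(LINT z|lebesgue_on (torus \<times> {0<..<T}). e (snd z) * (u (fst z) (snd z) \<bullet> grad \<psi> (fst z))) = 0"
      by (simp add: split_beta')
    have "\<exists>E. \<forall>r. \<bar>e r\<bar> \<le> E"
    proof -
      obtain B where B: "\<forall>r\<in>{t..t + 1/c}. \<bar>e r\<bar> \<le> B"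
        using compact_imp_bounded[OF compact_continuous_image[OF smooth_continuous[OF se] compact_Icc[of t "t + 1/c"]]]
        by (auto simp: bounded_iff)
      have "\<bar>e r\<bar> \<le> \<bar>B\<bar>" for r
        using B[rule_format, of r] e0[of r] by (cases "r \<in> {t..t + 1/c}") auto
      then show ?thesis by blast
    qed
    then obtain E where E: "\<And>r. \<bar>e r\<bar> \<le> E" by blast
    have int: "integrable (lebesgue_on (torus \<times> {0<..<T})) (\<lambda>z. e (snd z) * (u (fst z) (snd z) \<bullet> grad \<psi> (fst z)))"
      by (rule Cw_L2_test_integrable[OF u smooth_continuous[OF se] cg E P])
    have "0 = (LINT r|lebesgue_on {0<..<T}. LINT x|lebesgue_on torus. e r * (u x r \<bullet> grad \<psi> x))"
      using fubini_lebesgue_on(2)[OF _ _ int] 0 by simp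
    then show ?thesis by (simp add: e_def c_def m_def)
  qed
  obtain N where N: "1 / real (Suc N) < T - t"
    using t nat_approx_posE[of "T - t"] by auto
  have "eventually (\<lambda>n. (LINT r|lebesgue_on {0<..<T}. real (Suc n) * h (real (Suc n) * (r - t)) * m r) = 0) sequentially"
    unfolding eventually_sequentially
  proof (intro exI[of _ N] allI impI)
    fix n assume "N \<le> n"
    then have "1 / real (Suc n) \<le> 1 / real (Suc N)" by (simp add: frac_le)
    then show "(LINT r|lebesgue_on {0<..<T}. real (Suc n) * h (real (Suc n) * (r - t)) * m r) = 0"
      using N by (intro zero) linarith
  qed
  then have "(\<lambda>n. LINT r|lebesgue_on {0<..<T}. real (Suc n) * h (real (Suc n) * (r - t)) * m r) \<longlonglongrightarrow> 0"
    by (rule tendsto_eventually)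
  moreover have "(\<lambda>n. LINT r|lebesgue_on {0<..<T}. real (Suc n) * h (real (Suc n) * (r - t)) * m r) \<longlonglongrightarrow> m t"
    using t by (intro kernel_limit[OF Hh cm]) auto
  ultimately have "m t = 0" using LIMSEQ_unique by blast
  then show "(LINT x|lebesgue_on torus. u x t \<bullet> grad \<psi> x) = 0" by (simp add: m_def)
qed


section \<open>Evolution of the stream function\<close>

text \<open>The quarter turn that inverts the relation between a stream function and its field: if
  \<open>b\<close> is the field of \<Psi>, then \<open>rot90 b\<close> is the gradient of
  \<Psi>.\<close>

definition rot90 :: "real^2 \<Rightarrow> real^2" where
  "rot90 y = (\<chi> i. if i = 1 then - (y $ 2) else y $ 1)"

lemma rot90_nth [simp]: "rot90 y $ 1 = - (y $ 2)" "rot90 y $ 2 = y $ 1"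
  by (simp_all add: rot90_def)

lemma smooth_step_kernel_bounded:
  assumes "smooth_step H h"
  obtains B where "\<And>x. \<bar>h x\<bar> \<le> B"
proof -
  have sh: "smooth h" and hz: "\<And>x. x \<notin> {0<..<1} \<Longrightarrow> h x = 0"
    using assms by (auto simp: smooth_step_def)
  obtain B where B: "\<forall>x\<in>{0..1}. \<bar>h x\<bar> \<le> B"
    using compact_imp_bounded[OF compact_continuous_image[OF smooth_continuous[OF sh] compact_Icc[of 0 1]]]
    by (auto simp: bounded_iff)
  have "\<bar>h x\<bar> \<le> \<bar>B\<bar>" for x
    using B[rule_format, of x] hz[of x] by (cases "x \<in> {0..1}") auto
  with that show thesis by blast
qed

text \<open>The difference switches on just after 0 and off just after \<open>t\<close>. The second
  edge lies to the right of \<open>t\<close>, so the limit at \<open>r = t\<close> is 1, in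
  accordance with the closed interval.\<close>

lemma smooth_step_tendsto_indicator:
  assumes H: "smooth_step H h" and t: "0 \<le> t" and r: "0 < r"
  shows "(\<lambda>n. H (real (Suc n) * (r - 0)) - H (real (Suc n) * (r - t))) \<longlonglongrightarrow> indicator {0..t} r"
proof -
  have one: "(\<lambda>n. H (real (Suc n) * (r - s))) \<longlonglongrightarrow> 1" if "s < r" for s
  proof -
    have "0 < r - s" using that by simp
    then obtain N where N: "1 / real (Suc N) < r - s"
      by (rule nat_approx_posE)
    have "H (real (Suc n) * (r - s)) = 1" if "N \<le> n" for n
    proof -
      have "1 / real (Suc n) \<le> 1 / real (Suc N)" using that by (simp add: frac_le)
      then have "1 / real (Suc n) < r - s" using N by linarith
      then have "1 \<le> real (Suc n) * (r - s)" by (simp add: field_simps)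
      then show ?thesis using H by (simp add: smooth_step_def)
    qed
    then show ?thesis
      by (intro tendsto_eventually) (auto simp: eventually_sequentially)
  qed
  have zero: "H (real (Suc n) * (r - t)) = 0" if "r \<le> t" for n
  proof -
    have "real (Suc n) * (r - t) \<le> 0" using that by (intro mult_nonneg_nonpos) auto
    then show ?thesis using H unfolding smooth_step_def by blast
  qed
  show ?thesis
  proof (cases "r \<le> t")
    case True
    then show ?thesis using one[OF r] zero[OF True] r by simp
  next
    case False
    then have "t < r" by simp
    from tendsto_diff[OF one[OF r] one[OF this]] show ?thesis using False by simp
  qed
qed

text \<open>The test field is \<open>rot90\<close> of the gradient of
  \<open>wave k \<theta> / (4 pi^2 |k|^2)\<close>, and this function solves
  \<open>- \<Delta> \<chi> = wave k \<theta>\<close>. Since \<open>rot90 (b x)\<close> is the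
  gradient of \<open>f\<close>, the pairing is minus that of the two gradients, hence minus the
  coefficient of \<open>f\<close>. The inverse Laplacian is the reason for excluding
  \<open>k = 0\<close>.\<close>

lemma stream_function_pairing:
  fixes b :: "real^2 \<Rightarrow> real^2"
  assumes b: "b \<in> L2" and g: "has_weak_grad f (\<lambda>x. rot90 (b x))" and k: "k \<in> lattice" "k \<noteq> 0"
    and v: "v = (- 1 / (2 * pi * (k \<bullet> k))) *\<^sub>R rot90 k"
  shows "(LINT x|lebesgue_on torus. b x \<bullet> (wave k (\<theta> - pi/2) x *\<^sub>R v)) = - (LINT x|lebesgue_on torus. f x * wave k \<theta> x)"
proof -
  let ?D = "2 * pi * (k \<bullet> k)" and ?w = "wave k (\<theta> - pi/2)"
  have D: "?D \<noteq> 0" using k(2) by simp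
  have kk: "k \<bullet> k = k $ 1 * k $ 1 + k $ 2 * k $ 2" by (simp add: inner_vec_def sum_2)
  have i: "integrable (lebesgue_on torus) (\<lambda>x. rot90 (b x) $ j * ?w x)" for j
    using g by (intro L2_mult_integrable L2_component wave_L2) (simp add: has_weak_grad_def)
  have "(LINT x|lebesgue_on torus. b x \<bullet> (?w x *\<^sub>R v)) =
      (LINT x|lebesgue_on torus. (k $ 1 / ?D) * (rot90 (b x) $ 1 * ?w x) + (k $ 2 / ?D) * (rot90 (b x) $ 2 * ?w x))"
    using D by (intro Bochner_Integration.integral_cong refl)
      (simp add: v inner_vec_def[of "b _"] sum_2 divide_simps, simp add: algebra_simps)
  also have "\<dots> = (k $ 1 / ?D) * (LINT x|lebesgue_on torus. rot90 (b x) $ 1 * ?w x) +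
      (k $ 2 / ?D) * (LINT x|lebesgue_on torus. rot90 (b x) $ 2 * ?w x)"
    by (subst Bochner_Integration.integral_add)
       (simp_all only: integral_mult_right_zero i integrable_mult_right)
  also have "\<dots> = - (2 * pi * (k $ 1 * k $ 1 + k $ 2 * k $ 2) / ?D) * (LINT x|lebesgue_on torus. f x * wave k \<theta> x)"
  proof -
    have "(k $ 1 / d) * (- 2 * pi * k $ 1 * c) + (k $ 2 / d) * (- 2 * pi * k $ 2 * c) =
        - (2 * pi * (k $ 1 * k $ 1 + k $ 2 * k $ 2) / d) * c" for c d :: real
      by (cases "d = 0") (auto simp: field_simps)
    then show ?thesis
      by (simp only: weak_grad_wave[OF g k(1)] diff_add_cancel)
  qed
  finally show ?thesis using D by (simp add: kk[symmetric])
qed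

text \<open>Testing the equation for \<open>b\<close> against \<open>\<eta>(t) \<nabla>\<^sup>\<bottom> w(x)\<close>, with \<open>w\<close> a wave, gives the evolution of a
  Fourier coefficient of the stream function; \<open>\<eta>\<close> approximates the indicator function of \<open>[0, t]\<close>.\<close>

lemma stream_function_moments:
  fixes b :: "real^2 \<Rightarrow> real \<Rightarrow> real^2" and A :: "real^2 \<Rightarrow> real \<Rightarrow> real^2^2"
    and \<Psi> :: "real^2 \<Rightarrow> real \<Rightarrow> real" and a :: "(real^2) \<times> real \<Rightarrow> real"
  assumes b: "b \<in> Cw_L2 T"
    and A: "(\<lambda>z. A (fst z) (snd z)) \<in> borel_measurable (lebesgue_on (torus \<times> {0<..<T}))"
    and evol: "weak_evolution T b A b0"
    and flux: "AE z in lebesgue_on (torus \<times> {0<..<T}). A (fst z) (snd z) $ 1 $ 2 = a z \<and>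
      A (fst z) (snd z) $ 2 $ 1 = - a z \<and> A (fst z) (snd z) $ 1 $ 1 = 0 \<and> A (fst z) (snd z) $ 2 $ 2 = 0"
    and a: "integrable (lebesgue_on (torus \<times> {0<..<T})) a"
    and grad: "\<And>t. t \<in> {0..<T} \<Longrightarrow> has_weak_grad (\<lambda>x. \<Psi> x t) (\<lambda>x. rot90 (b x t))"
    and cont: "\<And>w. w \<in> L2 \<Longrightarrow> continuous_on {0..<T} (\<lambda>t. LINT x|lebesgue_on torus. \<Psi> x t * w x)"
    and k: "k \<in> lattice" "k \<noteq> 0" and t: "0 \<le> t" "t < T"
  shows "(LINT x|lebesgue_on torus. \<Psi> x t * wave k \<theta> x) = (LINT x|lebesgue_on torus. \<Psi> x 0 * wave k \<theta> x) -
    (LINT r|lebesgue_on {0<..<T}. indicator {0..t} r * (LINT x|lebesgue_on torus. a (x, r) * wave k \<theta> x))"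
proof -
  define v where "v = (- 1 / (2 * pi * (k \<bullet> k))) *\<^sub>R rot90 k"
  define m where "m r = (LINT x|lebesgue_on torus. \<Psi> x r * wave k \<theta> x)" for r
  define q where "q r = (LINT x|lebesgue_on torus. a (x, r) * wave k \<theta> x)" for r
  let ?w = "wave k (\<theta> - pi/2)"
  let ?Q = "lebesgue_on (torus \<times> {0<..<T})"
  have D: "k \<bullet> k \<noteq> 0" using k(2) by simp
  have kk: "k \<bullet> k = k $ 1 * k $ 1 + k $ 2 * k $ 2" by (simp add: inner_vec_def sum_2)
  \<comment> \<open>Contracting an antisymmetric matrix having \<open>a\<close> above the diagonal
    with the derivative of the test field produces exactly this factor; the length of
    \<open>v\<close> is chosen to make it 1.\<close>
  have kv: "2 * pi * (k $ 2 * v $ 1 - k $ 1 * v $ 2) = 1"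
  proof -
    have "2 * pi * (k $ 2 * v $ 1 - k $ 1 * v $ 2) = (2 * pi * (k $ 1 * k $ 1 + k $ 2 * k $ 2)) / (2 * pi * (k \<bullet> k))"
      by (simp add: v_def add_divide_distrib algebra_simps)
    then show ?thesis using D unfolding kk by simp
  qed
  have cm: "continuous_on {0..<T} m" unfolding m_def by (rule cont[OF wave_L2])
  have wb: "\<bar>wave l \<phi> x\<bar> \<le> 1" for l \<phi> x by (simp add: wave_def)
  have cw: "continuous_on UNIV (\<lambda>x. ?w x *\<^sub>R v)" by (intro continuous_intros wave_continuous)
  have wvb: "norm (?w x *\<^sub>R v) \<le> norm v" for x
    using wb[of k "\<theta> - pi/2" x] by (simp add: mult_left_le_one_le)
  note [measurable] = A borel_measurable_integrable[OF a]
  have mw[measurable]: "(\<lambda>z. wave l \<phi> (fst z)) \<in> borel_measurable ?Q" for l \<phi>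
    by (intro continuous_imp_measurable_cylinder continuous_on_compose2[OF wave_continuous[of UNIV]] continuous_intros) auto

  \<comment> \<open>Slice by slice, pairing \<open>b\<close> with the test field yields minus the
    moment \<open>m\<close>; \<open>e\<close> stands for either of the two kernels in the derivative
    of \<open>\<eta> n\<close>.\<close>
  have kernel: "integrable (lebesgue_on {0<..<T}) (\<lambda>r. e r * m r)"
    "integrable ?Q (\<lambda>z. e (snd z) * (b (fst z) (snd z) \<bullet> (?w (fst z) *\<^sub>R v)))"
    "(LINT z|?Q. e (snd z) * (b (fst z) (snd z) \<bullet> (?w (fst z) *\<^sub>R v))) = - (LINT r|lebesgue_on {0<..<T}. e r * m r)"
    if e: "continuous_on UNIV e" "\<And>r. \<bar>e r\<bar> \<le> E" for e E
  proof -
    show int: "integrable ?Q (\<lambda>z. e (snd z) * (b (fst z) (snd z) \<bullet> (?w (fst z) *\<^sub>R v)))"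
      by (rule Cw_L2_test_integrable[OF b e(1) cw e(2) wvb])
    have inner: "(LINT x|lebesgue_on torus. e r * (b x r \<bullet> (?w x *\<^sub>R v))) = - (e r * m r)" if "r \<in> {0<..<T}" for r
      using stream_function_pairing[OF Cw_L2_slice[OF b] grad k v_def, of r \<theta>] that
      by (simp only: integral_mult_right_zero m_def) simp
    have "integrable (lebesgue_on {0<..<T}) (\<lambda>r. LINT x|lebesgue_on torus. e r * (b x r \<bullet> (?w x *\<^sub>R v)))"
      using fubini_lebesgue_on(1)[OF _ _ int] by simp
    also have "?this \<longleftrightarrow> integrable (lebesgue_on {0<..<T}) (\<lambda>r. - (e r * m r))"
      by (intro Bochner_Integration.integrable_cong refl) (use inner in simp)
    finally show "integrable (lebesgue_on {0<..<T}) (\<lambda>r. e r * m r)" by simp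
    have "(LINT z|?Q. e (snd z) * (b (fst z) (snd z) \<bullet> (?w (fst z) *\<^sub>R v))) =
        (LINT r|lebesgue_on {0<..<T}. LINT x|lebesgue_on torus. e r * (b x r \<bullet> (?w x *\<^sub>R v)))"
      using fubini_lebesgue_on(2)[OF _ _ int] by simp
    also have "\<dots> = (LINT r|lebesgue_on {0<..<T}. - (e r * m r))"
      by (intro Bochner_Integration.integral_cong refl) (use inner in simp)
    finally show "(LINT z|?Q. e (snd z) * (b (fst z) (snd z) \<bullet> (?w (fst z) *\<^sub>R v))) = - (LINT r|lebesgue_on {0<..<T}. e r * m r)"
      by simp
  qed

  have aw: "integrable ?Q (\<lambda>z. c z * a z)" if [measurable]: "c \<in> borel_measurable ?Q" and c: "\<And>z. \<bar>c z\<bar> \<le> 1" for c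
  proof (rule Bochner_Integration.integrable_bound[OF a])
    show "AE z in ?Q. norm (c z * a z) \<le> norm (a z)"
      using c by (intro AE_I2) (simp add: abs_mult mult_left_le_one_le)
  qed measurable
  have qi: "integrable (lebesgue_on {0<..<T}) q"
    using fubini_lebesgue_on(1)[OF _ _ aw[OF mw[of k \<theta>]]] wb by (simp add: q_def[abs_def] mult.commute)

  obtain H h where Hh: "smooth_step H h" using smooth_step_exists by blast
  have sH: "smooth H" "smooth h" and H01: "\<And>x. 0 \<le> H x \<and> H x \<le> 1"
    and H0: "\<And>x. x \<le> 0 \<Longrightarrow> H x = 0" and H1: "\<And>x. 1 \<le> x \<Longrightarrow> H x = 1"
    using Hh by (auto simp: smooth_step_def)
  obtain B where B: "\<And>x. \<bar>h x\<bar> \<le> B" using smooth_step_kernel_bounded[OF Hh] by blast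

  \<comment> \<open>The derivative of this cutoff is an averaging kernel at 0 minus one at
    \<open>t\<close>; in the limit the two produce \<open>m 0\<close> and
    \<open>m t\<close>.\<close>
  define \<eta> where "\<eta> n r = H (real (Suc n) * (r - 0)) - H (real (Suc n) * (r - t))" for n r
  define K where "K n s r = real (Suc n) * h (real (Suc n) * (r - s))" for n s r
  have cK: "continuous_on UNIV (K n s)" for n s
    unfolding K_def by (intro continuous_intros smooth_continuous smooth_scaled sH)
  have Kb: "\<bar>K n s r\<bar> \<le> real (Suc n) * B" for n s r
    unfolding K_def abs_mult by (simp add: mult_left_mono B)
  have s\<eta>: "smooth (\<eta> n)" for n
    using smooth_add[OF smooth_scaled[OF sH(1), of "real (Suc n)" 0]
      smooth_mult[OF smooth_const[of "-1"] smooth_scaled[OF sH(1), of "real (Suc n)" t]]]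
    by (simp add: \<eta>_def[abs_def])
  have d\<eta>: "(\<eta> n has_real_derivative K n 0 r - K n t r) (at r)" for n r
    unfolding \<eta>_def[abs_def] K_def
    by (intro DERIV_diff smooth_step_scaled_derivative[OF Hh])
  have \<eta>b: "\<bar>\<eta> n r\<bar> \<le> 1" for n r
    using H01[of "real (Suc n) * (r - 0)"] H01[of "real (Suc n) * (r - t)"] unfolding \<eta>_def by linarith
  have m\<eta>[measurable]: "(\<lambda>z. \<eta> n (snd z)) \<in> borel_measurable ?Q" for n
    by (intro continuous_imp_measurable_cylinder continuous_on_compose2[OF smooth_continuous[OF s\<eta>, of UNIV]] continuous_intros) auto

  have key: "(LINT r|lebesgue_on {0<..<T}. K n 0 r * m r) - (LINT r|lebesgue_on {0<..<T}. K n t r * m r) =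
      (LINT r|lebesgue_on {0<..<T}. \<eta> n r * q r)" if n: "1 / real (Suc n) < T - t" for n
  proof -
    define c where "c = real (Suc n)"
    have c: "c > 0" "t + 1/c < T" using n by (auto simp: c_def)
    define \<phi> where "\<phi> = (\<lambda>z. (\<eta> n (snd z) * ?w (fst z)) *\<^sub>R v)"
    have \<eta>end: "\<eta> n r = 0" if "t + 1/c \<le> r" for r
    proof -
      have "1 \<le> c * (r - t)" using that c(1) by (simp add: field_simps)
      moreover have "c * (r - t) \<le> c * (r - 0)" using t c(1) by (intro mult_left_mono) auto
      ultimately show ?thesis using H1 unfolding \<eta>_def c_def[symmetric] by simp
    qed
    \<comment> \<open>The cutoff vanishes at time 0, so the initial term of the weak equation is
      zero. The initial value of the moment enters through averages just after 0, by continuity of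
      \<open>m\<close>.\<close>
    have \<eta>0: "\<eta> n 0 = 0"
    proof -
      have "real (Suc n) * (0 - t) \<le> 0" using t by (intro mult_nonneg_nonpos) auto
      then show ?thesis using H0 by (simp add: \<eta>_def)
    qed
    have "\<phi> \<in> test_halfopen T"
      unfolding test_halfopen_def
    proof (intro CollectI conjI)
      show "smooth \<phi>" unfolding \<phi>_def by (rule smooth_separated[OF s\<eta> smooth_wave])
      show "\<forall>t. periodic (\<lambda>x. \<phi> (x, t))"
        using periodic_wave[OF k(1)] by (simp add: \<phi>_def periodic_def)
      show "\<exists>T'<T. \<forall>x t. T' \<le> t \<longrightarrow> \<phi> (x, t) = 0"
        using c \<eta>end by (intro exI[of _ "t + 1/c"]) (simp add: \<phi>_def)
    qed
    then have "(LINT (x, r)|?Q. b x r \<bullet> dt \<phi> (x, r) + A x r \<bullet> Dx \<phi> (x, r)) +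
        (LINT x|lebesgue_on torus. b0 x \<bullet> \<phi> (x, 0)) = 0"
      using evol unfolding weak_evolution_def by blast
    moreover have "\<phi> (x, 0) = 0" for x using \<eta>0 by (simp add: \<phi>_def)
    ultimately have ev: "(LINT (x, r)|?Q. b x r \<bullet> dt \<phi> (x, r) + A x r \<bullet> Dx \<phi> (x, r)) = 0"
      by simp
    let ?F1 = "\<lambda>s z. K n s (snd z) * (b (fst z) (snd z) \<bullet> (?w (fst z) *\<^sub>R v))"
    let ?F2 = "\<lambda>z. \<eta> n (snd z) * wave k \<theta> (fst z) * a z"
    let ?G = "\<lambda>z. \<eta> n (snd z) * wave k \<theta> (fst z) * (2 * pi * (\<Sum>i\<in>UNIV. \<Sum>j\<in>UNIV. A (fst z) (snd z) $ i $ j * (k $ j * v $ i)))"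
    have integrand: "(case z of (x, r) \<Rightarrow> b x r \<bullet> dt \<phi> (x, r) + A x r \<bullet> Dx \<phi> (x, r)) = (?F1 0 z - ?F1 t z) + ?G z" for z
    proof -
      obtain x r where z: "z = (x, r)" by (cases z)
      have "b x r \<bullet> dt \<phi> (x, r) = ?F1 0 z - ?F1 t z"
        unfolding \<phi>_def separated_dt[OF d\<eta> smooth_wave] z by (simp add: algebra_simps)
      moreover have "A x r \<bullet> Dx \<phi> (x, r) = ?G z"
        unfolding \<phi>_def Dx_def separated_dx[OF d\<eta> smooth_wave] z
        by (simp add: inner_vec_def grad_wave sum_2 algebra_simps)
      ultimately show ?thesis by (simp add: z)
    qed
    have AE: "AE z in ?Q. (?F1 0 z - ?F1 t z) + ?G z = (?F1 0 z - ?F1 t z) + ?F2 z"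
      using flux
    proof eventually_elim
      case (elim z)
      have "2 * pi * (\<Sum>i\<in>UNIV. \<Sum>j\<in>UNIV. A (fst z) (snd z) $ i $ j * (k $ j * v $ i)) =
          (2 * pi * (k $ 2 * v $ 1 - k $ 1 * v $ 2)) * a z"
        using elim by (simp add: sum_2 algebra_simps)
      then show ?case unfolding kv by simp
    qed
    have mA: "(\<lambda>z. A (fst z) (snd z) $ i $ j) \<in> borel_measurable ?Q" for i j
      by (rule borel_measurable_continuous_on[OF _ A, of "\<lambda>M. M $ i $ j"]) (intro continuous_intros)
    have F1: "integrable ?Q (?F1 s)" for s by (rule kernel(2)[OF cK Kb])
    have F2: "integrable ?Q ?F2"
      by (rule aw) (auto simp: abs_mult intro!: mult_le_one \<eta>b wb)
    have "(LINT (x, r)|?Q. b x r \<bullet> dt \<phi> (x, r) + A x r \<bullet> Dx \<phi> (x, r)) = (LINT z|?Q. (?F1 0 z - ?F1 t z) + ?G z)"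
      by (intro Bochner_Integration.integral_cong refl integrand)
    then have "0 = (LINT z|?Q. (?F1 0 z - ?F1 t z) + ?G z)"
      using ev by (simp only:)
    also have "\<dots> = (LINT z|?Q. (?F1 0 z - ?F1 t z) + ?F2 z)"
    proof (rule integral_cong_AE[OF _ _ AE])
      show "(\<lambda>z. (?F1 0 z - ?F1 t z) + ?G z) \<in> borel_measurable ?Q"
        by (intro borel_measurable_add borel_measurable_diff borel_measurable_times borel_measurable_sum
            borel_measurable_integrable[OF F1] mA m\<eta> mw borel_measurable_const)
      show "(\<lambda>z. (?F1 0 z - ?F1 t z) + ?F2 z) \<in> borel_measurable ?Q"
        by (intro borel_measurable_add borel_measurable_diff
            borel_measurable_integrable[OF F1] borel_measurable_integrable[OF F2])
    qed
    also have "\<dots> = (LINT z|?Q. ?F1 0 z) - (LINT z|?Q. ?F1 t z) + (LINT z|?Q. ?F2 z)"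
      by (simp only: Bochner_Integration.integral_add Bochner_Integration.integral_diff
          Bochner_Integration.integrable_diff F1 F2)
    also have "(LINT z|?Q. ?F2 z) = (LINT r|lebesgue_on {0<..<T}. \<eta> n r * q r)"
      using fubini_lebesgue_on(2)[OF _ _ F2] by (simp add: q_def mult.assoc mult.commute[of "wave _ _ _"])
    finally show ?thesis unfolding kernel(3)[OF cK Kb] by linarith
  qed

  obtain N where N: "1 / real (Suc N) < T - t"
    using t nat_approx_posE[of "T - t"] by auto
  have ev: "eventually (\<lambda>n. (LINT r|lebesgue_on {0<..<T}. K n 0 r * m r) - (LINT r|lebesgue_on {0<..<T}. K n t r * m r) =
      (LINT r|lebesgue_on {0<..<T}. \<eta> n r * q r)) sequentially"
    unfolding eventually_sequentially
  proof (intro exI[of _ N] allI impI)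
    fix n assume "N \<le> n"
    then have "1 / real (Suc n) \<le> 1 / real (Suc N)" by (simp add: frac_le)
    then show "(LINT r|lebesgue_on {0<..<T}. K n 0 r * m r) - (LINT r|lebesgue_on {0<..<T}. K n t r * m r) =
      (LINT r|lebesgue_on {0<..<T}. \<eta> n r * q r)" using N by (intro key) linarith
  qed
  have "(\<lambda>n. (LINT r|lebesgue_on {0<..<T}. K n 0 r * m r) - (LINT r|lebesgue_on {0<..<T}. K n t r * m r)) \<longlonglongrightarrow> m 0 - m t"
    unfolding K_def using t by (intro tendsto_diff kernel_limit[OF Hh cm]) auto
  then have "(\<lambda>n. LINT r|lebesgue_on {0<..<T}. \<eta> n r * q r) \<longlonglongrightarrow> m 0 - m t"
    using ev by (rule Lim_transform_eventually)
  moreover have "(\<lambda>n. LINT r|lebesgue_on {0<..<T}. \<eta> n r * q r) \<longlonglongrightarrow> (LINT r|lebesgue_on {0<..<T}. indicator {0..t} r * q r)"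
  proof (rule integral_dominated_convergence[where w = "\<lambda>r. \<bar>q r\<bar>"])
    note mq = borel_measurable_integrable[OF qi]
    have "\<eta> n \<in> borel_measurable (lebesgue_on {0<..<T})" for n
      by (rule continuous_imp_measurable_on_sets_lebesgue[OF smooth_continuous[OF s\<eta>]]) simp
    then show "(\<lambda>r. \<eta> n r * q r) \<in> borel_measurable (lebesgue_on {0<..<T})" for n
      using mq by (rule borel_measurable_times)
    have "indicator {0..t} \<in> borel_measurable (lebesgue_on {0<..<T})"
      by (intro measurable_restrict_space1 borel_measurable_indicator) simp
    then show "(\<lambda>r. indicator {0..t} r * q r) \<in> borel_measurable (lebesgue_on {0<..<T})"
      using mq by (rule borel_measurable_times)
    show "AE r in lebesgue_on {0<..<T}. (\<lambda>n. \<eta> n r * q r) \<longlonglongrightarrow> indicator {0..t} r * q r"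
      unfolding \<eta>_def
      by (intro AE_I2 tendsto_mult smooth_step_tendsto_indicator[OF Hh t(1)] tendsto_const) auto
    show "AE r in lebesgue_on {0<..<T}. norm (\<eta> n r * q r) \<le> \<bar>q r\<bar>" for n
      using \<eta>b by (intro AE_I2) (simp add: abs_mult mult_left_le_one_le)
  qed (use qi in simp)
  ultimately have "m 0 - m t = (LINT r|lebesgue_on {0<..<T}. indicator {0..t} r * q r)"
    using LIMSEQ_unique by blast
  then show ?thesis by (simp add: m_def q_def)
qed


section \<open>Conservation\<close>

lemma continuous_rot90: "continuous_on A rot90"
  unfolding rot90_def
proof (intro continuous_on_vec_lambda)
  show "continuous_on A (\<lambda>y. if i = 1 then - (y $ 2) else y $ 1)" for i :: 2
    by (cases "i = 1") (auto intro!: continuous_intros)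
qed

lemma norm_rot90: "norm (rot90 y) = norm y"
  by (simp add: norm_eq_sqrt_inner inner_vec_def sum_2 add.commute)

text \<open>The gradient picked by \<open>weak_grad\<close> is arbitrary on a null set at each time.
  It is replaced by an expression in \<open>b\<close>, whose joint measurability in space and time
  is known.\<close>

lemma stream_function_weak_grad:
  assumes \<Psi>: "is_stream_function T b \<Psi>" and b: "b \<in> Cw_L2 T" and t: "t \<in> {0..<T}"
  shows "has_weak_grad (\<lambda>x. \<Psi> x t) (\<lambda>x. rot90 (b x t))"
proof -
  let ?g = "weak_grad (\<lambda>x. \<Psi> x t)"
  have "(\<lambda>x. \<Psi> x t) \<in> W12"
    using \<Psi> t by (auto simp: is_stream_function_def Cw_W12_def)
  then have "\<exists>g. has_weak_grad (\<lambda>x. \<Psi> x t) g"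
    by (simp add: W12_def)
  then have g: "has_weak_grad (\<lambda>x. \<Psi> x t) ?g"
    unfolding weak_grad_def by (rule someI_ex)
  then have gL2: "?g \<in> L2" by (simp add: has_weak_grad_def)
  have eq: "AE x in lebesgue_on torus. ?g x = rot90 (b x t)"
  proof -
    have "AE x in lebesgue_on torus. vector [?g x $ 2, - (?g x $ 1)] = b x t"
      using \<Psi> t by (auto simp: is_stream_function_def)
    then show ?thesis
    proof eventually_elim
      case (elim x)
      show ?case
        unfolding elim[symmetric] by (simp add: vec_eq_iff forall_2)
    qed
  qed
  have mb: "(\<lambda>x. rot90 (b x t)) \<in> borel_measurable (lebesgue_on torus)"
    by (rule borel_measurable_continuous_on[OF continuous_rot90 L2_measurable[OF Cw_L2_slice[OF b t]]])
  have rL2: "(\<lambda>x. rot90 (b x t)) \<in> L2"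
    by (rule L2_dominated[OF mb Cw_L2_slice[OF b t] L2_const[of "0::real"]]) (simp add: norm_rot90)
  have "(LINT x|lebesgue_on torus. ?g x $ i * \<psi> x) = (LINT x|lebesgue_on torus. rot90 (b x t) $ i * \<psi> x)"
    if "\<psi> \<in> torus_test" for \<psi> i
  proof (rule integral_cong_AE)
    have "\<psi> \<in> L2"
      using that by (auto simp: torus_test_def intro!: continuous_imp_L2 smooth_continuous)
    then show "(\<lambda>x. ?g x $ i * \<psi> x) \<in> borel_measurable (lebesgue_on torus)"
      "(\<lambda>x. rot90 (b x t) $ i * \<psi> x) \<in> borel_measurable (lebesgue_on torus)"
      using L2_mult_integrable[OF L2_component[OF gL2]] L2_mult_integrable[OF L2_component[OF rL2]]
      by (auto intro!: borel_measurable_integrable)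
    show "AE x in lebesgue_on torus. ?g x $ i * \<psi> x = rot90 (b x t) $ i * \<psi> x"
      using eq by eventually_elim simp
  qed
  with g rL2 show ?thesis by (simp add: has_weak_grad_def)
qed

lemma C_L2_pairing_continuous:
  fixes \<Psi> :: "real^2 \<Rightarrow> real \<Rightarrow> real"
  assumes \<Psi>: "\<Psi> \<in> C_L2 T" and w: "w \<in> L2"
  shows "continuous_on {0..<T} (\<lambda>t. LINT x|lebesgue_on torus. \<Psi> x t * w x)"
  unfolding continuous_on_def
proof
  fix t assume t: "t \<in> {0..<T}"
  have sl: "(\<lambda>x. \<Psi> x s) \<in> L2" if "s \<in> {0..<T}" for s using \<Psi> that by (simp add: C_L2_def)
  let ?W = "LINT x|lebesgue_on torus. (w x)\<^sup>2"
  have lim: "((\<lambda>s. l2_norm (\<lambda>x. \<Psi> x s - \<Psi> x t)) \<longlongrightarrow> 0) (at t within {0..<T})"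
    using \<Psi> t by (simp add: C_L2_def)
  have lim2: "((\<lambda>s. (l2_norm (\<lambda>x. \<Psi> x s - \<Psi> x t))\<^sup>2 * ?W) \<longlongrightarrow> 0) (at t within {0..<T})"
  proof -
    have "((\<lambda>s. (l2_norm (\<lambda>x. \<Psi> x s - \<Psi> x t))\<^sup>2) \<longlongrightarrow> 0) (at t within {0..<T})"
      using tendsto_power[OF lim, of 2] by simp
    then show ?thesis by (rule tendsto_mult_left_zero)
  qed
  have "((\<lambda>s. ((LINT x|lebesgue_on torus. \<Psi> x s * w x) - (LINT x|lebesgue_on torus. \<Psi> x t * w x))\<^sup>2) \<longlongrightarrow> 0) (at t within {0..<T})"
  proof (rule Lim_null_comparison[OF _ lim2])
    show "\<forall>\<^sub>F s in at t within {0..<T}. norm (((LINT x|lebesgue_on torus. \<Psi> x s * w x) - (LINT x|lebesgue_on torus. \<Psi> x t * w x))\<^sup>2)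
        \<le> (l2_norm (\<lambda>x. \<Psi> x s - \<Psi> x t))\<^sup>2 * ?W"
      unfolding eventually_at_filter
    proof (intro always_eventually allI impI)
      fix s assume s: "s \<in> {0..<T}"
      have d: "(\<lambda>x. \<Psi> x s - \<Psi> x t) \<in> L2" by (intro L2_diff sl s t)
      have "(LINT x|lebesgue_on torus. \<Psi> x s * w x) - (LINT x|lebesgue_on torus. \<Psi> x t * w x) =
          (LINT x|lebesgue_on torus. (\<Psi> x s - \<Psi> x t) \<bullet> w x)"
        using L2_mult_integrable[OF sl[OF s] w] L2_mult_integrable[OF sl[OF t] w]
        by (simp add: left_diff_distrib)
      also have "\<bar>\<dots>\<bar> \<le> (LINT x|lebesgue_on torus. \<bar>(\<Psi> x s - \<Psi> x t) \<bullet> w x\<bar>)"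
        by (rule integral_abs_bound)
      finally have "((LINT x|lebesgue_on torus. \<Psi> x s * w x) - (LINT x|lebesgue_on torus. \<Psi> x t * w x))\<^sup>2
          \<le> (LINT x|lebesgue_on torus. \<bar>(\<Psi> x s - \<Psi> x t) \<bullet> w x\<bar>)\<^sup>2"
        by (simp add: abs_le_square_iff[symmetric])
      also have "\<dots> \<le> (LINT x|lebesgue_on torus. (norm (\<Psi> x s - \<Psi> x t))\<^sup>2) * (LINT x|lebesgue_on torus. (norm (w x))\<^sup>2)"
        by (intro Cauchy_Schwarz_integral(2) L2_measurable L2_integrable_norm2 d w)
      also have "(LINT x|lebesgue_on torus. (norm (\<Psi> x s - \<Psi> x t))\<^sup>2) = (l2_norm (\<lambda>x. \<Psi> x s - \<Psi> x t))\<^sup>2"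
        by (simp add: l2_norm_def l2_inner_def power2_eq_square)
      finally show "norm (((LINT x|lebesgue_on torus. \<Psi> x s * w x) - (LINT x|lebesgue_on torus. \<Psi> x t * w x))\<^sup>2)
        \<le> (l2_norm (\<lambda>x. \<Psi> x s - \<Psi> x t))\<^sup>2 * ?W" by simp
    qed
  qed
  then have "((\<lambda>s. (LINT x|lebesgue_on torus. \<Psi> x s * w x) - (LINT x|lebesgue_on torus. \<Psi> x t * w x)) \<longlongrightarrow> 0) (at t within {0..<T})"
    by simp
  then show "((\<lambda>s. LINT x|lebesgue_on torus. \<Psi> x s * w x) \<longlongrightarrow> (LINT x|lebesgue_on torus. \<Psi> x t * w x)) (at t within {0..<T})"
    by (simp add: LIM_zero_iff)
qed

text \<open>The renormalizations \<open>2 (1 - cos (l s)) / l\<^sup>2\<close> are bounded by \<open>s\<^sup>2\<close> and tend to it as \<open>l\<close>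
  tends to \<open>0\<close>.\<close>

lemma integral_square_eq_if_cos_eq:
  fixes f g :: "real^2 \<Rightarrow> real"
  assumes f: "f \<in> L2" and g: "g \<in> L2"
    and eq: "\<And>l. l \<noteq> 0 \<Longrightarrow> (LINT x|lebesgue_on torus. cos (l * f x)) = (LINT x|lebesgue_on torus. cos (l * g x))"
  shows "(LINT x|lebesgue_on torus. (f x)\<^sup>2) = (LINT x|lebesgue_on torus. (g x)\<^sup>2)"
proof -
  define l where "l n = 1 / real (Suc n)" for n
  have l: "l n \<noteq> 0" for n by (simp add: l_def)
  have l0: "filterlim l (at 0) sequentially"
    unfolding filterlim_at using LIMSEQ_inverse_real_of_nat l by (simp add: l_def[abs_def] inverse_eq_divide)
  have lim: "(\<lambda>n. LINT x|lebesgue_on torus. 2 * (1 - cos (l n * h x)) / (l n)\<^sup>2) \<longlonglongrightarrow> (LINT x|lebesgue_on torus. (h x)\<^sup>2)"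
    if h: "h \<in> L2" for h :: "real^2 \<Rightarrow> real"
  proof (rule integral_dominated_convergence[where w = "\<lambda>x. (h x)\<^sup>2"])
    note [measurable] = L2_measurable[OF h]
    show "(\<lambda>x. (h x)\<^sup>2) \<in> borel_measurable (lebesgue_on torus)"
      "(\<lambda>x. 2 * (1 - cos (l n * h x)) / (l n)\<^sup>2) \<in> borel_measurable (lebesgue_on torus)" for n
      by measurable
    show "integrable (lebesgue_on torus) (\<lambda>x. (h x)\<^sup>2)" using L2_integrable_norm2[OF h] by simp
    \<comment> \<open>The half-angle formula writes the renormalization as a square; the bound and
      the limit then follow from \<open>|sin y| \<le> |y|\<close> and from the derivative of sine at
      0.\<close>
    have half: "2 * (1 - cos (l n * s)) / (l n)\<^sup>2 = (sin (s / 2 * l n) / (l n / 2))\<^sup>2" for n s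
    proof -
      have "cos (l n * s) = 1 - 2 * (sin (s / 2 * l n))\<^sup>2"
        using cos_double_sin[of "s / 2 * l n"] by (simp add: mult.commute)
      then show ?thesis by (simp add: power_divide)
    qed
    show "AE x in lebesgue_on torus. (\<lambda>n. 2 * (1 - cos (l n * h x)) / (l n)\<^sup>2) \<longlonglongrightarrow> (h x)\<^sup>2"
    proof (rule AE_I2)
      fix x
      have "((\<lambda>y. sin (h x / 2 * y)) has_real_derivative h x / 2) (at 0)"
        by (auto intro!: derivative_eq_intros)
      then have "((\<lambda>y. sin (h x / 2 * y) / y) \<longlongrightarrow> h x / 2) (at 0)"
        by (simp add: DERIV_def)
      from filterlim_compose[OF this l0] have "(\<lambda>n. sin (h x / 2 * l n) / l n) \<longlonglongrightarrow> h x / 2" .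
      from tendsto_power[OF tendsto_mult_right[OF this, of 2], of 2]
      show "(\<lambda>n. 2 * (1 - cos (l n * h x)) / (l n)\<^sup>2) \<longlonglongrightarrow> (h x)\<^sup>2"
        unfolding half by (simp add: mult.commute)
    qed
    show "AE x in lebesgue_on torus. norm (2 * (1 - cos (l n * h x)) / (l n)\<^sup>2) \<le> (h x)\<^sup>2" for n
    proof (rule AE_I2)
      fix x
      have "\<bar>sin (h x / 2 * l n)\<bar> \<le> \<bar>h x / 2 * l n\<bar>" by (rule abs_sin_x_le_abs_x)
      then have "\<bar>sin (h x / 2 * l n) / (l n / 2)\<bar> \<le> \<bar>h x\<bar>"
        using l[of n] by (simp add: abs_mult field_simps)
      then have "(sin (h x / 2 * l n) / (l n / 2))\<^sup>2 \<le> (h x)\<^sup>2"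
        by (simp only: abs_le_square_iff)
      then show "norm (2 * (1 - cos (l n * h x)) / (l n)\<^sup>2) \<le> (h x)\<^sup>2"
        by (simp only: half real_norm_def abs_power2)
    qed
  qed
  have int: "(LINT x|lebesgue_on torus. 2 * (1 - cos (l n * h x)) / (l n)\<^sup>2) =
      2 * ((LINT x|lebesgue_on torus. 1) - (LINT x|lebesgue_on torus. cos (l n * h x))) / (l n)\<^sup>2"
    if h: "h \<in> L2" for h :: "real^2 \<Rightarrow> real" and n
  proof -
    note [measurable] = L2_measurable[OF h]
    have "integrable (lebesgue_on torus) (\<lambda>x. cos (l n * h x))"
      by (rule torus.integrable_const_bound[where B = 1]) auto
    then show ?thesis by simp
  qed
  have "(\<lambda>n. LINT x|lebesgue_on torus. 2 * (1 - cos (l n * f x)) / (l n)\<^sup>2) =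
      (\<lambda>n. LINT x|lebesgue_on torus. 2 * (1 - cos (l n * g x)) / (l n)\<^sup>2)"
    by (simp only: int[OF f] int[OF g] eq[OF l])
  then show ?thesis
    using LIMSEQ_unique[OF lim[OF f]] lim[OF g] by simp
qed

theorem theorem1p1:
  fixes T :: real
    and u0 b0 :: "real^2 \<Rightarrow> real^2"
    and u b :: "real^2 \<Rightarrow> real \<Rightarrow> real^2"
    and S A :: "real^2 \<Rightarrow> real \<Rightarrow> real^2^2"
    and \<Psi> :: "real^2 \<Rightarrow> real \<Rightarrow> real"
  assumes "T > 0"
    and "u0 \<in> L2" and "b0 \<in> L2"
    and "div_free u0" and "div_free b0"
    and "u \<in> Cw_L2 T" and "b \<in> Cw_L2 T"
    and "S \<in> L1_loc T sym_mat" and "A \<in> L1_loc T antisym_mat"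
    and "div_free_time T u" and "div_free_time T b"
    and "weak_evolution T u S u0" and "weak_evolution T b A b0"
    and "AE t in lebesgue_on {0..<T}. (LINT x|lebesgue_on torus. u x t) = 0"
    and "AE t in lebesgue_on {0..<T}. (LINT x|lebesgue_on torus. b x t) = 0"
    and "AE (x, t) in lebesgue_on (torus \<times> {0<..<T}).
           (u x t, b x t, S x t, A x t) \<in> lambda_hull constraint_set"
    and "is_stream_function T b \<Psi>"
  shows "(\<lambda>t. LINT x|lebesgue_on torus. \<bar>\<Psi> x t\<bar>\<^sup>2) constant_on {0..<T}"
proof -
  note u = \<open>u \<in> Cw_L2 T\<close> and b = \<open>b \<in> Cw_L2 T\<close>
  let ?Q = "lebesgue_on (torus \<times> {0<..<T})"
  have Q: "torus \<times> {0<..<T} \<in> sets lebesgue" "torus \<times> {0<..<T} \<in> sets borel"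
    by (rule lebesgue_on_Times_sets; simp)+
  \<comment> \<open>This is \<open>u \<bullet> \<nabla>\<Psi>\<close> expressed through
    \<open>b\<close>, and at the same time the upper off-diagonal entry of \<open>A\<close> in the
    hull.\<close>
  define a where "a z = b (fst z) (snd z) $ 1 * u (fst z) (snd z) $ 2 - u (fst z) (snd z) $ 1 * b (fst z) (snd z) $ 2"
    for z
  have \<Psi>C: "\<Psi> \<in> C_L2 T" and mean: "\<And>t. t \<in> {0..<T} \<Longrightarrow> (LINT x|lebesgue_on torus. \<Psi> x t) = 0"
    using \<open>is_stream_function T b \<Psi>\<close> by (auto simp: is_stream_function_def)
  have \<Psi>L2: "(\<lambda>x. \<Psi> x t) \<in> L2" if "t \<in> {0..<T}" for t
    using \<Psi>C that by (simp add: C_L2_def)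
  note grad = stream_function_weak_grad[OF \<open>is_stream_function T b \<Psi>\<close> b]
  have a_inner: "a (x, t) = u x t \<bullet> rot90 (b x t)" for x t
    by (simp add: a_def inner_vec_def sum_2)

  have ai: "integrable ?Q a"
  proof (rule Cw_L2_pairing_integrable[OF u b, where c = 0])
    have comp: "(\<lambda>z. v (fst z) (snd z) $ i) \<in> borel_measurable ?Q" if "v \<in> Cw_L2 T" for v :: "real^2 \<Rightarrow> real \<Rightarrow> real^2" and i
      by (rule borel_measurable_continuous_on[OF _ Cw_L2_measurable[OF that], of "\<lambda>y. y $ i"]) (intro continuous_intros)
    show "a \<in> borel_measurable ?Q"
      unfolding a_def[abs_def] by (intro borel_measurable_diff borel_measurable_times comp u b)
    show "\<bar>a (x, t)\<bar> \<le> (norm (u x t))\<^sup>2 + (norm (b x t))\<^sup>2 + 0" for x t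
    proof -
      have "\<bar>a (x, t)\<bar> \<le> norm (u x t) * norm (b x t)"
        using Cauchy_Schwarz_ineq2[of "u x t" "rot90 (b x t)"] by (simp add: a_inner norm_rot90)
      also have "\<dots> \<le> (norm (u x t))\<^sup>2 + (norm (b x t))\<^sup>2"
        using sum_squares_bound[of "norm (u x t)" "norm (b x t)"]
          mult_nonneg_nonneg[OF norm_ge_zero[of "u x t"] norm_ge_zero[of "b x t"]] by linarith
      finally show ?thesis by simp
    qed
    show "(\<lambda>x. a (x, t)) \<in> borel_measurable (lebesgue_on torus)" if "t \<in> {0<..<T}" for t
      using that grad[of t] Cw_L2_slice[OF u, of t] unfolding a_inner
      by (intro borel_measurable_integrable L2_inner_integrable) (auto simp: has_weak_grad_def)
  qed

  have A: "(\<lambda>z. A (fst z) (snd z)) \<in> borel_measurable ?Q"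
  proof (rule measurable_restrict_mono)
    show "(\<lambda>z. A (fst z) (snd z)) \<in> borel_measurable (lebesgue_on (torus \<times> {0..<T}))"
      using \<open>A \<in> L1_loc T antisym_mat\<close> by (simp add: L1_loc_def split_beta')
  qed auto
  have flux: "AE z in ?Q. A (fst z) (snd z) $ 1 $ 2 = a z \<and> A (fst z) (snd z) $ 2 $ 1 = - a z \<and>
      A (fst z) (snd z) $ 1 $ 1 = 0 \<and> A (fst z) (snd z) $ 2 $ 2 = 0"
    using \<open>AE (x, t) in ?Q. (u x t, b x t, S x t, A x t) \<in> lambda_hull constraint_set\<close>
  proof eventually_elim
    case (elim z)
    then have "(u (fst z) (snd z), b (fst z) (snd z), S (fst z) (snd z), A (fst z) (snd z)) \<in> lambda_hull constraint_set"
      by (simp add: split_beta')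
    from lambda_hull_constraint_set[OF this] show ?case by (simp add: a_def)
  qed

  have transport: "(LINT x|lebesgue_on torus. a (x, t)) = 0"
    "l \<noteq> 0 \<Longrightarrow> (LINT x|lebesgue_on torus. sin (l * \<Psi> x t) * a (x, t)) = 0" if t: "t \<in> {0<..<T}" for t l
    unfolding a_inner using t
      transport_orthogonal[OF \<Psi>L2 grad Cw_L2_slice[OF u] div_free_slice[OF u \<open>div_free_time T u\<close> t], of t]
    by auto

  obtain a0 where a0: "a0 \<in> borel_measurable borel" "AE z in lborel. a0 z = indicator (torus \<times> {0<..<T}) z * a z"
    using lebesgue_on_borel_version[OF Q(1) borel_measurable_integrable[OF ai]] by blast
  \<comment> \<open>\<open>a0\<close> vanishes outside the cylinder only almost everywhere. The
    additional indicator makes this true at every point, so that all sections outside the square or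
    the time interval are identically 0.\<close>
  define a' where "a' z = indicator (torus \<times> {0<..<T}) z * a0 z" for z
  have a'm: "a' \<in> borel_measurable borel"
    unfolding a'_def[abs_def] using Q(2) a0(1) by (intro borel_measurable_times borel_measurable_indicator)
  have a'eq: "AE z in lborel. a' z = indicator (torus \<times> {0<..<T}) z * a z"
    using a0(2) by eventually_elim (simp add: a'_def indicator_def)
  have a'out: "a' z = 0" if "z \<notin> torus \<times> {0<..<T}" for z using that by (simp add: a'_def)
  have a'i: "integrable (lborel \<Otimes>\<^sub>M lborel) a'"
    using lebesgue_on_via_lborel(2)[OF Q(1) a'm a'eq] ai by (simp add: lborel_prod)
  have a'mp[measurable]: "a' \<in> borel_measurable (borel \<Otimes>\<^sub>M borel)"
    using a'm by (simp add: borel_prod)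
  have slice: "AE r in lborel. r \<in> {0<..<T} \<longrightarrow> (AE x in lborel. a' (x, r) = indicator torus x * a (x, r))"
  proof -
    have "{0<..<T} \<in> sets borel" by simp
    from lebesgue_on_Times_sections[OF torus_sets(2) this a'm a'eq] show ?thesis
      by eventually_elim auto
  qed

  obtain \<psi> where \<psi>[measurable]: "\<psi> \<in> borel_measurable borel" and \<psi>eq: "AE x in lborel. \<psi> x = indicator torus x * \<Psi> x 0"
    using lebesgue_on_borel_version[OF torus_sets(1) L2_measurable[OF \<Psi>L2[of 0]]] \<open>T > 0\<close> by auto

  \<comment> \<open>On the null set of points whose section is not integrable in time the integral
    may take its default value 0. Measurability of \<open>J\<close> holds everywhere, and the chain
    rule is applied only off that null set.\<close>
  define J where "J x t = (LBINT r:{0..t}. a' (x, r))" for x t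
  have J: "J x t = (LBINT s. (if 0 \<le> s \<and> s \<le> t then a' (x, s) else 0))" for x t
    unfolding J_def set_lebesgue_integral_def by (intro Bochner_Integration.integral_cong) auto
  have Jm[measurable]: "(\<lambda>z. J (fst z) (snd z)) \<in> borel_measurable (borel \<Otimes>\<^sub>M borel)"
    unfolding J by measurable
  have Jm1[measurable]: "(\<lambda>x. J x t) \<in> borel_measurable borel" for t
    unfolding J by measurable
  have Jout: "J x t = 0" if "x \<notin> torus" for x t
    using that a'out by (simp add: J_def set_lebesgue_integral_def)

  \<comment> \<open>Fubini with a bounded weight. The weight will be a wave when the moments of
    \<open>J\<close> are computed, and the outer derivative of the cosine when the chain rule is
    integrated.\<close>
  have weighted: "integrable lborel (\<lambda>x. LBINT r. c x r * a' (x, r))"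
    "integrable lborel (\<lambda>r. LBINT x. c x r * a' (x, r))"
    "(LBINT x. LBINT r. c x r * a' (x, r)) = (LBINT r. LBINT x. c x r * a' (x, r))"
    if [measurable]: "(\<lambda>z. c (fst z) (snd z)) \<in> borel_measurable (borel \<Otimes>\<^sub>M borel)" and c: "\<And>x r. \<bar>c x r\<bar> \<le> C"
    for c :: "real^2 \<Rightarrow> real \<Rightarrow> real" and C
  proof -
    have "integrable (lborel \<Otimes>\<^sub>M lborel) (\<lambda>z. c (fst z) (snd z) * a' z)"
    proof (rule Bochner_Integration.integrable_bound)
      show "integrable (lborel \<Otimes>\<^sub>M lborel) (\<lambda>z. C * \<bar>a' z\<bar>)" using a'i by simp
      show "AE z in lborel \<Otimes>\<^sub>M lborel. norm (c (fst z) (snd z) * a' z) \<le> norm (C * \<bar>a' z\<bar>)"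
      proof (rule AE_I2)
        fix z
        have "\<bar>c (fst z) (snd z)\<bar> * \<bar>a' z\<bar> \<le> \<bar>C\<bar> * \<bar>a' z\<bar>"
          using c[of "fst z" "snd z"] by (intro mult_right_mono) auto
        then show "norm (c (fst z) (snd z) * a' z) \<le> norm (C * \<bar>a' z\<bar>)" by (simp add: abs_mult)
      qed
    qed measurable
    then have i: "integrable (lborel \<Otimes>\<^sub>M lborel) (\<lambda>(x, r). c x r * a' (x, r))"
      by (simp add: split_beta')
    show "integrable lborel (\<lambda>x. LBINT r. c x r * a' (x, r))"
      using lborel_pair.integrable_fst[OF i] .
    show "integrable lborel (\<lambda>r. LBINT x. c x r * a' (x, r))"
      using lborel_pair.integrable_snd[OF i] .
    show "(LBINT x. LBINT r. c x r * a' (x, r)) = (LBINT r. LBINT x. c x r * a' (x, r))"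
      using lborel_pair.integral_fst[OF i] lborel_pair.integral_snd[OF i] by simp
  qed

  \<comment> \<open>The exceptional points depend on \<open>t\<close>, so for fixed \<open>x\<close>
    nothing is claimed about \<Psi> as a function of time. The chain rule is therefore applied to
    \<open>\<psi> x - J x r\<close>, defined for all \<open>r\<close>, and \<Psi> is put back only
    at a fixed time.\<close>
  have potential: "AE x in lborel. indicator torus x * \<Psi> x t = \<psi> x - J x t" if t: "t \<in> {0..<T}" for t
  proof -
    have t0: "(0::real) \<in> {0..<T}" using \<open>T > 0\<close> by simp
    define h where "h x = \<Psi> x t - \<Psi> x 0 + J x t" for x
    have Jmom: "integrable (lebesgue_on torus) (\<lambda>x. J x t * wave k \<theta> x) \<and>
        (LINT x|lebesgue_on torus. J x t * wave k \<theta> x) =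
        (LINT r|lebesgue_on {0<..<T}. indicator {0..t} r * (LINT x|lebesgue_on torus. a (x, r) * wave k \<theta> x))" for k \<theta>
    proof -
      define c where "c x r = indicator {0..t} r * wave k \<theta> x" for x and r :: real
      have [measurable]: "wave k \<theta> \<in> borel_measurable borel"
        by (rule borel_measurable_continuous_onI[OF wave_continuous])
      have cm: "(\<lambda>z. c (fst z) (snd z)) \<in> borel_measurable (borel \<Otimes>\<^sub>M borel)"
        unfolding c_def by measurable
      have cb: "\<bar>c x r\<bar> \<le> 1" for x r
        by (simp add: c_def wave_def indicator_def)
      have Jc: "(LBINT r. c x r * a' (x, r)) = J x t * wave k \<theta> x" for x
      proof -
        have "(LBINT r. c x r * a' (x, r)) = (LBINT r. (indicator {0..t} r *\<^sub>R a' (x, r)) * wave k \<theta> x)"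
          by (intro Bochner_Integration.integral_cong) (auto simp: c_def)
        then show ?thesis by (simp add: J_def set_lebesgue_integral_def)
      qed
      have eq1: "AE x in lborel. J x t * wave k \<theta> x = indicator torus x * (J x t * wave k \<theta> x)"
        using Jout by (intro AE_I2) (auto simp: indicator_def)
      have m1: "(\<lambda>x. J x t * wave k \<theta> x) \<in> borel_measurable borel" by measurable
      note via = lebesgue_on_via_lborel[OF torus_sets(1) m1 eq1]
      have "AE r in lborel. (LBINT x. c x r * a' (x, r)) =
          indicator {0<..<T} r * (indicator {0..t} r * (LINT x|lebesgue_on torus. a (x, r) * wave k \<theta> x))"
        using slice
      proof eventually_elim
        case (elim r)
        show ?case
        proof (cases "r \<in> {0<..<T}")
          case True
          then have eq: "AE x in lborel. a' (x, r) * wave k \<theta> x = indicator torus x * (a (x, r) * wave k \<theta> x)"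
            using elim by (auto elim!: eventually_mono)
          have "(\<lambda>x. a' (x, r) * wave k \<theta> x) \<in> borel_measurable borel" by measurable
          from lebesgue_on_via_lborel(3)[OF torus_sets(1) this eq]
          have "(LBINT x. a' (x, r) * wave k \<theta> x) = (LINT x|lebesgue_on torus. a (x, r) * wave k \<theta> x)" ..
          moreover have "(LBINT x. c x r * a' (x, r)) = (LBINT x. indicator {0..t} r * (a' (x, r) * wave k \<theta> x))"
            by (simp add: c_def mult_ac)
          ultimately show ?thesis using True by simp
        next
          case False
          then show ?thesis using a'out by simp
        qed
      qed
      moreover have "(\<lambda>r. LBINT x. c x r * a' (x, r)) \<in> borel_measurable borel"
        using borel_measurable_integrable[OF weighted(2)[of c, OF cm cb]] by simp
      ultimately have "(LINT r|lebesgue_on {0<..<T}. indicator {0..t} r * (LINT x|lebesgue_on torus. a (x, r) * wave k \<theta> x)) =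
          (LBINT r. LBINT x. c x r * a' (x, r))"
        by (intro lebesgue_on_via_lborel(3)) auto
      then show ?thesis
        using weighted[of c, OF cm cb] via(2,3) by (simp add: Jc)
    qed
    have Ji: "integrable (lebesgue_on torus) (\<lambda>x. J x t)"
      using Jmom[of 0 0] by (simp add: wave_def)
    have hi: "integrable (lebesgue_on torus) h"
      unfolding h_def[abs_def] using L2_integrable[OF \<Psi>L2[OF t]] L2_integrable[OF \<Psi>L2[OF t0]] Ji by simp
    have "AE x in lebesgue_on torus. h x = 0"
    proof (rule AE_zero_if_trig_moments_zero[OF hi])
      fix k \<theta> assume k: "k \<in> lattice"
      have "(LINT x|lebesgue_on torus. h x * wave k \<theta> x) =
          (LINT x|lebesgue_on torus. \<Psi> x t * wave k \<theta> x - \<Psi> x 0 * wave k \<theta> x + J x t * wave k \<theta> x)"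
        by (simp add: h_def algebra_simps)
      also have "\<dots> = (LINT x|lebesgue_on torus. \<Psi> x t * wave k \<theta> x) - (LINT x|lebesgue_on torus. \<Psi> x 0 * wave k \<theta> x) +
          (LINT x|lebesgue_on torus. J x t * wave k \<theta> x)"
        using L2_mult_integrable[OF \<Psi>L2[OF t] wave_L2] L2_mult_integrable[OF \<Psi>L2[OF t0] wave_L2] Jmom by simp
      also have "\<dots> = 0"
      proof (cases "k = 0")
        \<comment> \<open>The constant mode is not reached by the equation for \<open>b\<close>.
          Here both means of \<Psi> vanish by normalization, and that of \<open>a\<close> because
          \<open>u\<close> is divergence-free.\<close>
        case True
        have "(LINT r|lebesgue_on {0<..<T}. indicator {0..t} r * (LINT x|lebesgue_on torus. a (x, r) * wave k \<theta> x)) =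
            (LINT r|lebesgue_on {0<..<T}. 0)"
          using transport(1) True by (intro Bochner_Integration.integral_cong) (auto simp: wave_def)
        then show ?thesis
          using True mean[OF t] mean[OF t0] Jmom[of k \<theta>] by (simp add: wave_def)
      next
        case False
        then show ?thesis
          using stream_function_moments[OF b A \<open>weak_evolution T b A b0\<close> flux ai grad C_L2_pairing_continuous[OF \<Psi>C] k, of t \<theta>]
            t Jmom[of k \<theta>] by auto
      qed
      finally show "(LINT x|lebesgue_on torus. h x * wave k \<theta> x) = 0" .
    qed
    then have "AE x in lborel. x \<in> torus \<longrightarrow> h x = 0"
      by (subst (asm) AE_restrict_space_iff) (auto simp: AE_completion_iff)
    with \<psi>eq show ?thesis
    proof eventually_elim
      case (elim x)
      then show ?case using Jout[of x t] by (cases "x \<in> torus") (auto simp: h_def)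
    qed
  qed

  have cos_const: "(LINT x|lebesgue_on torus. cos (l * \<Psi> x t)) = (LINT x|lebesgue_on torus. cos (l * \<Psi> x 0))"
    if l: "l \<noteq> 0" and t: "t \<in> {0..<T}" for l t
  proof -
    have t0: "(0::real) \<in> {0..<T}" using \<open>T > 0\<close> by simp
    \<comment> \<open>For a fixed point, \<open>c x r * a' (x, r)\<close> is the time derivative of
      \<open>cos (l * (\<psi> x - J x r))\<close> on \<open>[0, t]\<close>, cut off outside this
      interval.\<close>
    define c where "c x r = indicator {0..t} r * (l * sin (l * (\<psi> x - J x r)))" for x and r :: real
    have cm: "(\<lambda>z. c (fst z) (snd z)) \<in> borel_measurable (borel \<Otimes>\<^sub>M borel)"
      unfolding c_def by measurable
    have cb: "\<bar>c x r\<bar> \<le> \<bar>l\<bar>" for x r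
      by (simp add: c_def indicator_def abs_mult mult_left_le)
    \<comment> \<open>With the time fixed first, \<open>\<psi> x - J x r\<close> may be replaced by
      \<Psi> at almost every point, and the transport identity applies. Interchanging the integrals
      carries this over to the chain rule, where the point is fixed first.\<close>
    have inner: "AE r in lborel. (LBINT x. c x r * a' (x, r)) = 0"
      using slice
    proof eventually_elim
      case (elim r)
      show ?case
      proof (cases "r \<in> {0<..<T} \<and> r \<in> {0..t}")
        case True
        then have r: "r \<in> {0<..<T}" "r \<in> {0..<T}" by auto
        have eq: "AE x in lborel. sin (l * (\<psi> x - J x r)) * a' (x, r) = indicator torus x * (sin (l * \<Psi> x r) * a (x, r))"
          using elim[rule_format, OF r(1)] potential[OF r(2)]
        proof eventually_elim
          case (elim x)
          then show ?case by (cases "x \<in> torus") auto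
        qed
        have "(\<lambda>x. sin (l * (\<psi> x - J x r)) * a' (x, r)) \<in> borel_measurable borel" by measurable
        from lebesgue_on_via_lborel(3)[OF torus_sets(1) this eq] transport(2)[OF r(1) l]
        have z: "(LBINT x. sin (l * (\<psi> x - J x r)) * a' (x, r)) = 0" by simp
        have "(LBINT x. c x r * a' (x, r)) = (LBINT x. l * (sin (l * (\<psi> x - J x r)) * a' (x, r)))"
          using True by (simp add: c_def mult_ac)
        then show ?thesis using z by simp
      next
        case False
        then have "c x r * a' (x, r) = 0" for x
          using a'out[of "(x, r)"] by (auto simp: c_def)
        then show ?thesis by (simp only: Bochner_Integration.integral_zero)
      qed
    qed
    have "(LBINT x. LBINT r. c x r * a' (x, r)) = (LBINT r. LBINT x. c x r * a' (x, r))"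
      by (rule weighted(3)[of c, OF cm cb])
    also have "\<dots> = (LBINT (r::real). 0)"
      by (rule integral_cong_AE) (use inner borel_measurable_integrable[OF weighted(2)[of c, OF cm cb]] in auto)
    finally have zero: "(LBINT x. LBINT r. c x r * a' (x, r)) = 0" by simp
    have "AE x in lborel. integrable lborel (\<lambda>r. a' (x, r))"
      using lborel_pair.AE_integrable_fst'[OF a'i] .
    then have "AE x in lborel. (LBINT r. c x r * a' (x, r)) = indicator torus x * (cos (l * \<Psi> x t) - cos (l * \<Psi> x 0))"
      using potential[OF t] \<psi>eq
    proof eventually_elim
      case (elim x)
      have m: "(\<lambda>r. a' (x, r)) \<in> borel_measurable borel" by measurable
      have "set_integrable lborel {0..t} (\<lambda>r. a' (x, r))"
        unfolding set_integrable_def using elim(1) by (intro integrable_mult_indicator) auto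
      then have "cos_chain l (\<psi> x) t (\<lambda>r. a' (x, r))"
        using t m by (intro cos_chain_integrable) auto
      then have "cos (l * (\<psi> x - J x t)) - cos (l * \<psi> x) = (LBINT r. c x r * a' (x, r))"
        unfolding cos_chain_def J_def[symmetric] by (simp add: c_def set_lebesgue_integral_def mult_ac)
      then show ?case
        using elim Jout[of x t] by (cases "x \<in> torus") auto
    qed
    from lebesgue_on_via_lborel(3)[OF torus_sets(1) borel_measurable_integrable[OF weighted(1)[of c, OF cm cb], simplified] this] zero
    have "(LINT x|lebesgue_on torus. cos (l * \<Psi> x t) - cos (l * \<Psi> x 0)) = 0" by simp
    moreover have "integrable (lebesgue_on torus) (\<lambda>x. cos (l * \<Psi> x s))" if "s \<in> {0..<T}" for s
    proof -
      note [measurable] = L2_measurable[OF \<Psi>L2[OF that]]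
      show ?thesis by (rule torus.integrable_const_bound[where B = 1]) auto
    qed
    ultimately show ?thesis using t t0 by simp
  qed

  show ?thesis
    unfolding constant_on_def
  proof (intro exI ballI)
    fix t assume t: "t \<in> {0..<T}"
    have t0: "(0::real) \<in> {0..<T}" using \<open>T > 0\<close> by simp
    show "(LINT x|lebesgue_on torus. \<bar>\<Psi> x t\<bar>\<^sup>2) = (LINT x|lebesgue_on torus. (\<Psi> x 0)\<^sup>2)"
      unfolding power2_abs
      by (rule integral_square_eq_if_cos_eq[OF \<Psi>L2[OF t] \<Psi>L2[OF t0] cos_const[OF _ t]])
  qed
qed

end
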